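(* Let $F$ be a field of characteristic $p>0$ and let $\mathfrak F$ be a saturated formation of soluble Lie algebras over $F$. Let $(L,[p])$ be a finite-dimensional restricted Lie algebra over $F$ such that $z^{[p]}=0$ for every $z$ in the centre of $L$. Let $S$ be a nonzero subnormal subalgebra of $L$ with $S\in\mathfrak F$. Let $V$ and $W$ be finite-dimensional $L$-modules such that $\mathrm{cl}(W)\subseteq \mathbb F_p\,\mathrm{cl}(V)$, and suppose that $V$, regarded as an $S$-module, is $\mathfrak F$-hypercentral. Then $W$, regarded as an $S$-module, is $\mathfrak F$-hypercentral.
   Context: All Lie algebras and modules are finite-dimensional. A formation $\mathfrak F$ of soluble Lie algebras over $F$ is a class of soluble Lie algebras closed under homomorphic images and such that if $L/A, L/B\in\mathfrak F$ for ideals $A,B$ of $L$ then $L/(A\cap B)\in\mathfrak F$; it is saturated if $L/\Phi(L)\in\mathfrak F$ implies $L\in\mathfrak F$, where $\Phi(L)$ is the Frattini subalgebra (intersection of maximal subalgebras). A subalgebra $S$ of $L$ is subnormal if there is a chain $S=S_0\subseteq S_1\subseteq\cdots\subseteq S_n=L$ with each $S_{i}$ an ideal of $S_{i+1}$. For $S\in\mathfrak F$, an irreducible $S$-module $M$ is $\mathfrak F$-central if the split extension of $M$ (as an abelian ideal) by $S/C_S(M)$ belongs to $\mathfrak F$, where $C_S(M)$ is the centralizer of $M$ in $S$; an $S$-module is $\mathfrak F$-hypercentral if every composition factor of it is $\mathfrak F$-central. Let $\bar F$ be the algebraic closure of $F$. If $\rho$ is the representation of $L$ on an $L$-module $U$,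 then $U$ has character $\chi$, where $\chi: L\to \bar F$, if $\rho(x)^p-\rho(x^{[p]})$ acts as the scalar $\chi(x)^p$ for all $x\in L$ (on $\bar F\otimes U$); every irreducible module of $\bar F\otimes L$ has a character. The character cluster $\mathrm{cl}(U)$ of an $L$-module $U$ is the set of characters of the composition factors of $\bar F\otimes_F U$ (as a module for $\bar F\otimes L$, restricted to $L$). $\mathbb F_p$ denotes the field with $p$ elements and $\mathbb F_p\,\mathrm{cl}(V)$ denotes the set of $\mathbb F_p$-linear combinations of the elements of $\mathrm{cl}(V)$ (as functions on $L$). *)

theory Defs
  imports "HOL-Library.Function_Algebras" "HOL-Computational_Algebra.Polynomial"
begin

text \<open>All finite-dimensional vector spaces are realised inside the space of
  coordinate functions nat => field with bounded support (every finite-dimensional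
  Lie algebra / module is isomorphic to one of this form).\<close>

type_synonym 'a vec = "nat \<Rightarrow> 'a"

definition smult :: "'a::times \<Rightarrow> 'a vec \<Rightarrow> 'a vec" where
  "smult c f = (\<lambda>i. c * f i)"

definition vsupp :: "nat \<Rightarrow> ('a::zero) vec set" where
  "vsupp n = {f. \<forall>i\<ge>n. f i = 0}"

definition subsp :: "('a::field) vec set \<Rightarrow> bool" where
  "subsp X \<longleftrightarrow> 0 \<in> X \<and> (\<forall>x\<in>X. \<forall>y\<in>X. x + y \<in> X) \<and> (\<forall>c. \<forall>x\<in>X. smult c x \<in> X)"

definition fdsub :: "('a::field) vec set \<Rightarrow> bool" where
  "fdsub X \<longleftrightarrow> subsp X \<and> (\<exists>n. X \<subseteq> vsupp n)"

definition vspan :: "('a::field) vec set \<Rightarrow> 'a vec set" where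
  "vspan A = \<Inter>{T. subsp T \<and> A \<subseteq> T}"

definition linear_on :: "('a::field) vec set \<Rightarrow> ('a vec \<Rightarrow> 'a vec) \<Rightarrow> bool" where
  "linear_on X f \<longleftrightarrow> (\<forall>x\<in>X. \<forall>y\<in>X. f (x + y) = f x + f y) \<and> (\<forall>c. \<forall>x\<in>X. f (smult c x) = smult c (f x))"

type_synonym 'a br = "'a vec \<Rightarrow> 'a vec \<Rightarrow> 'a vec"

definition lie_alg :: "('a::field) vec set \<Rightarrow> 'a br \<Rightarrow> bool" where
  "lie_alg X b \<longleftrightarrow> fdsub X \<and> (\<forall>x\<in>X. \<forall>y\<in>X. b x y \<in> X)
     \<and> (\<forall>x\<in>X. linear_on X (b x)) \<and> (\<forall>y\<in>X. linear_on X (\<lambda>x. b x y))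
     \<and> (\<forall>x\<in>X. b x x = 0)
     \<and> (\<forall>x\<in>X. \<forall>y\<in>X. \<forall>z\<in>X. b x (b y z) + b y (b z x) + b z (b x y) = 0)"

definition subalg :: "('a::field) vec set \<Rightarrow> 'a vec set \<Rightarrow> 'a br \<Rightarrow> bool" where
  "subalg S X b \<longleftrightarrow> subsp S \<and> S \<subseteq> X \<and> (\<forall>x\<in>S. \<forall>y\<in>S. b x y \<in> S)"

definition ideal_of :: "('a::field) vec set \<Rightarrow> 'a vec set \<Rightarrow> 'a br \<Rightarrow> bool" where
  "ideal_of I Y b \<longleftrightarrow> subsp I \<and> I \<subseteq> Y \<and> (\<forall>x\<in>Y. \<forall>y\<in>I. b x y \<in> I)"

definition derived :: "'a br \<Rightarrow> ('a::field) vec set \<Rightarrow> 'a vec set" where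
  "derived b I = vspan {b x y | x y. x \<in> I \<and> y \<in> I}"

definition soluble :: "('a::field) vec set \<Rightarrow> 'a br \<Rightarrow> bool" where
  "soluble X b \<longleftrightarrow> (\<exists>k. (derived b ^^ k) X = {0})"

definition max_subalg :: "('a::field) vec set \<Rightarrow> 'a vec set \<Rightarrow> 'a br \<Rightarrow> bool" where
  "max_subalg M X b \<longleftrightarrow> subalg M X b \<and> M \<noteq> X \<and>
     (\<forall>T. subalg T X b \<and> M \<subseteq> T \<longrightarrow> T = M \<or> T = X)"

text \<open>Frattini subalgebra: intersection of the maximal subalgebras (= X if there are none).\<close>
definition frattini :: "('a::field) vec set \<Rightarrow> 'a br \<Rightarrow> 'a vec set" where
  "frattini X b = X \<inter> \<Inter>{M. max_subalg M X b}"

definition lie_hom :: "('a::field) vec set \<Rightarrow> 'a br \<Rightarrow> 'a vec set \<Rightarrow> 'a br \<Rightarrow> ('a vec \<Rightarrow> 'a vec) \<Rightarrow> bool" where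
  "lie_hom X b Y c f \<longleftrightarrow> linear_on X f \<and> f ` X \<subseteq> Y \<and> (\<forall>x\<in>X. \<forall>y\<in>X. f (b x y) = c (f x) (f y))"

definition surj_hom :: "('a::field) vec set \<Rightarrow> 'a br \<Rightarrow> 'a vec set \<Rightarrow> 'a br \<Rightarrow> ('a vec \<Rightarrow> 'a vec) \<Rightarrow> bool" where
  "surj_hom X b Y c f \<longleftrightarrow> lie_hom X b Y c f \<and> f ` X = Y"

definition kern :: "('a::zero) vec set \<Rightarrow> ('a vec \<Rightarrow> 'a vec) \<Rightarrow> 'a vec set" where
  "kern X f = {x\<in>X. f x = 0}"

text \<open>A class of (finite-dimensional) Lie algebras over the field is a set of pairs
  (carrier, bracket) in coordinate form.  Quotients L/A are represented by surjective
  homomorphisms with kernel A.\<close>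

type_synonym 'a lie_class = "('a vec set \<times> 'a br) set"

definition formation :: "('a::field) lie_class \<Rightarrow> bool" where
  "formation FF \<longleftrightarrow>
     (\<forall>(X, b) \<in> FF. lie_alg X b \<and> soluble X b)
   \<and> (\<forall>X b Y c f. (X, b) \<in> FF \<longrightarrow> lie_alg Y c \<longrightarrow> surj_hom X b Y c f \<longrightarrow> (Y, c) \<in> FF)
   \<and> (\<forall>X b Y1 c1 f1 Y2 c2 f2 Y c f.
        lie_alg X b \<longrightarrow> lie_alg Y1 c1 \<longrightarrow> lie_alg Y2 c2 \<longrightarrow> lie_alg Y c \<longrightarrow>
        surj_hom X b Y1 c1 f1 \<longrightarrow> surj_hom X b Y2 c2 f2 \<longrightarrow> surj_hom X b Y c f \<longrightarrow>
        (Y1, c1) \<in> FF \<longrightarrow> (Y2, c2) \<in> FF \<longrightarrow>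
        kern X f = kern X f1 \<inter> kern X f2 \<longrightarrow> (Y, c) \<in> FF)"

definition saturated :: "('a::field) lie_class \<Rightarrow> bool" where
  "saturated FF \<longleftrightarrow>
     (\<forall>X b Y c f. lie_alg X b \<longrightarrow> lie_alg Y c \<longrightarrow> surj_hom X b Y c f \<longrightarrow>
        kern X f = frattini X b \<longrightarrow> (Y, c) \<in> FF \<longrightarrow> (X, b) \<in> FF)"

definition subnormal :: "('a::field) vec set \<Rightarrow> 'a vec set \<Rightarrow> 'a br \<Rightarrow> bool" where
  "subnormal S X b \<longleftrightarrow> (\<exists>Ss. Ss \<noteq> [] \<and> hd Ss = S \<and> last Ss = X \<and>
     (\<forall>T\<in>set Ss. subalg T X b) \<and>
     (\<forall>i. Suc i < length Ss \<longrightarrow> ideal_of (Ss ! i) (Ss ! Suc i) b))"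

definition ad_word :: "'a br \<Rightarrow> 'a vec \<Rightarrow> 'a vec \<Rightarrow> bool list \<Rightarrow> 'a vec \<Rightarrow> 'a vec" where
  "ad_word b x y us v = foldr (\<lambda>u w. b (if u then x else y) w) us v"

text \<open>Jacobson's sum  s_1(x,y) + ... + s_{p-1}(x,y), where i s_i(x,y) is the coefficient
  of t^(i-1) in ad(t x + y)^(p-1) (x).\<close>
definition jacobson_sum :: "nat \<Rightarrow> ('a::field) br \<Rightarrow> 'a vec \<Rightarrow> 'a vec \<Rightarrow> 'a vec" where
  "jacobson_sum p b x y = (\<Sum>i\<in>{1..p-1}. smult (inverse (of_nat i))
      (\<Sum>us\<in>{us. length us = p - 1 \<and> count_list us True = i - 1}. ad_word b x y us x))"

definition restricted :: "nat \<Rightarrow> ('a::field) vec set \<Rightarrow> 'a br \<Rightarrow> ('a vec \<Rightarrow> 'a vec) \<Rightarrow> bool" where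
  "restricted p X b pm \<longleftrightarrow> (\<forall>x\<in>X. pm x \<in> X)
     \<and> (\<forall>c. \<forall>x\<in>X. pm (smult c x) = smult (c ^ p) (pm x))
     \<and> (\<forall>x\<in>X. \<forall>y\<in>X. b (pm x) y = (b x ^^ p) y)
     \<and> (\<forall>x\<in>X. \<forall>y\<in>X. pm (x + y) = pm x + pm y + jacobson_sum p b x y)"

definition centre :: "('a::field) vec set \<Rightarrow> 'a br \<Rightarrow> 'a vec set" where
  "centre X b = {z\<in>X. \<forall>y\<in>X. b z y = 0}"

definition lie_mod :: "('a::field) vec set \<Rightarrow> 'a br \<Rightarrow> nat \<Rightarrow> ('a vec \<Rightarrow> 'a vec \<Rightarrow> 'a vec) \<Rightarrow> bool" where
  "lie_mod X b n \<rho> \<longleftrightarrow>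
     (\<forall>x\<in>X. linear_on (vsupp n) (\<rho> x) \<and> \<rho> x ` vsupp n \<subseteq> vsupp n)
   \<and> (\<forall>x\<in>X. \<forall>y\<in>X. \<forall>v\<in>vsupp n. \<rho> (x + y) v = \<rho> x v + \<rho> y v)
   \<and> (\<forall>c. \<forall>x\<in>X. \<forall>v\<in>vsupp n. \<rho> (smult c x) v = smult c (\<rho> x v))
   \<and> (\<forall>x\<in>X. \<forall>y\<in>X. \<forall>v\<in>vsupp n. \<rho> (b x y) v = \<rho> x (\<rho> y v) - \<rho> y (\<rho> x v))"

definition submod :: "'x set \<Rightarrow> ('x \<Rightarrow> ('k::field) vec \<Rightarrow> 'k vec) \<Rightarrow> 'k vec set \<Rightarrow> 'k vec set \<Rightarrow> bool" where
  "submod S \<rho> U N \<longleftrightarrow> subsp N \<and> N \<subseteq> U \<and> (\<forall>x\<in>S. \<forall>v\<in>N. \<rho> x v \<in> N)"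

definition comp_series :: "'x set \<Rightarrow> ('x \<Rightarrow> ('k::field) vec \<Rightarrow> 'k vec) \<Rightarrow> 'k vec set \<Rightarrow> 'k vec set list \<Rightarrow> bool" where
  "comp_series S \<rho> U Ns \<longleftrightarrow> Ns \<noteq> [] \<and> hd Ns = {0} \<and> last Ns = U \<and>
     (\<forall>N\<in>set Ns. submod S \<rho> U N) \<and>
     (\<forall>i. Suc i < length Ns \<longrightarrow> Ns ! i \<subset> Ns ! Suc i \<and>
        \<not> (\<exists>T. submod S \<rho> U T \<and> Ns ! i \<subset> T \<and> T \<subset> Ns ! Suc i))"

definition vjoin :: "nat \<Rightarrow> ('a::zero) vec \<Rightarrow> 'a vec \<Rightarrow> 'a vec" where
  "vjoin m q x = (\<lambda>i. if i < m then q i else x (i - m))"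

definition vfst :: "nat \<Rightarrow> ('a::zero) vec \<Rightarrow> 'a vec" where
  "vfst m u = (\<lambda>i. if i < m then u i else 0)"

definition vsnd :: "nat \<Rightarrow> ('a::zero) vec \<Rightarrow> 'a vec" where
  "vsnd m u = (\<lambda>i. u (i + m))"

text \<open>The composition factor N'/N of the S-module is realised as Q (coordinate
  space inside vsupp m) via a linear surjection pi from N' with kernel N.  Its split
  extension Q x| (S / C_S(N'/N)) is realised as the image of the semidirect product
  Q x| S (encoded by vjoin m) under a surjective homomorphism with kernel 0 x C_S.\<close>
definition fcentral_factor :: "('a::field) lie_class \<Rightarrow> 'a vec set \<Rightarrow> 'a br \<Rightarrow>
    ('a vec \<Rightarrow> 'a vec \<Rightarrow> 'a vec) \<Rightarrow> 'a vec set \<Rightarrow> 'a vec set \<Rightarrow> bool" where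
  "fcentral_factor FF S b \<rho> N N' \<longleftrightarrow>
    (\<exists>m Q \<pi>. subsp Q \<and> Q \<subseteq> vsupp m \<and> linear_on N' \<pi> \<and> \<pi> ` N' = Q \<and> kern N' \<pi> = N \<and>
      (let \<sigma> = (\<lambda>x q. \<pi> (\<rho> x (SOME v. v \<in> N' \<and> \<pi> v = q)));
           C = {x\<in>S. \<forall>v\<in>N'. \<rho> x v \<in> N};
           SD = {vjoin m q x | q x. q \<in> Q \<and> x \<in> S};
           bSD = (\<lambda>u w. vjoin m (\<sigma> (vsnd m u) (vfst m w) - \<sigma> (vsnd m w) (vfst m u))
                                (b (vsnd m u) (vsnd m w)))
       in \<exists>Y c f. lie_alg Y c \<and> surj_hom SD bSD Y c f \<and>
            kern SD f = {vjoin m 0 x | x. x \<in> C} \<and> (Y, c) \<in> FF))"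

definition fhypercentral :: "('a::field) lie_class \<Rightarrow> 'a vec set \<Rightarrow> 'a br \<Rightarrow> nat \<Rightarrow>
    ('a vec \<Rightarrow> 'a vec \<Rightarrow> 'a vec) \<Rightarrow> bool" where
  "fhypercentral FF S b n \<rho> \<longleftrightarrow>
    (\<forall>Ns. comp_series S \<rho> (vsupp n) Ns \<longrightarrow>
       (\<forall>i. Suc i < length Ns \<longrightarrow> fcentral_factor FF S b \<rho> (Ns ! i) (Ns ! Suc i)))"

definition is_alg_closure :: "('a::field \<Rightarrow> 'k::field) \<Rightarrow> bool" where
  "is_alg_closure emb \<longleftrightarrow>
     (\<forall>x y. emb (x + y) = emb x + emb y) \<and> (\<forall>x y. emb (x * y) = emb x * emb y) \<and> emb 1 = 1
   \<and> (\<forall>q :: 'k poly. degree q > 0 \<longrightarrow> (\<exists>z. poly q z = 0))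
   \<and> (\<forall>z. \<exists>q :: 'a poly. q \<noteq> 0 \<and> poly (map_poly emb q) z = 0)"

definition unitv :: "nat \<Rightarrow> ('a::{zero,one}) vec" where
  "unitv j = (\<lambda>i. if i = j then 1 else 0)"

text \<open>Extension of scalars: the action on Fbar (x) F^n = Fbar^n, by the same matrices.\<close>
definition ext_action :: "('a::field \<Rightarrow> 'k::field) \<Rightarrow> nat \<Rightarrow> ('a vec \<Rightarrow> 'a vec \<Rightarrow> 'a vec) \<Rightarrow>
    'a vec \<Rightarrow> 'k vec \<Rightarrow> 'k vec" where
  "ext_action emb n \<rho> x g = (\<lambda>i. if i < n then (\<Sum>j<n. emb (\<rho> x (unitv j) i) * g j) else 0)"

definition has_character :: "nat \<Rightarrow> 'x set \<Rightarrow> ('x \<Rightarrow> 'x) \<Rightarrow> ('x \<Rightarrow> ('k::field) vec \<Rightarrow> 'k vec) \<Rightarrow>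
    'k vec set \<Rightarrow> 'k vec set \<Rightarrow> ('x \<Rightarrow> 'k) \<Rightarrow> bool" where
  "has_character p X pm \<rho> N N' \<chi> \<longleftrightarrow>
     (\<forall>x\<in>X. \<forall>v\<in>N'. (\<rho> x ^^ p) v - \<rho> (pm x) v - smult (\<chi> x ^ p) v \<in> N)"

definition char_cluster :: "nat \<Rightarrow> ('a::field \<Rightarrow> 'k::field) \<Rightarrow> 'a vec set \<Rightarrow> ('a vec \<Rightarrow> 'a vec) \<Rightarrow>
    nat \<Rightarrow> ('a vec \<Rightarrow> 'a vec \<Rightarrow> 'a vec) \<Rightarrow> ('a vec \<Rightarrow> 'k) set" where
  "char_cluster p emb X pm n \<rho> =
     {\<chi>. (\<forall>x. x \<notin> X \<longrightarrow> \<chi> x = 0) \<and>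
        (\<exists>Ns i. comp_series X (ext_action emb n \<rho>) (vsupp n) Ns \<and> Suc i < length Ns \<and>
           has_character p X pm (ext_action emb n \<rho>) (Ns ! i) (Ns ! Suc i) \<chi>)}"

text \<open>F_p-linear combinations (integer multiples suffice in characteristic p).\<close>
definition Fp_span :: "('x \<Rightarrow> 'k::field) set \<Rightarrow> ('x \<Rightarrow> 'k) set" where
  "Fp_span A = {f. \<exists>B k. finite B \<and> B \<subseteq> A \<and> f = (\<lambda>x. \<Sum>\<chi>\<in>B. of_nat (k \<chi>) * \<chi> x)}"

end

theory Submission
  imports Defs "HOL-Library.Nat_Bijection" "HOL-Library.Multiset" "HOL-Computational_Algebra.Primes"
begin

text \<open>
  Write \<open>HH U\<close> when the semidirect product of \<open>S\<close> with a module \<open>U\<close> lies in the formation. For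
  \<open>S\<close> in the formation this is the same as \<open>U\<close> being hypercentral, and it is inherited by
  submodules, quotients, direct sums and extensions; saturation replaces cohomology in the
  case of extensions. It is also inherited by tensor products, because in a
  suitable extension of the semidirect products the tensor product lies in the Frattini subalgebra.
  As \<open>S\<close> is subnormal, it acts trivially on the factors of a subnormal chain from \<open>S\<close> to
  \<open>L\<close>, so the adjoint module of \<open>L\<close> satisfies \<open>HH\<close> as well.

  Matrix coefficients of modules with \<open>HH\<close> are functions on words in \<open>L\<close>. They are closed under the
  shuffle product (tensor products), and shuffling adds characters: \<open>x^p - x^[p]\<close> is primitive because
  the prefix operators are derivations of the shuffle algebra. So every \<open>F\<^sub>p\<close>-combination \<open>\<chi>\<close> of
  characters of \<open>V\<close> is the character of a coefficient \<open>\<Psi>\<close>.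

  Functionals on \<open>L\<close> modulo its centre are coefficients of the adjoint module, on which the
  centre and all \<open>x^p - x^[p]\<close> act as \<open>0\<close>. Since \<open>z^[p] = 0\<close> for central \<open>z\<close>, the centre acts on
  a composition factor with character \<open>\<chi>\<close> through \<open>\<chi>\<close>. Rewriting as in the
  Poincare-Birkhoff-Witt theorem expresses every element of the enveloping algebra through ordered
  monomials in a basis of \<open>L\<close> modulo the centre, with exponents below \<open>p\<close> and with coefficients
  in the subalgebra generated by the \<open>x^p - x^[p]\<close> and the centre. If such an element kills a
  vector of a module with \<open>HH\<close> that has \<open>\<Psi>\<close> and its shuffle products with the dual
  functionals among its coefficients, then its own coefficients vanish at \<open>\<chi>\<close>. If this happens
  for all characters of \<open>W\<close>, these central coefficients are nilpotent on \<open>W\<close>, hence \<open>0\<close> on its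
  irreducible factors. So every irreducible factor of \<open>W\<close> is a quotient of a cyclic submodule of
  a module with \<open>HH\<close>.
\<close>

section \<open>Linear algebra\<close>

text \<open>The formation lives over the ground field, the characters over its algebraic closure, so
  an irreducible module over the closure cannot itself enter the semidirect products of the class.
  Scalars are therefore extended only in the functionals: modules stay over the ground field, and
  closure-valued functionals on them produce the word functions that carry characters. The
  hypothesis on clusters gives no map between \<open>V\<close> and \<open>W\<close>. What can be
  transferred is an inclusion of annihilators, from a vector \<open>m\<close> of an auxiliary module
  to a vector of \<open>W\<close> modulo a submodule, and such an inclusion is what lets a cyclic
  module map onto a factor of \<open>W\<close>. The bound \<open>p\<close> on exponents serves
  twice: higher powers are rewritten through \<open>x^p - x^[p]\<close>, and the factorials of the
  remaining exponents are units, so that shuffle products of dual functionals separate the ordered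
  monomials. The condition on the centre makes up for the adjoint module being blind to central
  elements: with \<open>z^[p] = 0\<close> their action on a factor is determined by the
  character.\<close>

text \<open>Pointwise evaluation is kept out of the simpset: unification leaves eta-expanded terms of
  function type behind, on which these rules would fire.\<close>

lemma smult_apply: "smult c f i = c * f i"
  by (simp add: smult_def)

lemmas pointwise = plus_fun_apply zero_fun_apply minus_apply uminus_apply smult_apply
declare plus_fun_apply [simp del] zero_fun_apply [simp del] minus_apply [simp del] uminus_apply [simp del]

lemma smult_simps [simp]:
  fixes f g :: "('a::field) vec"
  shows "smult c (0::'a vec) = 0" "smult 0 f = 0" "smult 1 f = f"
    "smult c (smult d f) = smult (c * d) f"
    "smult c (- f) = - smult c f" "smult (- c) f = - smult c f"
  by (auto simp: fun_eq_iff pointwise)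

lemma smult_distrib:
  fixes f g :: "('a::field) vec"
  shows "smult c (f + g) = smult c f + smult c g" "smult (c + d) f = smult c f + smult d f"
    "smult c (f - g) = smult c f - smult c g" "smult (c - d) f = smult c f - smult d f"
  by (auto simp: fun_eq_iff pointwise algebra_simps)

lemma smult_sum: "smult c (\<Sum>i\<in>I. f i :: ('a::field) vec) = (\<Sum>i\<in>I. smult c (f i))"
  by (induction I rule: infinite_finite_induct) (simp_all add: smult_distrib)

lemma sum_apply: "(\<Sum>i\<in>I. f i :: 'b \<Rightarrow> 'c::comm_monoid_add) x = (\<Sum>i\<in>I. f i x)"
  by (induction I rule: infinite_finite_induct) (auto simp: pointwise)

lemma subsp_0 [simp]: "subsp X \<Longrightarrow> 0 \<in> X"
  and subsp_add: "subsp X \<Longrightarrow> x \<in> X \<Longrightarrow> y \<in> X \<Longrightarrow> x + y \<in> X"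
  and subsp_smult: "subsp X \<Longrightarrow> x \<in> X \<Longrightarrow> smult c x \<in> X"
  by (auto simp: subsp_def)

lemma subsp_minus: "subsp X \<Longrightarrow> x \<in> X \<Longrightarrow> - x \<in> X"
  using subsp_smult[of X x "-1"] by simp

lemma subsp_diff: "subsp X \<Longrightarrow> x \<in> X \<Longrightarrow> y \<in> X \<Longrightarrow> x - y \<in> X"
  using subsp_add[of X x "-y"] subsp_minus[of X y] by simp

lemma subsp_sum: "subsp X \<Longrightarrow> (\<And>i. i \<in> I \<Longrightarrow> f i \<in> X) \<Longrightarrow> (\<Sum>i\<in>I. f i) \<in> X"
  by (induction I rule: infinite_finite_induct) (auto simp: subsp_add)

lemma subspI:
  assumes "0 \<in> X" "\<And>x y. x \<in> X \<Longrightarrow> y \<in> X \<Longrightarrow> x + y \<in> X" "\<And>c x. x \<in> X \<Longrightarrow> smult c x \<in> X"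
  shows "subsp X"
  using assms by (auto simp: subsp_def)

lemma subsp_Int: "subsp X \<Longrightarrow> subsp Y \<Longrightarrow> subsp (X \<inter> Y)"
  by (auto simp: subsp_def)

lemma subsp_vsupp [simp]: "subsp (vsupp n :: ('a::field) vec set)"
  by (auto simp: subsp_def vsupp_def pointwise)

lemma subsp_zero [simp]: "subsp {0 :: ('a::field) vec}"
  by (auto simp: subsp_def)

lemma subsp_sums:
  assumes "subsp A" "subsp B" shows "subsp {a + b | a b. a \<in> A \<and> b \<in> B}"
proof (rule subspI)
  show "0 \<in> {a + b | a b. a \<in> A \<and> b \<in> B}"
    using assms by (auto intro!: exI[of _ 0])
next
  fix x y assume "x \<in> {a + b | a b. a \<in> A \<and> b \<in> B}" "y \<in> {a + b | a b. a \<in> A \<and> b \<in> B}"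
  then obtain a b a' b' where "x = a + b" "y = a' + b'" "a \<in> A" "b \<in> B" "a' \<in> A" "b' \<in> B" by auto
  then have "x + y = (a + a') + (b + b')" "a + a' \<in> A" "b + b' \<in> B"
    using assms by (auto simp: subsp_add)
  then show "x + y \<in> {a + b | a b. a \<in> A \<and> b \<in> B}" by blast
next
  fix c x assume "x \<in> {a + b | a b. a \<in> A \<and> b \<in> B}"
  then obtain a b where "x = a + b" "a \<in> A" "b \<in> B" by auto
  then have "smult c x = smult c a + smult c b" "smult c a \<in> A" "smult c b \<in> B"
    using assms by (auto simp: subsp_smult smult_distrib)
  then show "smult c x \<in> {a + b | a b. a \<in> A \<and> b \<in> B}" by blast
qed

lemma vspan_superset: "A \<subseteq> vspan A"
  and subsp_vspan [simp]: "subsp (vspan A)"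
  and vspan_min: "subsp T \<Longrightarrow> A \<subseteq> T \<Longrightarrow> vspan A \<subseteq> T"
  by (auto simp: vspan_def subsp_def)

lemma linear_onI:
  assumes "\<And>x y. x \<in> X \<Longrightarrow> y \<in> X \<Longrightarrow> f (x + y) = f x + f y" "\<And>c x. x \<in> X \<Longrightarrow> f (smult c x) = smult c (f x)"
  shows "linear_on X f"
  using assms by (auto simp: linear_on_def)

lemma lin_add: "linear_on X f \<Longrightarrow> x \<in> X \<Longrightarrow> y \<in> X \<Longrightarrow> f (x + y) = f x + f y"
  and lin_smult: "linear_on X f \<Longrightarrow> x \<in> X \<Longrightarrow> f (smult c x) = smult c (f x)"
  by (auto simp: linear_on_def)

lemma lin_0: "linear_on X f \<Longrightarrow> subsp X \<Longrightarrow> f 0 = 0"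
  using lin_smult[of X f 0 0] by simp

lemma lin_minus: "linear_on X f \<Longrightarrow> x \<in> X \<Longrightarrow> f (- x) = - f x"
  using lin_smult[of X f x "-1"] by simp

lemma lin_diff: "linear_on X f \<Longrightarrow> subsp X \<Longrightarrow> x \<in> X \<Longrightarrow> y \<in> X \<Longrightarrow> f (x - y) = f x - f y"
  using lin_add[of X f x "- y"] lin_minus[of X f y] subsp_minus[of X y] by simp

lemma lin_sum: "linear_on X f \<Longrightarrow> subsp X \<Longrightarrow> (\<And>i. i \<in> I \<Longrightarrow> g i \<in> X) \<Longrightarrow> f (\<Sum>i\<in>I. g i) = (\<Sum>i\<in>I. f (g i))"
  by (induction I rule: infinite_finite_induct) (auto simp: lin_0 lin_add subsp_sum)

lemma linear_on_subset: "linear_on X f \<Longrightarrow> Y \<subseteq> X \<Longrightarrow> linear_on Y f"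
  unfolding linear_on_def by blast

lemma linear_on_comp: "linear_on X f \<Longrightarrow> linear_on Y g \<Longrightarrow> f ` X \<subseteq> Y \<Longrightarrow> linear_on X (\<lambda>x. g (f x))"
  by (auto simp: linear_on_def image_subset_iff)

lemma subsp_image:
  assumes "subsp X" "linear_on X f" shows "subsp (f ` X)"
proof (rule subspI)
  show "0 \<in> f ` X" using lin_0[OF assms(2,1)] subsp_0[OF assms(1)] by (metis imageI)
next
  fix x y assume "x \<in> f ` X" "y \<in> f ` X"
  then show "x + y \<in> f ` X" using assms by (auto simp: lin_add[symmetric] subsp_add)
next
  fix c x assume "x \<in> f ` X"
  then show "smult c x \<in> f ` X" using assms by (auto simp: lin_smult[symmetric] subsp_smult)
qed

lemma subsp_vimage:
  assumes "subsp X" "linear_on X f" "subsp T" shows "subsp {x \<in> X. f x \<in> T}"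
  using assms lin_0[OF assms(2,1)] by (intro subspI) (simp_all add: subsp_add subsp_smult lin_add[OF assms(2)] lin_smult[OF assms(2)])

lemma subsp_kern: "subsp X \<Longrightarrow> linear_on X f \<Longrightarrow> subsp (kern X f)"
  using subsp_vimage[of X f "{0}"] by (simp add: kern_def)

text \<open>\<open>f\<close> is the projection along \<open>N\<close> onto a complement, so it
  vanishes exactly on \<open>N\<close> and its image models the quotient inside the same coordinate
  space. The ambient space of all functions is infinite-dimensional, hence the basis
  extension.\<close>

lemma ex_projection:
  assumes "subsp (N :: ('a::field) vec set)"
  obtains f where "linear_on UNIV f" "\<And>x. f x - x \<in> N" "\<And>x. x \<in> N \<Longrightarrow> f x = 0"
proof -
  interpret vec: vector_space "smult :: 'a \<Rightarrow> 'a vec \<Rightarrow> 'a vec"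
    by unfold_locales (auto simp: smult_distrib)
  interpret vec: vector_space_pair "smult :: 'a \<Rightarrow> 'a vec \<Rightarrow> 'a vec" "smult :: 'a \<Rightarrow> 'a vec \<Rightarrow> 'a vec"
    by unfold_locales
  have sub: "vec.subspace N" using assms by (auto simp: subsp_def vec.subspace_def)
  have zero: "0 \<in> N" using assms by simp
  obtain B where B: "B \<subseteq> N" "vec.independent B" "N \<subseteq> vec.span B"
    using vec.maximal_independent_subset[of N] by auto
  let ?E = "vec.extend_basis B"
  have E: "vec.independent ?E" "B \<subseteq> ?E" "vec.span ?E = UNIV"
    using vec.independent_extend_basis vec.extend_basis_superset vec.span_extend_basis B by auto
  obtain g where g: "Vector_Spaces.linear smult smult g" "\<And>x. x \<in> ?E \<Longrightarrow> g x = (if x \<in> B then 0 else x)"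
    using vec.linear_independent_extend[OF E(1), of "\<lambda>x. if x \<in> B then 0 else x"] by auto
  have NB: "vec.span B = N"
    using B sub by (metis vec.span_minimal subset_antisym)
  have g0: "g 0 = 0" using g(1) vec.linear_0 by blast
  have lin: "linear_on UNIV g"
    using g(1) by (auto intro!: linear_onI simp: vec.linear_add vec.linear_scale)
  have "g x - x \<in> N" for x
  proof -
    have "x \<in> vec.span ?E" using E by simp
    then show ?thesis
    proof (induction rule: vec.span_induct_alt)
      case base
      then show ?case using zero g0 by (metis diff_zero)
    next
      case (step c x y)
      have "g x - x \<in> N" using g(2)[OF step(1)] B assms
        by (auto simp: subsp_minus)
      then have "smult c (g x - x) + (g y - y) \<in> N"
        using step assms by (auto intro: subsp_add subsp_smult)
      also have "smult c (g x - x) + (g y - y) = g (smult c x + y) - (smult c x + y)"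
        using lin by (simp add: lin_add lin_smult smult_distrib)
      finally show ?case .
    qed
  qed
  moreover have "g x = 0" if "x \<in> N" for x
  proof -
    have "x \<in> vec.span B" using that NB by simp
    then show ?thesis
    proof (induction rule: vec.span_induct_alt)
      case base
      then show ?case using g0 .
    next
      case (step c x y)
      then show ?case using lin g(2) E(2) by (auto simp: lin_add lin_smult)
    qed
  qed
  ultimately show ?thesis using that lin by blast
qed

text \<open>The number of leading positions serves as the dimension of a subspace.\<close>

definition vdim :: "('a::field) vec set \<Rightarrow> nat" where
  "vdim N = card {i. \<exists>v\<in>N. v i \<noteq> 0 \<and> (\<forall>j>i. v j = 0)}"

lemma vdim_le:
  assumes "N \<subseteq> vsupp n" shows "vdim N \<le> n"
proof -
  have "{i. \<exists>v\<in>N. v i \<noteq> 0 \<and> (\<forall>j>i. v j = 0)} \<subseteq> {..<n}"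
    using assms by (force simp: vsupp_def not_le)
  then show ?thesis unfolding vdim_def using card_mono[of "{..<n}"] by simp
qed

text \<open>Elimination from the top: if every leading position of \<open>N'\<close> also occurred
  in \<open>N\<close>, subtracting multiples of vectors of \<open>N\<close> would reduce any vector
  of \<open>N'\<close> to zero, and \<open>N'\<close> would lie in \<open>N\<close>.\<close>

lemma vdim_less:
  assumes N: "subsp N" and N': "subsp N'" and sub: "N \<subset> N'" and n: "N' \<subseteq> vsupp n"
  shows "vdim N < vdim N'"
proof -
  let ?p = "\<lambda>N. {i. \<exists>v\<in>N. v i \<noteq> 0 \<and> (\<forall>j>i. v j = (0::'a))}"
  have "v \<in> N" if eq: "?p N' \<subseteq> ?p N" and v: "v \<in> N'" "v \<in> vsupp m" for v m
    using v
  proof (induction m arbitrary: v)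
    case 0
    then have "v = 0" by (auto simp: vsupp_def pointwise)
    then show ?case using N by simp
  next
    case (Suc m)
    show ?case
    proof (cases "v m = 0")
      case True
      have "v \<in> vsupp m"
        using Suc.prems(2) True by (auto simp: vsupp_def) (metis le_antisym not_less_eq_eq)
      then show ?thesis using Suc by blast
    next
      case False
      then have "m \<in> ?p N'" using Suc.prems by (auto simp: vsupp_def Suc_le_eq)
      then obtain w where w: "w \<in> N" "w m \<noteq> 0" "\<forall>j>m. w j = 0" using eq by blast
      let ?u = "v - smult (v m / w m) w"
      have "?u j = 0" if "j \<ge> m" for j
        using that w Suc.prems(2) by (cases "j = m") (auto simp: vsupp_def pointwise)
      then have "?u \<in> vsupp m" by (auto simp: vsupp_def)
      moreover have "?u \<in> N'" using N' Suc.prems w sub by (auto intro!: subsp_diff subsp_smult)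
      ultimately have "?u \<in> N" using Suc.IH by blast
      then show ?thesis using N w by (metis diff_add_cancel subsp_add subsp_smult)
    qed
  qed
  then have "\<not> ?p N' \<subseteq> ?p N" using sub n by blast
  moreover have "?p N \<subseteq> ?p N'" using sub by blast
  moreover have "finite (?p N')"
    by (rule finite_subset[of _ "{..<n}"]) (use n in \<open>force simp: vsupp_def not_le\<close>, simp)
  ultimately show ?thesis unfolding vdim_def by (intro psubset_card_mono) auto
qed

text \<open>Interleaving makes \<open>pr\<close> a bijection on all functions independently of any
  support bound, so iterated semidirect products can be formed without tracking dimensions.\<close>

definition pr :: "'a vec \<Rightarrow> 'a vec \<Rightarrow> 'a vec" where
  "pr u v = (\<lambda>i. if even i then u (i div 2) else v (i div 2))"

definition p1 :: "'a vec \<Rightarrow> 'a vec" where "p1 f = (\<lambda>i. f (2 * i))"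
definition p2 :: "'a vec \<Rightarrow> 'a vec" where "p2 f = (\<lambda>i. f (Suc (2 * i)))"

lemma p1_pr [simp]: "p1 (pr u v) = u" and p2_pr [simp]: "p2 (pr u v) = v"
  by (auto simp: p1_def p2_def pr_def)

lemma pr_p [simp]: "pr (p1 f) (p2 f) = f"
  by (auto simp: p1_def p2_def pr_def fun_eq_iff elim!: evenE oddE)

lemma pr_eq_iff: "f = g \<longleftrightarrow> p1 f = p1 g \<and> p2 f = p2 g"
  by (metis pr_p)

lemma pr_eqI: "p1 f = p1 g \<Longrightarrow> p2 f = p2 g \<Longrightarrow> f = g"
  by (metis pr_p)

lemma p_linear [simp]:
  fixes f g :: "('a::field) vec"
  shows "p1 (f + g) = p1 f + p1 g" "p2 (f + g) = p2 f + p2 g"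
    "p1 (f - g) = p1 f - p1 g" "p2 (f - g) = p2 f - p2 g"
    "p1 (- f) = - p1 f" "p2 (- f) = - p2 f"
    "p1 (smult c f) = smult c (p1 f)" "p2 (smult c f) = smult c (p2 f)"
    "p1 (0 :: 'a vec) = 0" "p2 (0 :: 'a vec) = 0"
  by (auto simp: p1_def p2_def fun_eq_iff pointwise)

definition PR :: "'a vec set \<Rightarrow> 'a vec set \<Rightarrow> 'a vec set" where
  "PR A B = {f. p1 f \<in> A \<and> p2 f \<in> B}"

lemma mem_PR [simp]: "f \<in> PR A B \<longleftrightarrow> p1 f \<in> A \<and> p2 f \<in> B"
  by (simp add: PR_def)

lemma fdsub_PR:
  assumes "fdsub A" "fdsub B" shows "fdsub (PR A B)"
proof -
  obtain n m where nm: "A \<subseteq> vsupp n" "B \<subseteq> vsupp m" using assms by (auto simp: fdsub_def)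
  have "PR A B \<subseteq> vsupp (2 * max n m)"
  proof
    fix f assume f: "f \<in> PR A B"
    have "f i = 0" if "i \<ge> 2 * max n m" for i
    proof (cases "even i")
      case True
      then obtain k where k: "i = 2 * k" by (elim evenE)
      then have "p1 f k = 0" using f nm that by (auto simp: vsupp_def subset_iff)
      then show ?thesis using k by (simp add: p1_def)
    next
      case False
      then obtain k where k: "i = Suc (2 * k)" by (elim oddE) simp
      then have "p2 f k = 0" using f nm that by (auto simp: vsupp_def subset_iff)
      then show ?thesis using k by (simp add: p2_def)
    qed
    then show "f \<in> vsupp (2 * max n m)" by (auto simp: vsupp_def)
  qed
  moreover have "subsp (PR A B)"
    using assms by (auto intro!: subspI simp: fdsub_def subsp_add subsp_smult)
  ultimately show ?thesis by (auto simp: fdsub_def)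
qed

lemma fdsub_subset: "fdsub X \<Longrightarrow> subsp Y \<Longrightarrow> Y \<subseteq> X \<Longrightarrow> fdsub Y"
  by (auto simp: fdsub_def)

lemma ex_max_subspace:
  assumes X: "fdsub X" and P: "P N0" "\<And>N. P N \<Longrightarrow> subsp N \<and> N \<subseteq> X"
  obtains N where "P N" "\<And>N'. P N' \<Longrightarrow> N \<subseteq> N' \<Longrightarrow> N' = N"
proof -
  obtain n where n: "X \<subseteq> vsupp n" using X by (auto simp: fdsub_def)
  have "\<forall>N. P N \<longrightarrow> vdim N < Suc n" using P(2) n vdim_le by (meson le_imp_less_Suc order_trans)
  with P(1) obtain N where N: "P N" "\<And>N'. P N' \<Longrightarrow> vdim N' \<le> vdim N"
    using ex_has_greatest_nat[of P N0 vdim "Suc n"] by blast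
  have "N' = N" if "P N'" "N \<subseteq> N'" for N'
    using vdim_less[of N N' n] N(2)[OF that(1)] P(2) n that N(1)
    by (metis leD order_trans psubsetI)
  then show ?thesis using that N by blast
qed

lemma ex_min_subspace:
  assumes X: "fdsub X" and P: "P N0" "\<And>N. P N \<Longrightarrow> subsp N \<and> N \<subseteq> X"
  obtains N where "P N" "\<And>N'. P N' \<Longrightarrow> N' \<subseteq> N \<Longrightarrow> N' = N"
proof -
  obtain n where n: "X \<subseteq> vsupp n" using X by (auto simp: fdsub_def)
  obtain N where N: "P N" "\<And>N'. P N' \<Longrightarrow> vdim N \<le> vdim N'"
    using ex_has_least_nat[of P N0 vdim] P(1) by metis
  have "N' = N" if "P N'" "N' \<subseteq> N" for N'
    using vdim_less[of N' N n] N(2)[OF that(1)] P(2) n that N(1)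
    by (metis leD order_trans psubsetI)
  then show ?thesis using that N by blast
qed

section \<open>Lie algebras and maximal subalgebras\<close>

lemma sums_left: "subsp B \<Longrightarrow> A \<subseteq> {x + y | x y. x \<in> A \<and> y \<in> B}"
  and sums_right: "subsp A \<Longrightarrow> B \<subseteq> {x + y | x y. x \<in> A \<and> y \<in> B}" for A B :: "('a::field) vec set"
  by (metis (mono_tags, lifting) add.right_neutral mem_Collect_eq subsetI subsp_0,
      metis (mono_tags, lifting) add.left_neutral mem_Collect_eq subsetI subsp_0)

locale lie =
  fixes X :: "('a::field) vec set" and b :: "'a br"
  assumes lie: "lie_alg X b"
begin

lemma fd: "fdsub X" and sub [simp]: "subsp X"
  using lie by (auto simp: lie_alg_def fdsub_def)

lemma cl [simp, intro]: "x \<in> X \<Longrightarrow> y \<in> X \<Longrightarrow> b x y \<in> X"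
  using lie by (auto simp: lie_alg_def)

lemma lin_r: "x \<in> X \<Longrightarrow> linear_on X (b x)" and lin_l: "y \<in> X \<Longrightarrow> linear_on X (\<lambda>x. b x y)"
  using lie by (auto simp: lie_alg_def)

lemma self [simp]: "x \<in> X \<Longrightarrow> b x x = 0"
  using lie by (auto simp: lie_alg_def)

lemma add_r: "x \<in> X \<Longrightarrow> y \<in> X \<Longrightarrow> z \<in> X \<Longrightarrow> b x (y + z) = b x y + b x z"
  and add_l: "x \<in> X \<Longrightarrow> y \<in> X \<Longrightarrow> z \<in> X \<Longrightarrow> b (x + y) z = b x z + b y z"
  and smult_r: "x \<in> X \<Longrightarrow> y \<in> X \<Longrightarrow> b x (smult k y) = smult k (b x y)"
  and smult_l: "x \<in> X \<Longrightarrow> y \<in> X \<Longrightarrow> b (smult k x) y = smult k (b x y)"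
  using lin_r lin_l by (auto simp: linear_on_def)

lemma diff_r: "x \<in> X \<Longrightarrow> y \<in> X \<Longrightarrow> z \<in> X \<Longrightarrow> b x (y - z) = b x y - b x z"
  and diff_l: "x \<in> X \<Longrightarrow> y \<in> X \<Longrightarrow> z \<in> X \<Longrightarrow> b (x - y) z = b x z - b y z"
  and minus_r: "x \<in> X \<Longrightarrow> y \<in> X \<Longrightarrow> b x (- y) = - b x y"
  and zero_r [simp]: "x \<in> X \<Longrightarrow> b x 0 = 0"
  using lin_diff[OF lin_r sub] lin_diff[OF lin_l sub] lin_minus[OF lin_r] lin_minus[OF lin_l]
    lin_0[OF lin_r sub] lin_0[OF lin_l sub] by auto

lemma anti: "x \<in> X \<Longrightarrow> y \<in> X \<Longrightarrow> b x y = - b y x"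
proof -
  assume *: "x \<in> X" "y \<in> X"
  have "0 = b (x + y) (x + y)" using * by (simp add: subsp_add)
  also have "\<dots> = b (x + y) x + b (x + y) y" using * by (intro add_r) (auto simp: subsp_add)
  also have "\<dots> = b x y + b y x" using * by (simp add: add_l add.commute)
  finally have "b x y + b y x = 0" by (rule sym)
  then show ?thesis by (simp only: eq_neg_iff_add_eq_0)
qed

lemma jac: "x \<in> X \<Longrightarrow> y \<in> X \<Longrightarrow> z \<in> X \<Longrightarrow> b x (b y z) = b (b x y) z + b y (b x z)"
proof -
  assume *: "x \<in> X" "y \<in> X" "z \<in> X"
  have "b x (b y z) + b y (b z x) + b z (b x y) = 0" using lie * by (simp add: lie_alg_def)
  moreover have "b y (b z x) = - b y (b x z)" using * anti[of z x] by (simp add: minus_r)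
  moreover have "b z (b x y) = - b (b x y) z" using * anti[of z "b x y"] by simp
  ultimately show ?thesis by (simp add: algebra_simps)
qed

end

lemma lie_algI:
  assumes "fdsub X" and "\<And>x y. x \<in> X \<Longrightarrow> y \<in> X \<Longrightarrow> b x y \<in> X"
    and "\<And>x y z. x \<in> X \<Longrightarrow> y \<in> X \<Longrightarrow> z \<in> X \<Longrightarrow> b x (y + z) = b x y + b x z"
    and "\<And>x y z. x \<in> X \<Longrightarrow> y \<in> X \<Longrightarrow> z \<in> X \<Longrightarrow> b (x + y) z = b x z + b y z"
    and "\<And>k x y. x \<in> X \<Longrightarrow> y \<in> X \<Longrightarrow> b x (smult k y) = smult k (b x y)"
    and "\<And>k x y. x \<in> X \<Longrightarrow> y \<in> X \<Longrightarrow> b (smult k x) y = smult k (b x y)"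
    and "\<And>x. x \<in> X \<Longrightarrow> b x x = 0"
    and "\<And>x y z. x \<in> X \<Longrightarrow> y \<in> X \<Longrightarrow> z \<in> X \<Longrightarrow> b x (b y z) + b y (b z x) + b z (b x y) = 0"
  shows "lie_alg X b"
  using assms by (simp add: lie_alg_def linear_on_def)

lemma lie_subalg: "lie_alg X b \<Longrightarrow> subalg S X b \<Longrightarrow> lie_alg S b"
proof -
  assume X: "lie_alg X b" and S: "subalg S X b"
  interpret lie X b by unfold_locales (rule X)
  have "S \<subseteq> X" using S by (simp add: subalg_def)
  then show ?thesis using X S fdsub_subset[OF fd, of S]
    unfolding lie_alg_def subalg_def
    by (meson linear_on_subset subset_iff)
qed

text \<open>The Lie axioms transfer along a linear surjection that respects the brackets; quotient
  brackets and split-extension brackets get them this way.\<close>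

lemma lie_image:
  assumes K: "lie_alg K b" and f: "linear_on K f"
    and hom: "\<And>x y. x \<in> K \<Longrightarrow> y \<in> K \<Longrightarrow> f (b x y) = c (f x) (f y)"
    and Y: "f ` K = Y" "Y \<subseteq> vsupp n"
  shows "lie_alg Y c"
proof -
  interpret lie K b by unfold_locales (rule K)
  have Y': "y \<in> Y \<longleftrightarrow> (\<exists>x\<in>K. y = f x)" for y using Y by auto
  show ?thesis
  proof (rule lie_algI)
    show "fdsub Y" using subsp_image[OF sub f] Y by (auto simp: fdsub_def)
  next
    fix x y assume "x \<in> Y" "y \<in> Y"
    then show "c x y \<in> Y" unfolding Y' by (metis hom cl)
  next
    fix x y z assume "x \<in> Y" "y \<in> Y" "z \<in> Y"
    then obtain u v w where [simp]: "u \<in> K" "v \<in> K" "w \<in> K" "x = f u" "y = f v" "z = f w"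
      unfolding Y' by auto
    show "c x (y + z) = c x y + c x z" "c (x + y) z = c x z + c y z"
      using f by (simp_all add: hom[symmetric] lin_add[symmetric] subsp_add add_r add_l)
    have "c x (c y z) + c y (c z x) + c z (c x y) = f (b u (b v w) + b v (b w u) + b w (b u v))"
      using f by (simp add: hom[symmetric] lin_add subsp_add)
    also have "b u (b v w) + b v (b w u) + b w (b u v) = 0" using lie by (simp add: lie_alg_def)
    finally show "c x (c y z) + c y (c z x) + c z (c x y) = 0" using f by (simp add: lin_0)
  next
    fix k x y assume "x \<in> Y" "y \<in> Y"
    then obtain u v where [simp]: "u \<in> K" "v \<in> K" "x = f u" "y = f v"
      unfolding Y' by auto
    show "c x (smult k y) = smult k (c x y)" "c (smult k x) y = smult k (c x y)"
      using f by (simp_all add: hom[symmetric] lin_smult[symmetric] subsp_smult smult_r smult_l)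
  next
    fix x assume "x \<in> Y"
    then obtain u where [simp]: "u \<in> K" "x = f u" unfolding Y' by auto
    show "c x x = 0" using f by (simp add: hom[symmetric] lin_0)
  qed
qed

lemma surj_homI:
  assumes "linear_on K f" "f ` K = Y" "\<And>x y. x \<in> K \<Longrightarrow> y \<in> K \<Longrightarrow> f (b x y) = c (f x) (f y)"
  shows "surj_hom K b Y c f"
  using assms by (auto simp: surj_hom_def lie_hom_def)

lemma surj_homD:
  assumes "surj_hom K b Y c f"
  shows "linear_on K f" "f ` K = Y" "\<And>x y. x \<in> K \<Longrightarrow> y \<in> K \<Longrightarrow> f (b x y) = c (f x) (f y)"
    "\<And>x. x \<in> K \<Longrightarrow> f x \<in> Y"
  using assms by (auto simp: surj_hom_def lie_hom_def)

lemma surj_hom_id: "surj_hom K b K b (\<lambda>x. x)"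
  by (rule surj_homI) (auto simp: linear_on_def)

lemma surj_hom_comp:
  assumes "surj_hom K b Y c f" "surj_hom Y c Z d g" shows "surj_hom K b Z d (\<lambda>x. g (f x))"
proof (rule surj_homI)
  note f = surj_homD[OF assms(1)] and g = surj_homD[OF assms(2)]
  show "linear_on K (\<lambda>x. g (f x))" by (rule linear_on_comp[OF f(1) g(1)]) (use f(2) in auto)
  show "(\<lambda>x. g (f x)) ` K = Z" using f(2) g(2) by (metis image_image)
  show "\<And>x y. x \<in> K \<Longrightarrow> y \<in> K \<Longrightarrow> g (f (b x y)) = d (g (f x)) (g (f y))"
    using f g by simp
qed

lemma kern_ideal:
  assumes K: "lie_alg K b" and Y: "lie_alg Y c" and f: "surj_hom K b Y c f"
  shows "ideal_of (kern K f) K b"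
proof -
  interpret K: lie K b by unfold_locales (rule K)
  interpret Y: lie Y c by unfold_locales (rule Y)
  note f = surj_homD[OF f]
  show ?thesis unfolding ideal_of_def using subsp_kern[OF K.sub f(1)] f by (auto simp: kern_def)
qed

text \<open>The image of the projection along \<open>A\<close> carries the quotient, with the
  bracket projected back into it. Brackets are respected because \<open>f\<close> changes each
  argument only by an element of the ideal.\<close>

lemma quotient_exists:
  assumes K: "lie_alg K b" and A: "ideal_of A K b"
  obtains Y c f where "lie_alg Y c" "surj_hom K b Y c f" "kern K f = A"
proof -
  interpret lie K b by unfold_locales (rule K)
  have A': "subsp A" "A \<subseteq> K" "\<And>x y. x \<in> K \<Longrightarrow> y \<in> A \<Longrightarrow> b x y \<in> A" using A by (auto simp: ideal_of_def)
  obtain f where f: "linear_on UNIV f" "\<And>x. f x - x \<in> A" "\<And>x. x \<in> A \<Longrightarrow> f x = 0"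
    using ex_projection[OF A'(1)] by blast
  have fK: "f x \<in> K" if "x \<in> K" for x
    using f(2)[of x] A'(2) that sub by (metis diff_add_cancel subsetD subsp_add)
  have fl: "linear_on K f" using f(1) linear_on_subset by blast
  define c where "c = (\<lambda>x y. f (b x y))"
  have hom: "f (b x y) = c (f x) (f y)" if "x \<in> K" "y \<in> K" for x y
  proof -
    have "b (f x) (f y) - b x y = b x (f y - y) - b (f y) (f x - x)"
    proof -
      have "b (f x) (f y) = - b (f y) (f x)" using that fK anti by blast
      moreover have "b (f y) x = - b x (f y)" using that fK anti by blast
      ultimately show ?thesis using that fK by (simp add: diff_r)
    qed
    also have "\<dots> \<in> A" using A' f(2) that fK by (simp add: subsp_diff)
    finally have "f (b (f x) (f y) - b x y) = 0" using f(3) by blast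
    then show ?thesis using f(1) by (simp add: c_def lin_diff subsp_def)
  qed
  obtain n where "K \<subseteq> vsupp n" using fd by (auto simp: fdsub_def)
  then have "f ` K \<subseteq> vsupp n" using fK by auto
  then have "lie_alg (f ` K) c" 
    by (intro lie_image[of K b f c "f ` K" n] K fl hom refl)
  moreover have "surj_hom K b (f ` K) c f" by (rule surj_homI) (use fl hom in auto)
  moreover have "kern K f = A"
  proof
    show "kern K f \<subseteq> A" using f(2) A'(1) by (auto simp: kern_def) (metis diff_0 minus_minus subsp_minus)
    show "A \<subseteq> kern K f" using f(3) A' by (auto simp: kern_def)
  qed
  ultimately show ?thesis using that by blast
qed

lemma factor_hom:
  assumes K: "subsp K" and f: "surj_hom K b Y c f" and g: "surj_hom K b Z d g"
    and ker: "\<And>x. x \<in> K \<Longrightarrow> f x = 0 \<Longrightarrow> g x = 0" and cl: "\<And>x y. x \<in> K \<Longrightarrow> y \<in> K \<Longrightarrow> b x y \<in> K"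
  obtains h where "surj_hom Y c Z d h" "\<And>x. x \<in> K \<Longrightarrow> h (f x) = g x"
proof -
  note f = surj_homD[OF f] and g = surj_homD[OF g]
  define h where "h = (\<lambda>y. g (SOME x. x \<in> K \<and> f x = y))"
  have h: "h (f x) = g x" if x: "x \<in> K" for x
  proof -
    let ?x = "SOME z. z \<in> K \<and> f z = f x"
    have *: "?x \<in> K \<and> f ?x = f x" by (rule someI[of _ x]) (use x in simp)
    then have "f (?x - x) = 0" using lin_diff[OF f(1) K] x by simp
    then have "g (?x - x) = 0" using ker * x K by (simp add: subsp_diff)
    then show ?thesis using lin_diff[OF g(1) K] * x by (simp add: h_def)
  qed
  have "surj_hom Y c Z d h"
  proof (rule surj_homI)
    show "linear_on Y h"
    proof (rule linear_onI)
      fix x y assume "x \<in> Y" "y \<in> Y"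
      then obtain u v where "u \<in> K" "v \<in> K" "x = f u" "y = f v" using f(2) by auto
      then show "h (x + y) = h x + h y"
        using f(1) g(1) K by (simp add: lin_add[symmetric] h subsp_add)
    next
      fix k x assume "x \<in> Y"
      then obtain u where "u \<in> K" "x = f u" using f(2) by auto
      then show "h (smult k x) = smult k (h x)"
        using f(1) g(1) K by (simp add: lin_smult[symmetric] h subsp_smult)
    qed
    show "h ` Y = Z" using h f(2) g(2) by (metis image_cong image_image)
    fix x y assume "x \<in> Y" "y \<in> Y"
    then obtain u v where "u \<in> K" "v \<in> K" "x = f u" "y = f v" using f(2) by auto
    then show "h (c x y) = d (h x) (h y)"
      using f(3) g(3) h cl by metis
  qed
  then show ?thesis using that h by blast
qed

section \<open>Cores of maximal subalgebras, the Frattini subalgebra and solubility\<close>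

definition core :: "('a::field) vec set \<Rightarrow> 'a br \<Rightarrow> 'a vec set \<Rightarrow> 'a vec set" where
  "core K b M = {x. \<forall>w\<in>lists K. foldr b w x \<in> M}"

lemma core_sub: "core K b M \<subseteq> M"
  by (auto simp: core_def dest: bspec[of _ _ "[]"])

context lie
begin

lemma foldr_cl: "w \<in> lists X \<Longrightarrow> x \<in> X \<Longrightarrow> foldr b w x \<in> X"
  by (induction w) auto

lemma foldr_lin: "w \<in> lists X \<Longrightarrow> linear_on X (foldr b w)"
  by (induction w) (auto simp: linear_on_def foldr_cl add_r smult_r)

lemma core_ideal:
  assumes "subalg M X b" shows "ideal_of (core X b M) X b"
  unfolding ideal_of_def
proof (intro conjI ballI)
  have M: "subsp M" "M \<subseteq> X" using assms by (auto simp: subalg_def)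
  show C: "core X b M \<subseteq> X" using core_sub M by blast
  show "subsp (core X b M)"
  proof (rule subspI)
    show "0 \<in> core X b M" using M by (auto simp: core_def lin_0[OF foldr_lin])
  next
    fix x y assume "x \<in> core X b M" "y \<in> core X b M"
    then show "x + y \<in> core X b M" using M C by (auto simp: core_def lin_add[OF foldr_lin] subset_iff subsp_add)
  next
    fix k x assume "x \<in> core X b M"
    then show "smult k x \<in> core X b M" using M C by (auto simp: core_def lin_smult[OF foldr_lin] subset_iff subsp_smult)
  qed
  fix x y assume xy: "x \<in> X" "y \<in> core X b M"
  show "b x y \<in> core X b M"
    unfolding core_def
  proof (intro CollectI ballI)
    fix w assume "w \<in> lists X"
    then have "w @ [x] \<in> lists X" using xy by auto
    then have "foldr b (w @ [x]) y \<in> M" using xy by (auto simp: core_def simp del: foldr_append)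
    then have "foldr b w (b x y) \<in> M" by simp
    then show "foldr b w (b x y) \<in> M" .
  qed
qed

text \<open>The empty word puts the core inside \<open>M\<close>, and appending a letter makes it an
  ideal; with this lemma it is the largest ideal contained in a subalgebra \<open>M\<close>.\<close>

lemma core_max:
  assumes "ideal_of I X b" "I \<subseteq> M" shows "I \<subseteq> core X b M"
proof -
  have "foldr b w x \<in> I" if "w \<in> lists X" "x \<in> I" for w x
    using that assms by (induction w) (auto simp: ideal_of_def)
  then show ?thesis using assms by (auto simp: core_def)
qed

lemma ideal_r: "ideal_of I X b \<Longrightarrow> x \<in> I \<Longrightarrow> y \<in> X \<Longrightarrow> b x y \<in> I"
  using anti[of x y] by (metis ideal_of_def subsetD subsp_minus)

lemma ideal_sums:
  assumes "ideal_of I X b" "ideal_of J X b" shows "ideal_of {x + y | x y. x \<in> I \<and> y \<in> J} X b"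
  unfolding ideal_of_def
proof (intro conjI ballI)
  show "subsp {x + y | x y. x \<in> I \<and> y \<in> J}" using assms by (auto simp: ideal_of_def intro: subsp_sums)
  show "{x + y | x y. x \<in> I \<and> y \<in> J} \<subseteq> X" using assms by (auto simp: ideal_of_def intro: subsp_add)
  fix x y assume x: "x \<in> X" and "y \<in> {x + y | x y. x \<in> I \<and> y \<in> J}"
  then obtain i j where "y = i + j" "i \<in> I" "j \<in> J" by auto
  moreover from this have "b x y = b x i + b x j" using x assms by (auto simp: ideal_of_def subset_iff add_r)
  moreover from calculation have "b x i \<in> I" "b x j \<in> J" using x assms by (auto simp: ideal_of_def)
  ultimately show "b x y \<in> {x + y | x y. x \<in> I \<and> y \<in> J}" by blast
qed

lemma subalg_ideal_sums:
  assumes M: "subalg M X b" and J: "ideal_of J X b" shows "subalg {x + y | x y. x \<in> M \<and> y \<in> J} X b"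
  unfolding subalg_def
proof (intro conjI ballI)
  show "subsp {x + y | x y. x \<in> M \<and> y \<in> J}" using assms by (auto simp: ideal_of_def subalg_def intro: subsp_sums)
  show "{x + y | x y. x \<in> M \<and> y \<in> J} \<subseteq> X" using assms by (auto simp: ideal_of_def subalg_def intro: subsp_add)
  fix x y assume "x \<in> {x + y | x y. x \<in> M \<and> y \<in> J}" and "y \<in> {x + y | x y. x \<in> M \<and> y \<in> J}"
  then obtain i j i' j' where *: "x = i + j" "i \<in> M" "j \<in> J" "y = i' + j'" "i' \<in> M" "j' \<in> J" by auto
  have X: "i \<in> X" "j \<in> X" "i' \<in> X" "j' \<in> X" using * M J by (auto simp: ideal_of_def subalg_def)
  have "b x y = b i i' + (b i j' + b j i' + b j j')" using * X by (simp add: add_r add_l subsp_add)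
  moreover have "b i i' \<in> M" using * M by (auto simp: subalg_def)
  moreover have "b i j' + b j i' + b j j' \<in> J" using * X J ideal_r by (auto simp: ideal_of_def intro!: subsp_add)
  ultimately show "b x y \<in> {x + y | x y. x \<in> M \<and> y \<in> J}" by blast
qed

text \<open>A maximal subalgebra that does not contain the ideal \<open>J\<close> supplements it,
  since \<open>M + J\<close> is a subalgebra strictly above \<open>M\<close>.\<close>

lemma max_subalg_ideal:
  assumes M: "max_subalg M X b" and J: "ideal_of J X b" "\<not> J \<subseteq> M" and x: "x \<in> X"
  obtains m j where "x = m + j" "m \<in> M" "j \<in> J"
proof -
  define T where "T = {x + y | x y. x \<in> M \<and> y \<in> J}"
  have M': "subalg M X b" using M by (simp add: max_subalg_def)
  have "subalg T X b" unfolding T_def by (rule subalg_ideal_sums[OF M' J(1)])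
  moreover have "M \<subseteq> T" unfolding T_def by (rule sums_left) (use J(1) in \<open>simp add: ideal_of_def\<close>)
  moreover have "J \<subseteq> T" unfolding T_def by (rule sums_right) (use M' in \<open>simp add: subalg_def\<close>)
  ultimately have "T = X" using M J(2) unfolding max_subalg_def by metis
  then show ?thesis using x that by (auto simp: T_def)
qed

end

text \<open>For Lie algebras this is solubility.\<close>

definition chief_abelian :: "('a::field) vec set \<Rightarrow> 'a br \<Rightarrow> bool" where
  "chief_abelian K b \<longleftrightarrow> (\<forall>I. ideal_of I K b \<and> I \<noteq> K \<longrightarrow>
     (\<exists>A. ideal_of A K b \<and> I \<subset> A \<and> (\<forall>x\<in>A. \<forall>y\<in>A. b x y \<in> I)))"

lemma overidealI:
  assumes "ideal_of B K b" "I \<subseteq> B" "J \<subseteq> B" "\<And>x y. x \<in> B \<Longrightarrow> y \<in> B \<Longrightarrow> b x y \<in> I" "\<not> J \<subseteq> I"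
  shows "\<exists>A. ideal_of A K b \<and> I \<subset> A \<and> (\<forall>x\<in>A. \<forall>y\<in>A. b x y \<in> I)"
  using assms by blast

lemma chief_abelianE:
  assumes "chief_abelian K b" "ideal_of I K b" "I \<noteq> K"
  obtains A where "ideal_of A K b" "I \<subset> A" "\<And>x y. x \<in> A \<Longrightarrow> y \<in> A \<Longrightarrow> b x y \<in> I"
proof -
  have "\<exists>A. ideal_of A K b \<and> I \<subset> A \<and> (\<forall>x\<in>A. \<forall>y\<in>A. b x y \<in> I)"
    using assms(1)[unfolded chief_abelian_def, rule_format, of I] assms(2,3) by simp
  then show ?thesis using that by auto
qed

context lie
begin

text \<open>For maximal \<open>M\<close> and an ideal \<open>A\<close> abelian modulo the core of \<open>M\<close>, the map \<open>1 + ad a\<close> is an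
  automorphism modulo the core, so it carries \<open>M\<close> to another maximal subalgebra.\<close>

lemma max_subalg_conj:
  assumes M: "max_subalg M X b" and A: "ideal_of A X b" and I: "ideal_of I X b" "I \<subseteq> M"
    and AA: "\<And>x y. x \<in> A \<Longrightarrow> y \<in> A \<Longrightarrow> b x y \<in> I" and a: "a \<in> A"
  shows "max_subalg {x \<in> X. x + b a x \<in> M} X b"
proof -
  let ?N = "{x \<in> X. x + b a x \<in> M}"
  have M': "subsp M" "M \<subseteq> X" "\<And>x y. x \<in> M \<Longrightarrow> y \<in> M \<Longrightarrow> b x y \<in> M" "M \<noteq> X"
    using M by (auto simp: max_subalg_def subalg_def)
  have aX [simp]: "a \<in> X" using A a by (auto simp: ideal_of_def)
  have I': "subsp I" "I \<subseteq> X" "\<And>x y. x \<in> X \<Longrightarrow> y \<in> I \<Longrightarrow> b x y \<in> I" using I by (auto simp: ideal_of_def)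
  have axA: "b a x \<in> A" if "x \<in> X" for x using ideal_r[OF A a that] .
  have aa: "b a (b a x) \<in> I" if "x \<in> X" for x using AA[OF a axA[OF that]] .
  \<comment> \<open>By the Jacobi identity \<open>1 + ad a\<close> is multiplicative up to the
    bracket of \<open>b a x\<close> with \<open>b a y\<close>. Both lie in \<open>A\<close>, so the
    error lies in \<open>I\<close>.\<close>
  have mult: "b x y + b a (b x y) = b (x + b a x) (y + b a y) - b (b a x) (b a y)" if "x \<in> X" "y \<in> X" for x y
    using that jac[of a x y] by (simp add: add_r add_l subsp_add)
  have mult': "b x y - b a (b x y) = b (x - b a x) (y - b a y) - b (b a x) (b a y)" if "x \<in> X" "y \<in> X" for x y
    using that jac[of a x y] by (simp add: diff_r diff_l subsp_diff)
  have N: "subalg ?N X b" unfolding subalg_def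
  proof (intro conjI ballI)
    have "linear_on X (\<lambda>x. x + b a x)" by (auto intro!: linear_onI simp: add_r smult_r smult_distrib)
    then show "subsp ?N" using subsp_vimage[OF sub _ M'(1)] by simp
    fix x y assume "x \<in> ?N" "y \<in> ?N"
    then show "b x y \<in> ?N" using mult[of x y] M' I AA axA by (auto intro!: subsp_diff)
  qed auto
  have IN: "I \<subseteq> ?N" using I' I(2) M'(1) by (auto intro!: subsp_add)
  \<comment> \<open>\<open>1 - ad a\<close> inverts \<open>1 + ad a\<close> modulo \<open>I\<close>,
    because the square of \<open>ad a\<close> maps into \<open>I\<close>.\<close>
  have conj_in: "x - b a x \<in> ?N \<longleftrightarrow> x \<in> M" if "x \<in> X" for x
  proof -
    have 1: "x - b a x + b a (x - b a x) = x - b a (b a x)" using that by (simp add: diff_r)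
    have 2: "x - b a (b a x) \<in> M \<longleftrightarrow> x \<in> M"
      using aa[OF that] I(2) M'(1) by (metis diff_add_cancel subsetD subsp_add subsp_diff)
    have "x - b a x \<in> X" using that by (simp add: subsp_diff)
    then show ?thesis unfolding mem_Collect_eq 1 using 2 by blast
  qed
  have "?N \<noteq> X"
  proof
    assume "?N = X"
    then have "x \<in> M" if "x \<in> X" for x using conj_in[OF that] that by (simp add: subsp_diff)
    then show False using M' by blast
  qed
  moreover have "T = ?N \<or> T = X" if T: "subalg T X b" "?N \<subseteq> T" for T
  proof -
    have T': "subsp T" "T \<subseteq> X" "\<And>x y. x \<in> T \<Longrightarrow> y \<in> T \<Longrightarrow> b x y \<in> T" using T by (auto simp: subalg_def)
    let ?T = "{x \<in> X. x - b a x \<in> T}"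
    have IT: "I \<subseteq> T" using IN T by blast
    have "subalg ?T X b" unfolding subalg_def
    proof (intro conjI ballI)
      have "linear_on X (\<lambda>x. x - b a x)" by (auto intro!: linear_onI simp: add_r smult_r smult_distrib)
      then show "subsp ?T" using subsp_vimage[OF sub _ T'(1)] by simp
      fix x y assume "x \<in> ?T" "y \<in> ?T"
      then show "b x y \<in> ?T" using mult'[of x y] T' IT AA axA by (auto intro!: subsp_diff)
    qed auto
    moreover have "M \<subseteq> ?T" using conj_in T(2) M'(2) by blast
    ultimately consider "?T = M" | "?T = X" using M unfolding max_subalg_def by blast
    then show ?thesis
    proof cases
      case 1
      have "t \<in> ?N" if t: "t \<in> T" for t
      proof -
        have tX: "t \<in> X" using t T' by blast
        have "t + b a t - b a (t + b a t) = t - b a (b a t)" using tX by (simp add: add_r)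
        also have "\<dots> \<in> T" using t aa[OF tX] IT T'(1) by (auto intro: subsp_diff)
        finally have "t + b a t \<in> ?T" using tX by (simp add: subsp_add)
        then show ?thesis using 1 tX by auto
      qed
      then show ?thesis using T by blast
    next
      case 2
      have "x \<in> T" if x: "x \<in> X" for x
      proof -
        have "x + b a x \<in> ?T" using 2 x by (simp add: subsp_add)
        then have "x + b a x - b a (x + b a x) + b a (b a x) \<in> T" using aa[OF x] IT T'(1) by (auto intro: subsp_add)
        then show ?thesis using x by (simp add: add_r)
      qed
      then show ?thesis using T' by blast
    qed
  qed
  ultimately show ?thesis using N by (auto simp: max_subalg_def)
qed

text \<open>An element \<open>x\<close> of the Frattini subalgebra lies in \<open>M\<close> and in
  all conjugates of \<open>M\<close> under \<open>1 + ad a\<close>, so \<open>b a x\<close> lies in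
  \<open>M \<inter> A\<close>. Because the algebra is \<open>M + A\<close>, this intersection is an
  ideal up to the core and hence inside it. So \<open>x\<close> centralises \<open>A\<close> modulo
  the core, and the part of \<open>M\<close> with this property is again an ideal inside
  \<open>M\<close>.\<close>

lemma frattini_in_core:
  assumes sol: "chief_abelian X b" and M: "max_subalg M X b"
  shows "frattini X b \<subseteq> core X b M"
proof
  fix x assume "x \<in> frattini X b"
  then have x: "x \<in> X" "\<And>N. max_subalg N X b \<Longrightarrow> x \<in> N" by (auto simp: frattini_def)
  let ?I = "core X b M"
  have M': "subalg M X b" "subsp M" "M \<subseteq> X" "\<And>x y. x \<in> M \<Longrightarrow> y \<in> M \<Longrightarrow> b x y \<in> M" "M \<noteq> X"
    using M by (auto simp: max_subalg_def subalg_def)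
  have I: "ideal_of ?I X b" using core_ideal M' by blast
  have IM: "?I \<subseteq> M" by (rule core_sub)
  then have "?I \<noteq> X" using M' by blast
  then obtain A where A: "ideal_of A X b" "?I \<subset> A" "\<And>x y. x \<in> A \<Longrightarrow> y \<in> A \<Longrightarrow> b x y \<in> ?I"
    using chief_abelianE[OF sol I] by metis
  have A': "subsp A" "A \<subseteq> X" "\<And>x y. x \<in> X \<Longrightarrow> y \<in> A \<Longrightarrow> b x y \<in> A" using A by (auto simp: ideal_of_def)
  have nA: "\<not> A \<subseteq> M" using core_max[OF A(1)] A(2) by blast
  note dec = max_subalg_ideal[OF M A(1) nA]
  have idealI: "ideal_of J X b" if J: "subsp J" "J \<subseteq> X" "\<And>m y. m \<in> M \<Longrightarrow> y \<in> J \<Longrightarrow> b m y \<in> J"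
     "\<And>m y. m \<in> A \<Longrightarrow> y \<in> J \<Longrightarrow> b m y \<in> J" for J
    unfolding ideal_of_def
  proof (intro conjI ballI)
    fix x y assume "x \<in> X" "y \<in> J"
    then obtain m j where "x = m + j" "m \<in> M" "j \<in> A" using dec by blast
    then show "b x y \<in> J" using J \<open>y \<in> J\<close> M' A' by (auto simp: add_l subset_iff intro: subsp_add)
  qed (use J in auto)
  have "ideal_of (M \<inter> A) X b"
    by (rule idealI) (use M' A' A(3) IM in \<open>auto intro: subsp_Int\<close>)
  then have MA: "M \<inter> A \<subseteq> ?I" using core_max by blast
  have axI: "b a x \<in> ?I" if a: "a \<in> A" for a
  proof -
    have "x + b a x \<in> M" using x(2)[OF max_subalg_conj[OF M A(1) I IM A(3) a]] by blast
    then have "x + b a x - x \<in> M" using x(2)[OF M] M'(2) subsp_diff by blast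
    then have "b a x \<in> M" by simp
    moreover have "b a x \<in> A" using ideal_r[OF A(1) a x(1)] .
    ultimately show ?thesis using MA by blast
  qed
  let ?C = "{x \<in> M. \<forall>a\<in>A. b a x \<in> ?I}"
  have Isub: "subsp ?I" "?I \<subseteq> X" "\<And>x y. x \<in> X \<Longrightarrow> y \<in> ?I \<Longrightarrow> b x y \<in> ?I" using I by (auto simp: ideal_of_def)
  have "ideal_of ?C X b"
  proof (rule idealI)
    show "subsp ?C"
      using M' A' Isub by (auto intro!: subspI simp: subsp_add subsp_smult add_r smult_r subset_iff)
    fix m y assume m: "m \<in> M" and y: "y \<in> ?C"
    have "b a (b m y) \<in> ?I" if a: "a \<in> A" for a
    proof -
      have "b a (b m y) = b (b a m) y + b m (b a y)" using a m y M' A' by (intro jac) auto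
      moreover have "b (b a m) y \<in> ?I" using ideal_r[OF A(1)] a m y M' by blast
      moreover have "b m (b a y) \<in> ?I" using Isub a m y M' by blast
      ultimately show ?thesis using Isub by (simp add: subsp_add)
    qed
    then show "b m y \<in> ?C" using m y M' by blast
  next
    fix m y assume m: "m \<in> A" and y: "y \<in> ?C"
    then have "b m y \<in> ?I" by blast
    moreover from this have "b a (b m y) \<in> ?I" if "a \<in> A" for a using Isub that A' by blast
    ultimately show "b m y \<in> ?C" using IM by blast
  qed (use M' in auto)
  then have "?C \<subseteq> ?I" using core_max[of ?C M] by blast
  then show "x \<in> ?I" using axI x(2)[OF M] by blast
qed

text \<open>By \<open>frattini_in_core\<close> the Frattini subalgebra is an intersection of cores,
  which are ideals.\<close>

lemma frattini_ideal:
  assumes sol: "chief_abelian X b" shows "ideal_of (frattini X b) X b"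
  unfolding ideal_of_def
proof (intro conjI ballI)
  show "subsp (frattini X b)"
    by (rule subspI) (auto simp: frattini_def max_subalg_def subalg_def subsp_add subsp_smult)
  show "frattini X b \<subseteq> X" by (auto simp: frattini_def)
  fix x y assume x: "x \<in> X" and y: "y \<in> frattini X b"
  have "b x y \<in> M" if M: "max_subalg M X b" for M
  proof -
    have "ideal_of (core X b M) X b" using core_ideal M by (auto simp: max_subalg_def)
    then have "b x y \<in> core X b M" using frattini_in_core[OF sol M] x y by (auto simp: ideal_of_def)
    then show ?thesis using core_sub by blast
  qed
  then show "b x y \<in> frattini X b" using x y by (auto simp: frattini_def)
qed

lemma bracket_sums_in_ideal:
  assumes I: "ideal_of I X b" and D: "D \<subseteq> X" "\<And>d d'. d \<in> D \<Longrightarrow> d' \<in> D \<Longrightarrow> b d d' \<in> I"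
    and x: "x \<in> {x + y | x y. x \<in> I \<and> y \<in> D}" and y: "y \<in> {x + y | x y. x \<in> I \<and> y \<in> D}"
  shows "b x y \<in> I"
proof -
  have I': "subsp I" "I \<subseteq> X" "\<And>x y. x \<in> X \<Longrightarrow> y \<in> I \<Longrightarrow> b x y \<in> I" using I by (auto simp: ideal_of_def)
  obtain i d where i: "x = i + d" "i \<in> I" "d \<in> D" using x by blast
  obtain i' d' where i': "y = i' + d'" "i' \<in> I" "d' \<in> D" using y by blast
  have m [simp]: "i \<in> X" "d \<in> X" "i' \<in> X" "d' \<in> X" using i i' I' D by auto
  have "b x y = b i (i' + d') + (b d i' + b d d')" using i i' by (simp add: add_r add_l subsp_add)
  moreover have "b i (i' + d') \<in> I" by (rule ideal_r[OF I i(2)]) (simp add: subsp_add)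
  moreover have "b d i' \<in> I" by (rule I'(3)) (use i' in auto)
  moreover have "b d d' \<in> I" by (rule D(2)) (use i i' in auto)
  ultimately show ?thesis using I'(1) by (simp add: subsp_add)
qed

lemma ideal_derived:
  assumes I: "ideal_of I X b" shows "ideal_of (derived b I) X b" "derived b I \<subseteq> I"
proof -
  have I': "subsp I" "I \<subseteq> X" "\<And>x y. x \<in> X \<Longrightarrow> y \<in> I \<Longrightarrow> b x y \<in> I" using I by (auto simp: ideal_of_def)
  let ?G = "{b x y | x y. x \<in> I \<and> y \<in> I}"
  show DI: "derived b I \<subseteq> I" unfolding derived_def by (rule vspan_min) (use I' in auto)
  show "ideal_of (derived b I) X b" unfolding ideal_of_def
  proof (intro conjI ballI)
    show "subsp (derived b I)" by (simp add: derived_def)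
    show "derived b I \<subseteq> X" using DI I' by blast
    fix x y assume x: "x \<in> X" and y: "y \<in> derived b I"
    have "derived b I \<subseteq> {y \<in> X. b x y \<in> derived b I}" unfolding derived_def
    proof (rule vspan_min)
      show "subsp {y \<in> X. b x y \<in> vspan ?G}" by (rule subsp_vimage) (use x lin_r in auto)
      show "?G \<subseteq> {y \<in> X. b x y \<in> vspan ?G}"
      proof safe
        fix u v assume uv: "u \<in> I" "v \<in> I"
        then show "b u v \<in> X" using I' by blast
        have "b (b x u) v \<in> ?G" "b u (b x v) \<in> ?G" using uv x I' by blast+
        moreover have "b x (b u v) = b (b x u) v + b u (b x v)" using uv x I' by (intro jac) auto
        ultimately show "b x (b u v) \<in> vspan ?G"
          using vspan_superset[of ?G] by (simp add: subset_iff subsp_add)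
      qed
    qed
    then show "b x y \<in> derived b I" using y by blast
  qed
qed

lemma ideal_derived_pow: "ideal_of ((derived b ^^ k) X) X b"
proof (induction k)
  case 0
  show ?case by (auto simp: ideal_of_def)
next
  case (Suc k)
  then show ?case using ideal_derived by simp
qed

text \<open>If \<open>D m\<close> is the first derived term inside \<open>I\<close>, then
  \<open>I + D (m - 1)\<close> is strictly larger than \<open>I\<close> and abelian modulo
  \<open>I\<close>.\<close>

lemma soluble_chief_abelian:
  assumes "soluble X b" shows "chief_abelian X b"
  unfolding chief_abelian_def
proof (intro allI impI)
  fix I assume I: "ideal_of I X b \<and> I \<noteq> X"
  then have I': "subsp I" "I \<subseteq> X" "\<And>x y. x \<in> X \<Longrightarrow> y \<in> I \<Longrightarrow> b x y \<in> I" by (auto simp: ideal_of_def)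
  let ?D = "\<lambda>k. (derived b ^^ k) X"
  obtain k where "?D k = {0}" using assms by (auto simp: soluble_def)
  then have ex: "\<exists>k. ?D k \<subseteq> I" using I' by (intro exI[of _ k]) auto
  define m where "m = (LEAST k. ?D k \<subseteq> I)"
  have m: "?D m \<subseteq> I" unfolding m_def by (rule LeastI_ex[OF ex])
  have "m \<noteq> 0" using m I I' by (intro notI) auto
  then obtain j where j: "m = Suc j" by (cases m) auto
  have nj: "\<not> ?D j \<subseteq> I" using not_less_Least[of j "\<lambda>k. ?D k \<subseteq> I"] j m_def by auto
  let ?A = "{x + y | x y. x \<in> I \<and> y \<in> ?D j}"
  have Dj: "ideal_of (?D j) X b" by (rule ideal_derived_pow)
  then have Dj': "subsp (?D j)" "?D j \<subseteq> X" by (auto simp: ideal_of_def)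
  have "ideal_of ?A X b" using I Dj ideal_sums by blast
  moreover have "I \<subseteq> ?A" by (rule sums_left) (use Dj' in simp)
  moreover have "?D j \<subseteq> ?A" by (rule sums_right) (use I' in simp)
  moreover have "b x y \<in> I" if xy: "x \<in> ?A" "y \<in> ?A" for x y
  proof (rule bracket_sums_in_ideal[OF _ Dj'(2) _ xy])
    fix d d' assume "d \<in> ?D j" "d' \<in> ?D j"
    then have "b d d' \<in> {b x y | x y. x \<in> ?D j \<and> y \<in> ?D j}" by blast
    then have "b d d' \<in> ?D m" by (simp add: j derived_def subsetD[OF vspan_superset])
    then show "b d d' \<in> I" using m by blast
  qed (use I in simp)
  ultimately show "\<exists>A. ideal_of A X b \<and> I \<subset> A \<and> (\<forall>x\<in>A. \<forall>y\<in>A. b x y \<in> I)"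
    using nj by (rule overidealI)
qed

text \<open>If the abelian kernel is not inside \<open>I\<close>, adding it to \<open>I\<close>
  gives the required ideal; otherwise an ideal found in the quotient is pulled back.\<close>

lemma chief_abelian_extension:
  assumes Y: "lie_alg Y c" and f: "surj_hom X b Y c f" and sol: "chief_abelian Y c"
    and ab: "\<And>x y. x \<in> kern X f \<Longrightarrow> y \<in> kern X f \<Longrightarrow> b x y = 0"
  shows "chief_abelian X b"
  unfolding chief_abelian_def
proof (intro allI impI)
  interpret Y: lie Y c by unfold_locales (rule Y)
  fix I assume I: "ideal_of I X b \<and> I \<noteq> X"
  then have I': "subsp I" "I \<subseteq> X" "\<And>x y. x \<in> X \<Longrightarrow> y \<in> I \<Longrightarrow> b x y \<in> I" by (auto simp: ideal_of_def)
  note fD = surj_homD[OF f]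
  let ?A = "kern X f"
  have A: "ideal_of ?A X b" by (rule kern_ideal[OF lie Y f])
  show "\<exists>A. ideal_of A X b \<and> I \<subset> A \<and> (\<forall>x\<in>A. \<forall>y\<in>A. b x y \<in> I)"
  proof (cases "?A \<subseteq> I")
    case False
    let ?B = "{x + y | x y. x \<in> I \<and> y \<in> ?A}"
    have A': "subsp ?A" "?A \<subseteq> X" using A by (auto simp: ideal_of_def)
    have "ideal_of ?B X b" using I A ideal_sums by blast
    moreover have "I \<subseteq> ?B" by (rule sums_left) (use A' in simp)
    moreover have "?A \<subseteq> ?B" by (rule sums_right) (use I' in simp)
    moreover have "b x y \<in> I" if xy: "x \<in> ?B" "y \<in> ?B" for x y
      by (rule bracket_sums_in_ideal[OF _ A'(2) _ xy]) (use I I' ab in simp_all)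
    ultimately show ?thesis using False by (rule overidealI)
  next
    case True
    have fI: "f x \<in> f ` I \<longleftrightarrow> x \<in> I" if "x \<in> X" for x
    proof
      assume "f x \<in> f ` I"
      then obtain i where i: "i \<in> I" "f x = f i" by auto
      then have "x - i \<in> ?A" using that I' fD by (auto simp: kern_def subsp_diff lin_diff)
      then have "x - i + i \<in> I" using True i(1) I'(1) subsp_add by blast
      then show "x \<in> I" by simp
    qed auto
    have "ideal_of (f ` I) Y c" unfolding ideal_of_def
    proof (intro conjI ballI)
      show "subsp (f ` I)" using subsp_image I' fD linear_on_subset by blast
      show "f ` I \<subseteq> Y" using I' fD by blast
      fix x y assume "x \<in> Y" "y \<in> f ` I"
      then obtain u i where "u \<in> X" "x = f u" "i \<in> I" "y = f i" using fD(2) by auto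
      then show "c x y \<in> f ` I" using fD(3)[of u i] I' by (auto intro!: image_eqI[of _ f "b u i"])
    qed
    moreover have "f ` I \<noteq> Y" using fI fD(4) I I' by blast
    ultimately obtain B where B: "ideal_of B Y c" "f ` I \<subset> B" "\<And>x y. x \<in> B \<Longrightarrow> y \<in> B \<Longrightarrow> c x y \<in> f ` I"
      using chief_abelianE[OF sol] by metis
    let ?B = "{x \<in> X. f x \<in> B}"
    have "ideal_of ?B X b" using subsp_vimage[OF sub fD(1), of B] B fD by (auto simp: ideal_of_def)
    moreover have "I \<subseteq> ?B" using B I' by blast
    moreover have "?B \<noteq> I" using B fD(2) unfolding ideal_of_def by blast
    moreover have "b x y \<in> I" if xy: "x \<in> ?B" "y \<in> ?B" for x y
      using xy B(3)[of "f x" "f y"] fD(3)[of x y] fI[of "b x y"] by simp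
    ultimately show ?thesis by (intro exI[of _ ?B]) blast
  qed
qed

end

section \<open>Saturated formations and semidirect products\<close>

locale sat_formation =
  fixes FF :: "('a::field) lie_class"
  assumes form: "formation FF" and sat: "saturated FF"
begin

lemma F_lie: "(K, b) \<in> FF \<Longrightarrow> lie_alg K b"
  using form by (auto simp: formation_def)

lemma F_chief_abelian: "(K, b) \<in> FF \<Longrightarrow> chief_abelian K b"
proof -
  assume K: "(K, b) \<in> FF"
  interpret lie K b by unfold_locales (rule F_lie[OF K])
  show ?thesis using K form by (intro soluble_chief_abelian) (auto simp: formation_def)
qed

lemma F_image: "(K, b) \<in> FF \<Longrightarrow> surj_hom K b Y c f \<Longrightarrow> lie_alg Y c \<Longrightarrow> (Y, c) \<in> FF"
  using form unfolding formation_def by blast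

lemma ideal_Int: "ideal_of I K b \<Longrightarrow> ideal_of J K b \<Longrightarrow> ideal_of (I \<inter> J) K b"
  by (auto simp: ideal_of_def intro: subsp_Int)

text \<open>The defining clause of a formation asks for the kernel to equal the intersection of the
  two kernels. Here it only has to contain it: the quotient by the exact intersection is in the
  class and maps onto \<open>Y\<close>.\<close>

lemma F_subdirect:
  assumes K: "lie_alg K b" and Y: "lie_alg Y c" "surj_hom K b Y c f"
    and 1: "(Y1, c1) \<in> FF" "surj_hom K b Y1 c1 f1" and 2: "(Y2, c2) \<in> FF" "surj_hom K b Y2 c2 f2"
    and ker: "\<And>x. x \<in> K \<Longrightarrow> f1 x = 0 \<Longrightarrow> f2 x = 0 \<Longrightarrow> f x = 0"
  shows "(Y, c) \<in> FF"
proof -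
  interpret lie K b by unfold_locales (rule K)
  have "ideal_of (kern K f1 \<inter> kern K f2) K b"
    using kern_ideal K F_lie 1 2 ideal_Int by metis
  then obtain Z d g where Z: "lie_alg Z d" "surj_hom K b Z d g" "kern K g = kern K f1 \<inter> kern K f2"
    using quotient_exists[OF K] by metis
  have "(Z, d) \<in> FF"
    using form K Z 1 2 F_lie[OF 1(1)] F_lie[OF 2(1)] unfolding formation_def by blast
  moreover have "f x = 0" if "x \<in> K" "g x = 0" for x
  proof -
    have "x \<in> kern K g" using that by (simp add: kern_def)
    then show ?thesis unfolding Z(3) using ker by (simp add: kern_def)
  qed
  then obtain h where "surj_hom Z d Y c h" using factor_hom[OF sub Z(2) Y(2)] cl by metis
  ultimately show ?thesis using F_image Y by blast
qed

text \<open>Saturation speaks of the quotient by the full Frattini subalgebra. That subalgebra is an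
  ideal because \<open>K\<close> is an extension of a soluble algebra by an abelian kernel, and the
  quotient by it is an image of \<open>Y\<close>.\<close>

lemma F_frattini:
  assumes K: "lie_alg K b" and Y: "(Y, c) \<in> FF" "surj_hom K b Y c f" and ker: "kern K f \<subseteq> frattini K b"
    and ab: "\<And>x y. x \<in> kern K f \<Longrightarrow> y \<in> kern K f \<Longrightarrow> b x y = 0"
  shows "(K, b) \<in> FF"
proof -
  interpret lie K b by unfold_locales (rule K)
  have "chief_abelian K b"
    using chief_abelian_extension[OF F_lie[OF Y(1)] Y(2) F_chief_abelian[OF Y(1)] ab] .
  then have "ideal_of (frattini K b) K b" by (rule frattini_ideal)
  then obtain Z d g where Z: "lie_alg Z d" "surj_hom K b Z d g" "kern K g = frattini K b"
    using quotient_exists[OF K] by metis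
  have "g x = 0" if "x \<in> K" "f x = 0" for x
  proof -
    have "x \<in> kern K f" using that by (simp add: kern_def)
    then have "x \<in> kern K g" using ker Z(3) by blast
    then show ?thesis by (simp add: kern_def)
  qed
  then obtain h where "surj_hom Y c Z d h" using factor_hom[OF sub Y(2) Z(2)] cl by metis
  then have "(Z, d) \<in> FF" using F_image Y Z by blast
  then show ?thesis using sat K Z unfolding saturated_def by blast
qed

text \<open>A substitute for cohomology: a minimal ideal \<open>B'\<close> with \<open>K/B'\<close> in the class either lies in the
  Frattini subalgebra, or it is supplemented by a maximal subalgebra \<open>M\<close>, and then \<open>K\<close> modulo
  \<open>M \<inter> B'\<close> is a subdirect product of \<open>K/B'\<close> and a quotient of \<open>T\<close>.\<close>

lemma F_extension:
  assumes K: "lie_alg K b" and U: "subsp U" "U \<subseteq> K" "\<And>x y. x \<in> U \<Longrightarrow> y \<in> U \<Longrightarrow> b x y = 0"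
    and T: "(T, b) \<in> FF" "T \<subseteq> K" "\<And>x. x \<in> K \<Longrightarrow> \<exists>t\<in>T. \<exists>u\<in>U. x = t + u"
    and Y: "(Y, c) \<in> FF" "surj_hom K b Y c f" and ker: "kern K f \<subseteq> T" "kern K f \<subseteq> U"
  shows "(K, b) \<in> FF"
proof -
  interpret lie K b by unfold_locales (rule K)
  define P where "P B \<longleftrightarrow> ideal_of B K b \<and> B \<subseteq> kern K f \<and> (\<exists>Y c f. (Y, c) \<in> FF \<and> surj_hom K b Y c f \<and> kern K f = B)" for B
  have P0: "P (kern K f)" using kern_ideal[OF K F_lie[OF Y(1)] Y(2)] Y by (auto simp: P_def)
  have Psub: "subsp B \<and> B \<subseteq> K" if "P B" for B using that by (auto simp: P_def ideal_of_def)
  obtain B where B: "P B" and Bmin: "\<And>B'. P B' \<Longrightarrow> B' \<subseteq> B \<Longrightarrow> B' = B"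
    using ex_min_subspace[OF fd, of P, OF P0 Psub] by metis
  then obtain Y1 c1 f1 where 1: "(Y1, c1) \<in> FF" "surj_hom K b Y1 c1 f1" "kern K f1 = B"
    by (auto simp: P_def)
  have Bid: "ideal_of B K b" and BU: "B \<subseteq> U" and BT: "B \<subseteq> T" using B ker by (auto simp: P_def)
  have B': "subsp B" "B \<subseteq> K" "\<And>x y. x \<in> K \<Longrightarrow> y \<in> B \<Longrightarrow> b x y \<in> B" using Bid by (auto simp: ideal_of_def)
  have BB: "b x y = 0" if "x \<in> B" "y \<in> B" for x y using U(3) BU that by blast
  show ?thesis
  proof (cases "B \<subseteq> frattini K b")
    case True
    show ?thesis by (rule F_frattini[OF K 1(1,2)]) (use True BB 1 in auto)
  next
    case False
    then obtain M where M: "max_subalg M K b" "\<not> B \<subseteq> M" using B'(2) by (auto simp: frattini_def)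
    then have M': "subsp M" "M \<subseteq> K" "\<And>x y. x \<in> M \<Longrightarrow> y \<in> M \<Longrightarrow> b x y \<in> M"
      by (auto simp: max_subalg_def subalg_def)
    note dec = max_subalg_ideal[OF M(1) Bid M(2)]
    have idealI: "ideal_of J K b" if J: "subsp J" "J \<subseteq> K" "\<And>m y. m \<in> M \<Longrightarrow> y \<in> J \<Longrightarrow> b m y \<in> J"
       "\<And>m y. m \<in> B \<Longrightarrow> y \<in> J \<Longrightarrow> b m y \<in> J" for J
      unfolding ideal_of_def
    proof (intro conjI ballI)
      fix x y assume "x \<in> K" "y \<in> J"
      then obtain m j where "x = m + j" "m \<in> M" "j \<in> B" using dec by blast
      then show "b x y \<in> J" using J \<open>y \<in> J\<close> M' B' by (auto simp: add_l subset_iff intro: subsp_add)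
    qed (use J in auto)
    \<comment> \<open>\<open>B1\<close> is an ideal because \<open>K = M + B\<close> and
      \<open>B\<close> is abelian. Once \<open>K\<close> modulo \<open>B1\<close> is in the class,
      minimality forces \<open>B1 = B\<close>, against the choice of \<open>M\<close>.\<close>
    define B1 where "B1 = M \<inter> B"
    have B1s: "subsp B1" unfolding B1_def using M' B' by (auto intro: subsp_Int)
    have B1id: "ideal_of B1 K b"
      by (rule idealI) (use B1s M' B' BB subsp_0[OF M'(1)] in \<open>auto simp: B1_def\<close>)
    then have B1': "\<And>x y. x \<in> K \<Longrightarrow> y \<in> B1 \<Longrightarrow> b x y \<in> B1" by (auto simp: ideal_of_def)
    \<comment> \<open>The centraliser of \<open>B\<close> modulo \<open>B1\<close> inside
      \<open>M\<close>. It meets \<open>B\<close> in \<open>B1\<close>, so \<open>K\<close> modulo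
      \<open>B1\<close> is a subdirect product of the quotients by \<open>B\<close> and by
      \<open>D\<close>.\<close>
    define D where "D = {x \<in> M. \<forall>u\<in>B. b u x \<in> B1}"
    have Did: "ideal_of D K b"
    proof (rule idealI)
      show "subsp D" unfolding D_def
      proof (rule subspI)
        show "0 \<in> {x \<in> M. \<forall>u\<in>B. b u x \<in> B1}" using M' B1s B' by auto
      next
        fix x y assume "x \<in> {x \<in> M. \<forall>u\<in>B. b u x \<in> B1}" "y \<in> {x \<in> M. \<forall>u\<in>B. b u x \<in> B1}"
        moreover from this have "b u (x + y) = b u x + b u y" if "u \<in> B" for u
          using that M' B' by (intro add_r) auto
        ultimately show "x + y \<in> {x \<in> M. \<forall>u\<in>B. b u x \<in> B1}" using M' B1s by (auto simp: subsp_add)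
      next
        fix k x assume "x \<in> {x \<in> M. \<forall>u\<in>B. b u x \<in> B1}"
        moreover from this have "b u (smult k x) = smult k (b u x)" if "u \<in> B" for u
          using that M' B' by (intro smult_r) auto
        ultimately show "smult k x \<in> {x \<in> M. \<forall>u\<in>B. b u x \<in> B1}" using M' B1s by (auto simp: subsp_smult)
      qed
      show "D \<subseteq> K" using M' by (auto simp: D_def)
    next
      fix m x assume m: "m \<in> M" and x: "x \<in> D"
      have "b u (b m x) \<in> B1" if u: "u \<in> B" for u
      proof -
        have mem: "u \<in> K" "m \<in> K" "x \<in> K" using u m x B' M' by (auto simp: D_def)
        have "b u (b m x) = b (b u m) x + b m (b u x)" using mem by (rule jac)
        moreover have "b (b u m) x \<in> B1" using x ideal_r[OF Bid u mem(2)] by (auto simp: D_def)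
        moreover have "b m (b u x) \<in> B1" using x u mem B1' by (auto simp: D_def)
        ultimately show ?thesis using B1s by (simp add: subsp_add)
      qed
      then show "b m x \<in> D" using m x M' by (auto simp: D_def)
    next
      fix m x assume m: "m \<in> B" and x: "x \<in> D"
      then have bm: "b m x \<in> B1" by (auto simp: D_def)
      then have "b u (b m x) = 0" if "u \<in> B" for u using that BB by (auto simp: B1_def)
      then show "b m x \<in> D" using bm M' B' by (auto simp: D_def B1_def)
    qed
    obtain Z d g where Z: "lie_alg Z d" "surj_hom K b Z d g" "kern K g = D"
      using quotient_exists[OF K Did] by metis
    note gD = surj_homD[OF Z(2)]
    \<comment> \<open>Here \<open>U\<close> being abelian and \<open>B \<subseteq> T\<close> pay
      off: if \<open>u = m + \<beta>\<close> with \<open>m\<close> in \<open>M\<close> and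
      \<open>\<beta>\<close> in \<open>B\<close>, then \<open>m\<close> lies in \<open>U\<close>, so
      it centralises \<open>B\<close> and belongs to \<open>D\<close>, while \<open>\<beta>\<close>
      can be absorbed into \<open>T\<close>.\<close>
    have gT: "g ` T = Z"
    proof
      show "g ` T \<subseteq> Z" using gD T by blast
      show "Z \<subseteq> g ` T"
      proof
        fix z assume "z \<in> Z"
        then obtain x where x: "x \<in> K" "z = g x" using gD(2) by auto
        obtain t u where tu: "t \<in> T" "u \<in> U" "x = t + u" using T(3)[OF x(1)] by blast
        obtain m \<beta> where m: "u = m + \<beta>" "m \<in> M" "\<beta> \<in> B" using dec[of u] tu U by blast
        have "m = u - \<beta>" using m by simp
        moreover have "u - \<beta> \<in> U" using tu(2) m(3) BU U(1) subsp_diff by blast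
        ultimately have "m \<in> U" by simp
        then have "b w m = 0" if "w \<in> B" for w using that BU U(3) by blast
        then have "m \<in> D" using m B1s by (auto simp: D_def)
        then have "m \<in> kern K g" using Z by simp
        then have gm: "g m = 0" "m \<in> K" by (auto simp: kern_def)
        have mem: "t \<in> K" "\<beta> \<in> K" using tu m T B' by auto
        have "x = (t + \<beta>) + m" using tu m by (simp add: algebra_simps)
        then have "z = g (t + \<beta>)" using gm mem gD(1) x by (simp add: lin_add subsp_add)
        moreover have "t + \<beta> \<in> T" using tu m BT F_lie[OF T(1)]
          by (auto simp: lie_alg_def fdsub_def intro: subsp_add)
        ultimately show "z \<in> g ` T" by blast
      qed
    qed
    have "surj_hom T b Z d g"
      by (rule surj_homI[OF linear_on_subset[OF gD(1) T(2)] gT]) (meson gD(3) T(2) subsetD)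
    then have ZF: "(Z, d) \<in> FF" using F_image T Z by blast
    obtain W e h where W: "lie_alg W e" "surj_hom K b W e h" "kern K h = B1"
      using quotient_exists[OF K B1id] by metis
    have "(W, e) \<in> FF"
    proof (rule F_subdirect[OF K W(1,2) 1(1,2) ZF Z(2)])
      fix x assume "x \<in> K" "f1 x = 0" "g x = 0"
      then have "x \<in> kern K f1" "x \<in> kern K g" by (auto simp: kern_def)
      then have "x \<in> B1" using 1 Z by (auto simp: D_def B1_def)
      then have "x \<in> kern K h" using W by simp
      then show "h x = 0" by (simp add: kern_def)
    qed
    then have "P B1" using B1id B W unfolding P_def B1_def by blast
    then have "B1 = B" using Bmin by (auto simp: B1_def)
    then show ?thesis using M by (auto simp: B1_def)
  qed
qed

end

section \<open>Modules on arbitrary carriers and their semidirect products\<close>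

definition gmod :: "('a::field) vec set \<Rightarrow> 'a br \<Rightarrow> 'a vec set \<Rightarrow> ('a vec \<Rightarrow> 'a vec \<Rightarrow> 'a vec) \<Rightarrow> bool" where
  "gmod X b U \<rho> \<longleftrightarrow> fdsub U
   \<and> (\<forall>x\<in>X. linear_on U (\<rho> x) \<and> \<rho> x ` U \<subseteq> U)
   \<and> (\<forall>x\<in>X. \<forall>y\<in>X. \<forall>v\<in>U. \<rho> (x + y) v = \<rho> x v + \<rho> y v)
   \<and> (\<forall>c. \<forall>x\<in>X. \<forall>v\<in>U. \<rho> (smult c x) v = smult c (\<rho> x v))
   \<and> (\<forall>x\<in>X. \<forall>y\<in>X. \<forall>v\<in>U. \<rho> (b x y) v = \<rho> x (\<rho> y v) - \<rho> y (\<rho> x v))"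

lemma gmodI:
  assumes "fdsub U" "\<And>x v. x \<in> X \<Longrightarrow> v \<in> U \<Longrightarrow> \<rho> x v \<in> U"
    "\<And>x v w. x \<in> X \<Longrightarrow> v \<in> U \<Longrightarrow> w \<in> U \<Longrightarrow> \<rho> x (v + w) = \<rho> x v + \<rho> x w"
    "\<And>k x v. x \<in> X \<Longrightarrow> v \<in> U \<Longrightarrow> \<rho> x (smult k v) = smult k (\<rho> x v)"
    "\<And>x y v. x \<in> X \<Longrightarrow> y \<in> X \<Longrightarrow> v \<in> U \<Longrightarrow> \<rho> (x + y) v = \<rho> x v + \<rho> y v"
    "\<And>k x v. x \<in> X \<Longrightarrow> v \<in> U \<Longrightarrow> \<rho> (smult k x) v = smult k (\<rho> x v)"
    "\<And>x y v. x \<in> X \<Longrightarrow> y \<in> X \<Longrightarrow> v \<in> U \<Longrightarrow> \<rho> (b x y) v = \<rho> x (\<rho> y v) - \<rho> y (\<rho> x v)"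
  shows "gmod X b U \<rho>"
  using assms by (auto simp: gmod_def linear_on_def)

text \<open>The bracket of the semidirect product with the module as an abelian ideal; the acting
  algebra sits in the even coordinates and the module in the odd ones.\<close>

definition SB :: "('a::field) br \<Rightarrow> ('a vec \<Rightarrow> 'a vec \<Rightarrow> 'a vec) \<Rightarrow> 'a br" where
  "SB b \<rho> k l = pr (b (p1 k) (p1 l)) (\<rho> (p1 k) (p2 l) - \<rho> (p1 l) (p2 k))"

lemma SB_simps [simp]: "p1 (SB b \<rho> k l) = b (p1 k) (p1 l)" "p2 (SB b \<rho> k l) = \<rho> (p1 k) (p2 l) - \<rho> (p1 l) (p2 k)"
  by (auto simp: SB_def)

locale lmod = lie X b for X :: "('a::field) vec set" and b +
  fixes U :: "'a vec set" and \<rho> :: "'a vec \<Rightarrow> 'a vec \<Rightarrow> 'a vec"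
  assumes gm: "gmod X b U \<rho>"
begin

lemma Ufd: "fdsub U" and Usub [simp]: "subsp U" using gm by (auto simp: gmod_def fdsub_def)

lemma act [simp, intro]: "x \<in> X \<Longrightarrow> v \<in> U \<Longrightarrow> \<rho> x v \<in> U"
  and act_lin: "x \<in> X \<Longrightarrow> linear_on U (\<rho> x)"
  and act_brk: "x \<in> X \<Longrightarrow> y \<in> X \<Longrightarrow> v \<in> U \<Longrightarrow> \<rho> (b x y) v = \<rho> x (\<rho> y v) - \<rho> y (\<rho> x v)"
  and act_ladd: "x \<in> X \<Longrightarrow> y \<in> X \<Longrightarrow> v \<in> U \<Longrightarrow> \<rho> (x + y) v = \<rho> x v + \<rho> y v"
  and act_lsmult: "x \<in> X \<Longrightarrow> v \<in> U \<Longrightarrow> \<rho> (smult k x) v = smult k (\<rho> x v)"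
  using gm by (auto simp: gmod_def)

lemma act_add: "x \<in> X \<Longrightarrow> v \<in> U \<Longrightarrow> w \<in> U \<Longrightarrow> \<rho> x (v + w) = \<rho> x v + \<rho> x w"
  and act_smult: "x \<in> X \<Longrightarrow> v \<in> U \<Longrightarrow> \<rho> x (smult k v) = smult k (\<rho> x v)"
  and act_diff: "x \<in> X \<Longrightarrow> v \<in> U \<Longrightarrow> w \<in> U \<Longrightarrow> \<rho> x (v - w) = \<rho> x v - \<rho> x w"
  and act_0 [simp]: "x \<in> X \<Longrightarrow> \<rho> x 0 = 0"
  using lin_add[OF act_lin] lin_smult[OF act_lin] lin_diff[OF act_lin] lin_0[OF act_lin] by auto

lemma act_l0 [simp]: "v \<in> U \<Longrightarrow> \<rho> 0 v = 0"
  using act_lsmult[of 0 v 0] by simp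

lemma lie_semidirect: "lie_alg (PR X U) (SB b \<rho>)"
proof (rule lie_algI)
  show "fdsub (PR X U)" using fdsub_PR fd Ufd by blast
next
  fix k l m assume "k \<in> PR X U" "l \<in> PR X U" "m \<in> PR X U"
  then have [simp]: "p1 k \<in> X" "p2 k \<in> U" "p1 l \<in> X" "p2 l \<in> U" "p1 m \<in> X" "p2 m \<in> U" by auto
  have "b (p1 k) (b (p1 l) (p1 m)) + b (p1 l) (b (p1 m) (p1 k)) + b (p1 m) (b (p1 k) (p1 l)) = 0"
    using lie by (simp add: lie_alg_def)
  then show "SB b \<rho> k (SB b \<rho> l m) + SB b \<rho> l (SB b \<rho> m k) + SB b \<rho> m (SB b \<rho> k l) = 0"
    by - (rule pr_eqI, simp_all add: act_diff act_brk)
qed (simp_all add: pr_eq_iff[of "SB _ _ _ _"] subsp_diff add_r add_l smult_r smult_l act_add act_ladd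
    act_smult act_lsmult smult_distrib)

lemma restrict: "subalg S X b \<Longrightarrow> gmod S b U \<rho>"
  using gm unfolding gmod_def subalg_def by (meson subset_iff)

lemma submodule:
  assumes "subsp N" "N \<subseteq> U" "\<And>x v. x \<in> X \<Longrightarrow> v \<in> N \<Longrightarrow> \<rho> x v \<in> N"
  shows "gmod X b N \<rho>"
  by (rule gmodI) (use assms fdsub_subset[OF Ufd] in \<open>auto simp: act_add act_smult act_ladd act_lsmult act_brk subset_iff\<close>)

end

lemma gmod_sum:
  assumes "gmod X b U \<rho>" "gmod X b V \<sigma>"
  shows "gmod X b (PR U V) (\<lambda>x f. pr (\<rho> x (p1 f)) (\<sigma> x (p2 f)))"
proof (rule gmodI)
  note 1 = assms(1)[unfolded gmod_def linear_on_def] and 2 = assms(2)[unfolded gmod_def linear_on_def]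
  show "fdsub (PR U V)" using 1 2 by (simp add: fdsub_PR)
  fix x v assume "x \<in> X" "v \<in> PR U V"
  then show "pr (\<rho> x (p1 v)) (\<sigma> x (p2 v)) \<in> PR U V" using 1 2 by (simp add: image_subset_iff)
qed (use assms in \<open>simp_all add: gmod_def linear_on_def pr_eq_iff[of "pr _ _"]\<close>)

lemma surj_hom_semidirect:
  assumes \<phi>: "surj_hom K b X c \<phi>" and \<psi>: "linear_on A \<psi>" "\<psi> ` A = U"
    and eq: "\<And>k a. k \<in> K \<Longrightarrow> a \<in> A \<Longrightarrow> \<psi> (\<rho> k a) = \<sigma> (\<phi> k) (\<psi> a)"
    and act: "\<And>k a. k \<in> K \<Longrightarrow> a \<in> A \<Longrightarrow> \<rho> k a \<in> A" and A: "subsp A"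
  shows "surj_hom (PR K A) (SB b \<rho>) (PR X U) (SB c \<sigma>) (\<lambda>k. pr (\<phi> (p1 k)) (\<psi> (p2 k)))"
proof (rule surj_homI)
  note p = surj_homD[OF \<phi>]
  show "linear_on (PR K A) (\<lambda>k. pr (\<phi> (p1 k)) (\<psi> (p2 k)))"
    using p(1) \<psi>(1) by (auto simp: linear_on_def pr_eq_iff[of "pr _ _"])
  show "(\<lambda>k. pr (\<phi> (p1 k)) (\<psi> (p2 k))) ` PR K A = PR X U"
  proof
    show "(\<lambda>k. pr (\<phi> (p1 k)) (\<psi> (p2 k))) ` PR K A \<subseteq> PR X U" using p \<psi> by auto
    show "PR X U \<subseteq> (\<lambda>k. pr (\<phi> (p1 k)) (\<psi> (p2 k))) ` PR K A"
    proof
      fix z assume "z \<in> PR X U"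
      then obtain k a where "k \<in> K" "p1 z = \<phi> k" "a \<in> A" "p2 z = \<psi> a" using p(2) \<psi>(2) by auto
      then show "z \<in> (\<lambda>k. pr (\<phi> (p1 k)) (\<psi> (p2 k))) ` PR K A"
        by (intro image_eqI[of _ _ "pr k a"]) (auto simp: pr_eq_iff[of z])
    qed
  qed
  fix k l assume "k \<in> PR K A" "l \<in> PR K A"
  then show "pr (\<phi> (p1 (SB b \<rho> k l))) (\<psi> (p2 (SB b \<rho> k l))) =
      SB c \<sigma> (pr (\<phi> (p1 k)) (\<psi> (p2 k))) (pr (\<phi> (p1 l)) (\<psi> (p2 l)))"
    using p \<psi> A by (simp add: pr_eq_iff[of "pr _ _"] lin_diff act eq)
qed

lemma (in lmod) surj_hom_p1: "surj_hom (PR X U) (SB b \<rho>) X b p1"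
proof (rule surj_homI)
  show "p1 ` PR X U = X"
  proof
    show "X \<subseteq> p1 ` PR X U" by (intro subsetI image_eqI[of _ _ "pr x 0" for x]) auto
  qed auto
qed (auto simp: linear_on_def)

lemma (in lie) adjoint_ideal:
  assumes "ideal_of A X b" shows "gmod X b A b"
proof (rule gmodI)
  have A: "subsp A" "A \<subseteq> X" "\<And>x y. x \<in> X \<Longrightarrow> y \<in> A \<Longrightarrow> b x y \<in> A" using assms by (auto simp: ideal_of_def)
  show "fdsub A" using fdsub_subset[OF fd] A by blast
  fix x y v assume "x \<in> X" "y \<in> X" "v \<in> A"
  then show "b (b x y) v = b x (b y v) - b y (b x v)" using jac[of x y v] A by auto
qed (use assms in \<open>auto simp: ideal_of_def subset_iff add_r add_l smult_r smult_l\<close>)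

context sat_formation
begin

text \<open>The maps \<open>(k, a) -> k\<close> and \<open>(k, a) -> k + a\<close> are both
  homomorphisms onto \<open>K\<close>, the second because \<open>A\<close> is abelian, and their
  kernels meet in zero. So this is a subdirect product of two copies of \<open>K\<close>.\<close>

lemma F_fibre:
  assumes K: "(K, b) \<in> FF" and A: "ideal_of A K b" and ab: "\<And>x y. x \<in> A \<Longrightarrow> y \<in> A \<Longrightarrow> b x y = 0"
  shows "(PR K A, SB b b) \<in> FF"
proof -
  interpret lie K b by unfold_locales (rule F_lie[OF K])
  interpret lmod K b A b by unfold_locales (rule adjoint_ideal[OF A])
  have AK: "A \<subseteq> K" using A by (auto simp: ideal_of_def)
  have 2: "surj_hom (PR K A) (SB b b) K b (\<lambda>k. p1 k + p2 k)"
  proof (rule surj_homI)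
    show "(\<lambda>k. p1 k + p2 k) ` PR K A = K"
    proof
      show "(\<lambda>k. p1 k + p2 k) ` PR K A \<subseteq> K" using AK by (auto simp: subset_iff intro!: subsp_add[OF sub])
      show "K \<subseteq> (\<lambda>k. p1 k + p2 k) ` PR K A" by (intro subsetI image_eqI[of _ _ "pr x 0" for x]) auto
    qed
    fix k l assume "k \<in> PR K A" "l \<in> PR K A"
    then have m: "p1 k \<in> K" "p2 k \<in> A" "p1 l \<in> K" "p2 l \<in> A" "p2 k \<in> K" "p2 l \<in> K" using AK by auto
    then have "b (p1 k + p2 k) (p1 l + p2 l) = b (p1 k) (p1 l) + b (p1 k) (p2 l) + b (p2 k) (p1 l)"
      using ab by (simp add: add_r add_l subsp_add)
    then show "p1 (SB b b k l) + p2 (SB b b k l) = b (p1 k + p2 k) (p1 l + p2 l)"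
      using m anti[of "p2 k" "p1 l"] by (simp add: algebra_simps)
  qed (auto simp: linear_on_def smult_distrib algebra_simps)
  show ?thesis
  proof (rule F_subdirect[OF lie_semidirect lie_semidirect surj_hom_id K surj_hom_p1 K 2])
    fix x :: "'a vec" assume "p1 x = 0" "p1 x + p2 x = 0"
    then show "x = 0" by - (rule pr_eqI, simp_all)
  qed
qed

end

section \<open>Modules whose semidirect product lies in the formation\<close>

locale formation_member = sat_formation FF for FF :: "('a::field) lie_class" +
  fixes S :: "'a vec set" and b :: "'a br"
  assumes S: "(S, b) \<in> FF"
begin

sublocale S: lie S b by unfold_locales (rule F_lie[OF S])

text \<open>The whole of \<open>S\<close> acts here, whereas centrality divides by the centraliser
  of the module. Since \<open>S\<close> is in the class, one passes between the two by a quotient in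
  one direction and a subdirect product with \<open>S\<close> in the other.\<close>

definition HH :: "'a vec set \<Rightarrow> ('a vec \<Rightarrow> 'a vec \<Rightarrow> 'a vec) \<Rightarrow> bool" where
  "HH U \<rho> \<longleftrightarrow> (PR S U, SB b \<rho>) \<in> FF"

text \<open>The factor of \<open>U\<close> by \<open>N\<close> enters through any algebra
  \<open>Y\<close> of the class onto which the semidirect product maps with kernel meeting
  \<open>U\<close> in \<open>N\<close>; a subdirect product with \<open>S\<close> then gives the
  semidirect product with that factor. \<open>F_extension\<close> finishes, with the semidirect
  product of \<open>S\<close> and \<open>N\<close> in the role of \<open>T\<close>.\<close>

lemma HH_climb:
  assumes gm: "gmod S b U \<rho>" and N: "subsp N" "N \<subseteq> U" "\<And>x v. x \<in> S \<Longrightarrow> v \<in> N \<Longrightarrow> \<rho> x v \<in> N" "HH N \<rho>"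
    and Y: "(Y, c) \<in> FF" "surj_hom (PR S U) (SB b \<rho>) Y c f"
    and ker: "\<And>n. n \<in> U \<Longrightarrow> f (pr 0 n) = 0 \<longleftrightarrow> n \<in> N"
  shows "HH U \<rho>"
proof -
  interpret lmod S b U \<rho> by unfold_locales (rule gm)
  let ?K = "PR S U" and ?B = "PR {0} N"
  have K: "lie_alg ?K (SB b \<rho>)" by (rule lie_semidirect)
  have B: "ideal_of ?B ?K (SB b \<rho>)"
    unfolding ideal_of_def
  proof (intro conjI ballI)
    show "subsp ?B" using N by (auto intro!: subspI simp: subsp_add subsp_smult)
    show "?B \<subseteq> ?K" using N by auto
    fix x y assume "x \<in> ?K" "y \<in> ?B"
    then show "SB b \<rho> x y \<in> ?B" using N by auto
  qed
  obtain Z d g where Z: "lie_alg Z d" "surj_hom ?K (SB b \<rho>) Z d g" "kern ?K g = ?B"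
    using quotient_exists[OF K B] by metis
  have ZF: "(Z, d) \<in> FF"
  proof (rule F_subdirect[OF K Z(1,2) Y S surj_hom_p1])
    fix x assume x: "x \<in> ?K" "f x = 0" "p1 x = 0"
    then have "x = pr 0 (p2 x)" by (simp add: pr_eq_iff[of x])
    then have "p2 x \<in> N" using ker[of "p2 x"] x by auto
    then have "x \<in> kern ?K g" using x Z(3) by simp
    then show "g x = 0" by (simp add: kern_def)
  qed
  have "(PR S U, SB b \<rho>) \<in> FF"
  proof (rule F_extension[OF K _ _ _ _ _ _ ZF Z(2)])
    show "subsp (PR {0} U)" "PR {0} U \<subseteq> PR S U" by (auto intro!: subspI simp: subsp_add subsp_smult)
    show "SB b \<rho> x y = 0" if "x \<in> PR {0} U" "y \<in> PR {0} U" for x y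
      using that by - (rule pr_eqI, simp_all)
    show "(PR S N, SB b \<rho>) \<in> FF" using N(4) by (simp add: HH_def)
    show "PR S N \<subseteq> PR S U" using N by auto
    show "\<exists>t\<in>PR S N. \<exists>u\<in>PR {0} U. x = t + u" if "x \<in> PR S U" for x
      using that N by (intro bexI[of _ "pr (p1 x) 0"] bexI[of _ "pr 0 (p2 x)"]) (auto simp: pr_eq_iff[of x])
    show "kern (PR S U) g \<subseteq> PR S N" "kern (PR S U) g \<subseteq> PR {0} U" using Z(3) N by auto
  qed
  then show ?thesis by (simp add: HH_def)
qed

text \<open>\<open>F_fibre\<close> puts the semidirect product of \<open>K\<close> with its abelian
  ideal \<open>A\<close> into the class, and \<open>\<phi>\<close> and \<open>\<psi>\<close> map it
  onto that of \<open>S\<close> and \<open>U\<close>. Thus a module found as an abelian ideal in an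
  algebra of the class inherits \<open>HH\<close>.\<close>

lemma HH_fibre:
  assumes K: "(K, c) \<in> FF" "surj_hom K c S b \<phi>" and A: "ideal_of A K c" "\<And>x y. x \<in> A \<Longrightarrow> y \<in> A \<Longrightarrow> c x y = 0"
    and U: "gmod S b U \<rho>" and \<psi>: "linear_on A \<psi>" "\<psi> ` A = U"
    and eq: "\<And>k a. k \<in> K \<Longrightarrow> a \<in> A \<Longrightarrow> \<psi> (c k a) = \<rho> (\<phi> k) (\<psi> a)"
  shows "HH U \<rho>"
proof -
  interpret lmod S b U \<rho> by unfold_locales (rule U)
  have "surj_hom (PR K A) (SB c c) (PR S U) (SB b \<rho>) (\<lambda>k. pr (\<phi> (p1 k)) (\<psi> (p2 k)))"
    by (rule surj_hom_semidirect) (use K(2) A \<psi> eq in \<open>auto simp: ideal_of_def\<close>)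
  then show ?thesis
    unfolding HH_def using F_image[OF F_fibre[OF K(1) A]] lie_semidirect by blast
qed

text \<open>\<open>N\<close> is an abelian ideal of the semidirect product with \<open>U\<close>, so
  this is a case of \<open>HH_fibre\<close>.\<close>

lemma HH_submodule:
  assumes gm: "gmod S b U \<rho>" and H: "HH U \<rho>" and N: "subsp N" "N \<subseteq> U" "\<And>x v. x \<in> S \<Longrightarrow> v \<in> N \<Longrightarrow> \<rho> x v \<in> N"
  shows "HH N \<rho>"
proof -
  interpret lmod S b U \<rho> by unfold_locales (rule gm)
  show ?thesis
  proof (rule HH_fibre[OF H[unfolded HH_def] surj_hom_p1])
    show "ideal_of (PR {0} N) (PR S U) (SB b \<rho>)"
      using N unfolding ideal_of_def by (auto intro!: subspI simp: subsp_add subsp_smult)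
    show "SB b \<rho> x y = 0" if "x \<in> PR {0} N" "y \<in> PR {0} N" for x y
      using that N by - (rule pr_eqI, auto simp: subset_iff)
    show "gmod S b N \<rho>" using submodule N by blast
    show "linear_on (PR {0} N) p2" by (auto simp: linear_on_def)
    show "p2 ` PR {0} N = N"
    proof
      show "N \<subseteq> p2 ` PR {0} N" by (intro subsetI image_eqI[of _ _ "pr 0 x" for x]) auto
    qed auto
    show "p2 (SB b \<rho> k a) = \<rho> (p1 k) (p2 a)" if "k \<in> PR S U" "a \<in> PR {0} N" for k a
      using that by auto
  qed
qed

lemma HH_sum:
  assumes U: "gmod S b U \<rho>" "HH U \<rho>" and V: "gmod S b V \<sigma>" "HH V \<sigma>"
  shows "HH (PR U V) (\<lambda>x f. pr (\<rho> x (p1 f)) (\<sigma> x (p2 f)))"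
proof -
  let ?\<tau> = "\<lambda>x f. pr (\<rho> x (p1 f)) (\<sigma> x (p2 f))"
  interpret U: lmod S b U \<rho> by unfold_locales (rule U)
  interpret V: lmod S b V \<sigma> by unfold_locales (rule V)
  interpret UV: lmod S b "PR U V" ?\<tau> by unfold_locales (rule gmod_sum[OF U(1) V(1)])
  have 1: "surj_hom (PR S (PR U V)) (SB b ?\<tau>) (PR S U) (SB b \<rho>) (\<lambda>k. pr (p1 k) (p1 (p2 k)))"
  proof (rule surj_hom_semidirect[OF surj_hom_id])
    show "p1 ` PR U V = U"
    proof
      show "U \<subseteq> p1 ` PR U V" by (intro subsetI image_eqI[of _ _ "pr x 0" for x]) auto
    qed auto
  qed (auto simp: linear_on_def)
  have 2: "surj_hom (PR S (PR U V)) (SB b ?\<tau>) (PR S V) (SB b \<sigma>) (\<lambda>k. pr (p1 k) (p2 (p2 k)))"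
  proof (rule surj_hom_semidirect[OF surj_hom_id])
    show "p2 ` PR U V = V"
    proof
      show "V \<subseteq> p2 ` PR U V" by (intro subsetI image_eqI[of _ _ "pr 0 x" for x]) auto
    qed auto
  qed (auto simp: linear_on_def)
  show ?thesis unfolding HH_def
  proof (rule F_subdirect[OF UV.lie_semidirect UV.lie_semidirect surj_hom_id
        U(2)[unfolded HH_def] 1 V(2)[unfolded HH_def] 2])
    fix x :: "'a vec" assume a: "pr (p1 x) (p1 (p2 x)) = 0" "pr (p1 x) (p2 (p2 x)) = 0"
    have "p1 x = 0" "p1 (p2 x) = 0" using arg_cong[OF a(1), of p1] arg_cong[OF a(1), of p2] by simp_all
    moreover have "p2 (p2 x) = 0" using arg_cong[OF a(2), of p2] by simp
    ultimately have "p2 x = 0" by (metis p_linear(9,10) pr_p)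
    then show "x = 0" using \<open>p1 x = 0\<close> by (metis p_linear(9,10) pr_p)
  qed
qed

end

section \<open>Tensor products and the adjoint module\<close>

lemma p1_image: "0 \<in> B \<Longrightarrow> p1 ` PR A B = A"
  by (force intro: image_eqI[of _ _ "pr x 0" for x])

lemma p2_image: "0 \<in> A \<Longrightarrow> p2 ` PR A B = B"
  by (force intro: image_eqI[of _ _ "pr 0 x" for x])

definition tens :: "('a::field) vec \<Rightarrow> 'a vec \<Rightarrow> 'a vec" where
  "tens u v = (\<lambda>k. u (fst (prod_decode k)) * v (snd (prod_decode k)))"

definition col :: "'a vec \<Rightarrow> nat \<Rightarrow> 'a vec" where "col f j = (\<lambda>i. f (prod_encode (i, j)))"
definition row :: "'a vec \<Rightarrow> nat \<Rightarrow> 'a vec" where "row f i = (\<lambda>j. f (prod_encode (i, j)))"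

definition TU :: "('a::field) vec set \<Rightarrow> 'a vec set \<Rightarrow> 'a vec set" where
  "TU U V = vspan {tens u v | u v. u \<in> U \<and> v \<in> V}"

text \<open>A tensor is stored as its coordinate matrix, indexed through \<open>prod_encode\<close>.
  Applying \<open>\<rho>\<close> to columns and \<open>\<sigma>\<close> to rows is
  \<open>\<rho> \<otimes> 1 + 1 \<otimes> \<sigma>\<close>, expressed without choosing a
  decomposition into pure tensors.\<close>

definition tact :: "('x \<Rightarrow> ('a::field) vec \<Rightarrow> 'a vec) \<Rightarrow> ('x \<Rightarrow> 'a vec \<Rightarrow> 'a vec) \<Rightarrow> 'x \<Rightarrow> 'a vec \<Rightarrow> 'a vec" where
  "tact \<rho> \<sigma> x f = (\<lambda>k. \<rho> x (col f (snd (prod_decode k))) (fst (prod_decode k))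
                     + \<sigma> x (row f (fst (prod_decode k))) (snd (prod_decode k)))"

lemma tens_encode: "tens u v (prod_encode (i, j)) = u i * v j"
  by (simp add: tens_def)

lemma tens_linear:
  fixes u v :: "('a::field) vec"
  shows "tens (u + u') v = tens u v + tens u' v" "tens u (v + v') = tens u v + tens u v'"
    "tens (smult c u) v = smult c (tens u v)" "tens u (smult c v) = smult c (tens u v)"
    "tens (u - u') v = tens u v - tens u' v" "tens u (v - v') = tens u v - tens u v'"
    "tens 0 v = 0" "tens u 0 = 0"
  by (auto simp: tens_def fun_eq_iff pointwise algebra_simps)

lemma col_tens: "col (tens u v) j = smult (v j) u" and row_tens: "row (tens u v) i = smult (u i) v"
  by (auto simp: col_def row_def tens_def fun_eq_iff pointwise)

lemma col_linear:
  fixes f g :: "('a::field) vec"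
  shows "col (f + g) j = col f j + col g j" "col (smult c f) j = smult c (col f j)" "col (0 :: 'a vec) j = 0"
    "row (f + g) j = row f j + row g j" "row (smult c f) j = smult c (row f j)" "row (0 :: 'a vec) j = 0"
  by (auto simp: col_def row_def fun_eq_iff pointwise)

lemma linear_on_vspan_eq:
  assumes "linear_on (vspan G) f" "linear_on (vspan G) g" "\<And>x. x \<in> G \<Longrightarrow> f x = g x" "x \<in> vspan G"
  shows "f x = g x"
proof -
  have "vspan G \<subseteq> {x \<in> vspan G. f x = g x}"
  proof (rule vspan_min)
    show "subsp {x \<in> vspan G. f x = g x}"
      by (rule subspI) (use assms(1,2) in \<open>simp_all add: lin_0 lin_add lin_smult subsp_add subsp_smult\<close>)
    show "G \<subseteq> {x \<in> vspan G. f x = g x}" using assms(3) vspan_superset by blast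
  qed
  then show ?thesis using assms(4) by blast
qed

lemma TU_superset: "u \<in> U \<Longrightarrow> v \<in> V \<Longrightarrow> tens u v \<in> TU U V"
  unfolding TU_def by (rule subsetD[OF vspan_superset]) blast

lemma TU_min: "subsp T \<Longrightarrow> (\<And>u v. u \<in> U \<Longrightarrow> v \<in> V \<Longrightarrow> tens u v \<in> T) \<Longrightarrow> TU U V \<subseteq> T"
  unfolding TU_def by (rule vspan_min) auto

lemma TU_col: assumes "subsp U" "f \<in> TU U V" shows "col f j \<in> U"
proof -
  have "TU U V \<subseteq> {f. col f j \<in> U}"
    by (rule TU_min) (use assms(1) in \<open>auto intro!: subspI simp: col_linear col_tens subsp_add subsp_smult\<close>)
  then show ?thesis using assms(2) by blast
qed

lemma TU_row: assumes "subsp V" "f \<in> TU U V" shows "row f j \<in> V"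
proof -
  have "TU U V \<subseteq> {f. row f j \<in> V}"
    by (rule TU_min) (use assms(1) in \<open>auto intro!: subspI simp: col_linear row_tens subsp_add subsp_smult\<close>)
  then show ?thesis using assms(2) by blast
qed

lemma fdsub_TU: assumes "fdsub U" "fdsub V" shows "fdsub (TU U V)"
proof -
  obtain n m where nm: "U \<subseteq> vsupp n" "V \<subseteq> vsupp m" using assms by (auto simp: fdsub_def)
  have "finite (prod_encode ` ({..<n} \<times> {..<m}))" by simp
  then obtain N where N: "\<forall>k\<in>prod_encode ` ({..<n} \<times> {..<m}). k < N"
    using finite_nat_set_iff_bounded by meson
  have "tens u v \<in> vsupp N" if "u \<in> U" "v \<in> V" for u v
    unfolding vsupp_def
  proof (intro CollectI allI impI)
    fix k assume "k \<ge> N"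
    then have "k \<notin> prod_encode ` ({..<n} \<times> {..<m})" using N leD by blast
    then have "\<not> (fst (prod_decode k) < n \<and> snd (prod_decode k) < m)"
      by (metis (no_types, lifting) SigmaI image_eqI lessThan_iff prod.collapse prod_decode_inverse)
    then show "tens u v k = 0" using that nm by (auto simp: tens_def vsupp_def subset_iff)
  qed
  then have "TU U V \<subseteq> vsupp N" by (intro TU_min) auto
  then show ?thesis by (auto simp: fdsub_def TU_def)
qed

locale lmod2 = U: lmod X b U \<rho> + V: lmod X b V \<sigma>
  for X :: "('a::field) vec set" and b U \<rho> V \<sigma>
begin

abbreviation "\<theta> \<equiv> tact \<rho> \<sigma>"

lemma tact_tens: "x \<in> X \<Longrightarrow> u \<in> U \<Longrightarrow> v \<in> V \<Longrightarrow> \<theta> x (tens u v) = tens (\<rho> x u) v + tens u (\<sigma> x v)"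
  by (simp add: tact_def col_tens row_tens U.act_smult V.act_smult) (simp add: tens_def fun_eq_iff pointwise)

lemma tact_linear: "x \<in> X \<Longrightarrow> linear_on (TU U V) (\<theta> x)"
proof (rule linear_onI)
  assume x: "x \<in> X"
  fix f g assume f: "f \<in> TU U V" and g: "g \<in> TU U V"
  have "\<rho> x (col (f + g) j) = \<rho> x (col f j) + \<rho> x (col g j)" "\<sigma> x (row (f + g) j) = \<sigma> x (row f j) + \<sigma> x (row g j)" for j
    using x f g by (simp_all add: col_linear U.act_add V.act_add TU_col TU_row)
  then show "\<theta> x (f + g) = \<theta> x f + \<theta> x g" by (simp add: tact_def fun_eq_iff pointwise algebra_simps)
next
  assume x: "x \<in> X"
  fix k f assume f: "f \<in> TU U V"
  have "\<rho> x (col (smult k f) j) = smult k (\<rho> x (col f j))" "\<sigma> x (row (smult k f) j) = smult k (\<sigma> x (row f j))" for j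
    using x f by (simp_all add: col_linear U.act_smult V.act_smult TU_col TU_row)
  then show "\<theta> x (smult k f) = smult k (\<theta> x f)" by (simp add: tact_def fun_eq_iff pointwise algebra_simps)
qed

lemma TUsub [simp]: "subsp (TU U V)" by (simp add: TU_def)

lemma tact_in: assumes x: "x \<in> X" and f: "f \<in> TU U V" shows "\<theta> x f \<in> TU U V"
proof -
  have "TU U V \<subseteq> {f \<in> TU U V. \<theta> x f \<in> TU U V}"
  proof (rule TU_min)
    show "subsp {f \<in> TU U V. \<theta> x f \<in> TU U V}" using subsp_vimage[OF _ tact_linear[OF x]] by simp
    fix u v assume "u \<in> U" "v \<in> V"
    then show "tens u v \<in> {f \<in> TU U V. \<theta> x f \<in> TU U V}"
      using x by (simp add: TU_superset tact_tens subsp_add)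
  qed
  then show ?thesis using f by blast
qed

lemma gmod_tensor: "gmod X b (TU U V) \<theta>"
proof (rule gmodI)
  show "fdsub (TU U V)" using fdsub_TU U.Ufd V.Ufd by blast
next
  fix x v assume "x \<in> X" "v \<in> TU U V"
  then show "\<theta> x v \<in> TU U V" by (rule tact_in)
next
  fix x v w assume "x \<in> X" "v \<in> TU U V" "w \<in> TU U V"
  then show "\<theta> x (v + w) = \<theta> x v + \<theta> x w" using tact_linear lin_add by blast
next
  fix k x v assume "x \<in> X" "v \<in> TU U V"
  then show "\<theta> x (smult k v) = smult k (\<theta> x v)" using tact_linear lin_smult by blast
next
  fix x y v assume x: "x \<in> X" and y: "y \<in> X" and v: "v \<in> TU U V"
  have "\<rho> (x + y) (col v j) = \<rho> x (col v j) + \<rho> y (col v j)" "\<sigma> (x + y) (row v j) = \<sigma> x (row v j) + \<sigma> y (row v j)" for j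
    using x y v by (simp_all add: U.act_ladd V.act_ladd TU_col TU_row)
  then show "\<theta> (x + y) v = \<theta> x v + \<theta> y v" by (simp add: tact_def fun_eq_iff pointwise algebra_simps)
next
  fix k x v assume x: "x \<in> X" and v: "v \<in> TU U V"
  have "\<rho> (smult k x) (col v j) = smult k (\<rho> x (col v j))" "\<sigma> (smult k x) (row v j) = smult k (\<sigma> x (row v j))" for j
    using x v by (simp_all add: U.act_lsmult V.act_lsmult TU_col TU_row)
  then show "\<theta> (smult k x) v = smult k (\<theta> x v)" by (simp add: tact_def fun_eq_iff pointwise algebra_simps)
next
  fix x y v assume x: "x \<in> X" and y: "y \<in> X" and v: "v \<in> TU U V"
  have l: "linear_on (TU U V) (\<lambda>v. \<theta> x (\<theta> y v) - \<theta> y (\<theta> x v))"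
    using x y by (intro linear_onI) (simp_all add: tact_in lin_add[OF tact_linear] lin_smult[OF tact_linear] smult_distrib)
  have e: "\<theta> (b x y) f = \<theta> x (\<theta> y f) - \<theta> y (\<theta> x f)" if fG: "f \<in> {tens u v | u v. u \<in> U \<and> v \<in> V}" for f
  proof -
    obtain u v where f: "f = tens u v" and uv: "u \<in> U" "v \<in> V" using fG by blast
    have [simp]: "\<theta> z (tens u' v' + tens u'' v'') = \<theta> z (tens u' v') + \<theta> z (tens u'' v'')"
      if "z \<in> X" "u' \<in> U" "u'' \<in> U" "v' \<in> V" "v'' \<in> V" for z u' u'' v' v''
      using that lin_add[OF tact_linear] TU_superset by blast
    show ?thesis unfolding f using x y uv by (simp add: tact_tens U.act_brk V.act_brk tens_linear)
  qed
  show "\<theta> (b x y) v = \<theta> x (\<theta> y v) - \<theta> y (\<theta> x v)"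
    by (rule linear_on_vspan_eq[OF tact_linear[OF U.cl[OF x y], unfolded TU_def] l[unfolded TU_def] e v[unfolded TU_def]])
qed

text \<open>\<open>V \<oplus> U \<otimes> V\<close> as a module over the semidirect product of \<open>U\<close>: an element of \<open>U\<close> maps
  \<open>v\<close> to \<open>u \<otimes> v\<close>. The resulting algebra has \<open>U \<otimes> V\<close> inside its Frattini subalgebra.\<close>

definition \<tau> :: "'a vec \<Rightarrow> 'a vec \<Rightarrow> 'a vec" where
  "\<tau> k f = pr (\<sigma> (p1 k) (p1 f)) (\<theta> (p1 k) (p2 f) + tens (p2 k) (p1 f))"

lemma \<tau>_simps [simp]: "p1 (\<tau> k f) = \<sigma> (p1 k) (p1 f)" "p2 (\<tau> k f) = \<theta> (p1 k) (p2 f) + tens (p2 k) (p1 f)"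
  by (auto simp: \<tau>_def)

text \<open>Two elements of \<open>U\<close> commute on this space, since both send \<open>V\<close>
  into the tensor part and kill the tensor part; the bracket of an element of \<open>X\<close> with
  one of \<open>U\<close> is handled by the Leibniz rule \<open>tact_tens\<close>.\<close>

lemma gmod_\<tau>: "gmod (PR X U) (SB b \<rho>) (PR V (TU U V)) \<tau>"
proof -
  interpret T: lmod X b "TU U V" \<theta> by unfold_locales (rule gmod_tensor)
  show ?thesis
  proof (rule gmodI)
    show "fdsub (PR V (TU U V))" using fdsub_PR V.Ufd T.Ufd by blast
  next
    fix k l f assume "k \<in> PR X U" "l \<in> PR X U" "f \<in> PR V (TU U V)"
    then have m: "p1 k \<in> X" "p2 k \<in> U" "p1 l \<in> X" "p2 l \<in> U" "p1 f \<in> V" "p2 f \<in> TU U V" by auto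
    show "\<tau> (SB b \<rho> k l) f = \<tau> k (\<tau> l f) - \<tau> l (\<tau> k f)"
    proof (rule pr_eqI)
      show "p1 (\<tau> (SB b \<rho> k l) f) = p1 (\<tau> k (\<tau> l f) - \<tau> l (\<tau> k f))" using m by (simp add: V.act_brk)
      show "p2 (\<tau> (SB b \<rho> k l) f) = p2 (\<tau> k (\<tau> l f) - \<tau> l (\<tau> k f))"
        using m by (simp add: T.act_brk T.act_add TU_superset tact_tens tens_linear)
    qed
  next
    fix x v assume "x \<in> PR X U" "v \<in> PR V (TU U V)"
    then show "\<tau> x v \<in> PR V (TU U V)" by (simp add: TU_superset subsp_add)
  qed (rule pr_eqI; simp add: V.act_add T.act_add V.act_smult T.act_smult V.act_ladd T.act_ladd V.act_lsmult
      T.act_lsmult tens_linear smult_distrib algebra_simps)+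
qed

end

context formation_member
begin

text \<open>Modulo the tensor part \<open>A\<close> the algebra is a subdirect product of the
  semidirect products with \<open>U\<close> and with \<open>V\<close>. If a maximal subalgebra did
  not contain \<open>A\<close>, it would supplement \<open>A\<close> and contain lifts of every
  \<open>u\<close> and every \<open>v\<close>; their brackets are all the tensors
  \<open>u \<otimes> v\<close>, which span \<open>A\<close>. So \<open>A\<close> lies in the
  Frattini subalgebra, and \<open>HH_fibre\<close> extracts the module \<open>A\<close> from the
  algebra.\<close>

lemma HH_tensor:
  assumes U: "gmod S b U \<rho>" "HH U \<rho>" and V: "gmod S b V \<sigma>" "HH V \<sigma>"
  shows "HH (TU U V) (tact \<rho> \<sigma>)"
proof -
  interpret lmod2 S b U \<rho> V \<sigma> by unfold_locales (rule U, rule V)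
  interpret T: lmod S b "TU U V" \<theta> by unfold_locales (rule gmod_tensor)
  let ?K1 = "PR S U" and ?c1 = "SB b \<rho>" and ?W = "PR V (TU U V)"
  interpret K1: lie ?K1 ?c1 by unfold_locales (rule U.lie_semidirect)
  interpret W: lmod ?K1 ?c1 ?W \<tau> by unfold_locales (rule gmod_\<tau>)
  let ?K = "PR ?K1 ?W" and ?c = "SB ?c1 \<tau>"
  interpret K: lie ?K ?c by unfold_locales (rule W.lie_semidirect)
  let ?A = "PR {0} (PR {0} (TU U V))"
  have A: "ideal_of ?A ?K ?c"
    unfolding ideal_of_def
  proof (intro conjI ballI)
    show "subsp ?A" by (rule subspI) (simp_all add: subsp_add subsp_smult)
    show "?A \<subseteq> ?K" by auto
    fix x y assume "x \<in> ?K" "y \<in> ?A"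
    then show "?c x y \<in> ?A" by (simp add: tens_linear subsp_diff)
  qed
  have ab: "?c x y = 0" if "x \<in> ?A" "y \<in> ?A" for x y
    using that by - (rule pr_eqI; rule pr_eqI; simp add: tens_linear)
  obtain Y d f where Y: "lie_alg Y d" "surj_hom ?K ?c Y d f" "kern ?K f = ?A"
    using quotient_exists[OF W.lie_semidirect A] by metis
  have 2: "surj_hom ?K ?c (PR S V) (SB b \<sigma>) (\<lambda>k. pr (p1 (p1 k)) (p1 (p2 k)))"
  proof (rule surj_hom_semidirect[OF U.surj_hom_p1])
    show "p1 ` ?W = V" by (rule p1_image) simp
  qed (auto simp: linear_on_def TU_superset subsp_add tact_in)
  have YF: "(Y, d) \<in> FF"
  proof (rule F_subdirect[OF W.lie_semidirect Y(1,2) U(2)[unfolded HH_def] W.surj_hom_p1 V(2)[unfolded HH_def] 2])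
    fix x :: "'a vec" assume x: "x \<in> ?K" "p1 x = 0" "pr (p1 (p1 x)) (p1 (p2 x)) = 0"
    have "p1 (p2 x) = 0" using arg_cong[OF x(3), of p2] by simp
    then have "x \<in> kern ?K f" using x Y(3) by simp
    then show "f x = 0" by (simp add: kern_def)
  qed
  have "(?K, ?c) \<in> FF"
  proof (rule F_frattini[OF W.lie_semidirect YF Y(2)])
    show "kern ?K f \<subseteq> frattini ?K ?c"
    proof -
      have "?A \<subseteq> M" if M: "max_subalg M ?K ?c" for M
      proof (rule ccontr)
        assume nA: "\<not> ?A \<subseteq> M"
        note dec = K.max_subalg_ideal[OF M A nA]
        have M': "subsp M" "M \<subseteq> ?K" "\<And>x y. x \<in> M \<Longrightarrow> y \<in> M \<Longrightarrow> ?c x y \<in> M"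
          using M by (auto simp: max_subalg_def subalg_def)
        have gen: "pr 0 (pr 0 (tens u v)) \<in> M" if uv: "u \<in> U" "v \<in> V" for u v
        proof -
          let ?k = "pr (pr 0 u) 0" and ?l = "pr 0 (pr v 0)"
          have k: "?k \<in> ?K" and l: "?l \<in> ?K" using uv by auto
          obtain m a where m: "?k = m + a" "m \<in> M" "a \<in> ?A" using dec[OF k] by blast
          obtain m' a' where m': "?l = m' + a'" "m' \<in> M" "a' \<in> ?A" using dec[OF l] by blast
          have e: "m = ?k - a" "m' = ?l - a'" using m m' by (simp_all add: eq_diff_eq)
          \<comment> \<open>The corrections \<open>a\<close> and \<open>a'\<close> leave the bracket
            unchanged, because \<open>A\<close> is abelian and is annihilated by \<open>u\<close>
            and by \<open>v\<close>.\<close>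
          have "?c m m' = pr 0 (pr 0 (tens u v))"
            unfolding e using m(3) m'(3) uv subsp_minus[OF TUsub]
            by (simp add: pr_eq_iff[of _ "pr _ _"] tens_linear T.act_lin[THEN lin_minus])
          then show ?thesis using M'(3)[OF m(2) m'(2)] by simp
        qed
        have "TU U V \<subseteq> {t. pr 0 (pr 0 t) \<in> M}"
        proof (rule TU_min)
          have "pr 0 (pr 0 (s + t)) = pr 0 (pr 0 s) + pr 0 (pr 0 t)" "pr 0 (pr 0 (smult k t)) = smult k (pr 0 (pr 0 t))"
            "pr 0 (pr 0 0) = (0 :: 'a vec)" for s t :: "'a vec" and k
            by (simp_all add: pr_eq_iff[of "pr _ _"])
          then show "subsp {t. pr 0 (pr 0 t) \<in> M}" using M'(1) by (intro subspI) (simp_all add: subsp_add subsp_smult)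
        qed (use gen in blast)
        note TM = this
        have "?A \<subseteq> M"
        proof
          fix x assume x: "x \<in> ?A"
          then have "p2 (p2 x) \<in> TU U V" by simp
          then have "pr 0 (pr 0 (p2 (p2 x))) \<in> M" using TM by blast
          moreover have "pr 0 (pr 0 (p2 (p2 x))) = x" using x by (simp add: pr_eq_iff[of "pr _ _"])
          ultimately show "x \<in> M" by simp
        qed
        then show False using nA by blast
      qed
      then show ?thesis using Y(3) A by (auto simp: frattini_def ideal_of_def)
    qed
    show "?c x y = 0" if "x \<in> kern ?K f" "y \<in> kern ?K f" for x y using that ab Y(3) by blast
  qed
  then show ?thesis
  proof (rule HH_fibre[OF _ surj_hom_comp[OF W.surj_hom_p1 U.surj_hom_p1] A ab gmod_tensor])
    show "linear_on ?A (\<lambda>x. p2 (p2 x))" by (auto simp: linear_on_def)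
    show "(\<lambda>x. p2 (p2 x)) ` ?A = TU U V"
    proof
      show "TU U V \<subseteq> (\<lambda>x. p2 (p2 x)) ` ?A" by (intro subsetI image_eqI[of _ _ "pr 0 (pr 0 x)" for x]) auto
    qed auto
    fix k a assume "k \<in> ?K" "a \<in> ?A"
    then show "p2 (p2 (?c k a)) = \<theta> (p1 (p1 k)) (p2 (p2 a))" by (simp add: tens_linear)
  qed
qed

section \<open>The trivial module and the adjoint module\<close>

definition EE :: "'a vec set" where "EE = {smult c (unitv 0) | c. True}"

lemma EE_mem [simp]: "smult c (unitv 0) \<in> EE"
  by (auto simp: EE_def)

lemma subsp_EE: "subsp EE"
  unfolding EE_def
proof (rule subspI)
  show "0 \<in> {smult c (unitv 0 :: 'a vec) | c. True}" by (metis (mono_tags) mem_Collect_eq smult_simps(2))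
qed (auto simp: smult_distrib(2)[symmetric])

lemma fdsub_EE: "fdsub EE"
  using subsp_EE unfolding fdsub_def by (intro conjI exI[of _ 1]) (auto simp: EE_def vsupp_def unitv_def pointwise)

lemma lie_EE: "lie_alg EE (\<lambda>_ _. 0)"
  by (rule lie_algI) (use fdsub_EE subsp_EE in auto)

text \<open>A nonzero soluble algebra differs from its derived algebra, so some coordinate of the
  projection along the derived algebra is a nonzero functional on \<open>S\<close> that kills all
  brackets. It maps \<open>S\<close> onto the one-dimensional algebra. This is where
  \<open>S\<close> being nonzero enters.\<close>

lemma EE_F:
  assumes S0: "S \<noteq> {0}" shows "(EE, \<lambda>_ _. 0) \<in> FF"
proof -
  have "derived b S \<noteq> S"
  proof
    assume D: "derived b S = S"
    have "(derived b ^^ k) S = S" for k by (induction k) (auto simp: D)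
    moreover have "soluble S b" using form S by (auto simp: formation_def)
    ultimately show False using S0 by (auto simp: soluble_def)
  qed
  moreover have ideal: "ideal_of (derived b S) S b" "derived b S \<subseteq> S"
    using S.ideal_derived[of S] by (auto simp: ideal_of_def)
  ultimately obtain s where s: "s \<in> S" "s \<notin> derived b S" by blast
  have sD: "subsp (derived b S)" using ideal by (simp add: ideal_of_def)
  obtain g where g: "linear_on UNIV g" "\<And>x. g x - x \<in> derived b S" "\<And>x. x \<in> derived b S \<Longrightarrow> g x = 0"
    using ex_projection[OF sD] by blast
  have "g s \<noteq> 0" using g(2)[of s] s sD subsp_minus[of "derived b S" "- s"] by auto
  then obtain i where i: "g s i \<noteq> 0" by (metis ext zero_fun_apply)
  let ?f = "\<lambda>x. smult (g x i) (unitv 0) :: 'a vec"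
  have "surj_hom S b EE (\<lambda>_ _. 0) ?f"
  proof (rule surj_homI)
    show "linear_on S ?f"
      using g(1) by (auto intro!: linear_onI simp: lin_add lin_smult pointwise smult_distrib)
    show "?f ` S = EE"
    proof
      show "EE \<subseteq> ?f ` S"
      proof
        fix e :: "'a vec" assume "e \<in> EE"
        then obtain c where c: "e = smult c (unitv 0)" by (auto simp: EE_def)
        have "e = ?f (smult (c / g s i) s)" using i g(1) c by (simp add: lin_smult pointwise)
        then show "e \<in> ?f ` S" using s subsp_smult[OF S.sub] by blast
      qed
    qed auto
    fix x y assume "x \<in> S" "y \<in> S"
    then have "b x y \<in> {b x y | x y. x \<in> S \<and> y \<in> S}" by blast
    then have "b x y \<in> derived b S" by (simp add: derived_def subsetD[OF vspan_superset])
    then show "?f (b x y) = 0" using g(3) by (simp add: pointwise)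
  qed
  then show ?thesis using F_image S lie_EE by blast
qed

lemma gmod_EE: "gmod X b EE (\<lambda>_ _. 0)"
  by (rule gmodI) (use fdsub_EE subsp_EE in auto)

lemma HH_EE:
  assumes S0: "S \<noteq> {0}" shows "HH EE (\<lambda>_ _. 0)"
proof -
  interpret lmod S b EE "\<lambda>_ _. 0" by unfold_locales (rule gmod_EE)
  have 2: "surj_hom (PR S EE) (SB b (\<lambda>_ _. 0)) EE (\<lambda>_ _. 0) p2"
  proof (rule surj_homI)
    show "p2 ` PR S EE = EE" by (rule p2_image) simp
  qed (auto simp: linear_on_def)
  show ?thesis unfolding HH_def
  proof (rule F_subdirect[OF lie_semidirect lie_semidirect surj_hom_id S surj_hom_p1 EE_F[OF S0] 2])
    fix x :: "'a vec" assume "p1 x = 0" "p2 x = 0"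
    then show "x = 0" by - (rule pr_eqI, simp_all)
  qed
qed

lemma HH_zero:
  assumes "gmod S b U \<rho>" shows "HH {0} \<rho>"
proof -
  interpret lmod S b U \<rho> by unfold_locales (rule assms)
  interpret Z: lmod S b "{0}" \<rho> by unfold_locales (rule submodule, auto)
  have "surj_hom S b (PR S {0}) (SB b \<rho>) (\<lambda>x. pr x 0)"
  proof (rule surj_homI)
    show "linear_on S (\<lambda>x. pr x 0)" by (auto intro!: linear_onI simp: pr_eq_iff[of "pr _ _"])
    show "(\<lambda>x. pr x 0) ` S = PR S {0}"
    proof
      show "PR S {0} \<subseteq> (\<lambda>x. pr x 0) ` S"
      proof
        fix x assume "x \<in> PR S {0}"
        then have "x = pr (p1 x) 0" "p1 x \<in> S" by (metis mem_PR pr_p singletonD)+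
        then show "x \<in> (\<lambda>x. pr x 0) ` S" by blast
      qed
    qed auto
    show "pr (b x y) 0 = SB b \<rho> (pr x 0) (pr y 0)" if "x \<in> S" "y \<in> S" for x y
      using that by (simp add: pr_eq_iff[of "pr _ _"])
  qed
  then show ?thesis unfolding HH_def using F_image S Z.lie_semidirect by blast
qed

text \<open>The climb goes up the derived series from its zero term. Each derived term becomes an
  abelian ideal in the quotient of \<open>S\<close> by the next term, which is in the class;
  \<open>F_fibre\<close> supplies the algebra for that factor and \<open>HH_climb\<close> adds
  it.\<close>

lemma HH_derived: "HH ((derived b ^^ k) S) b"
proof -
  let ?D = "\<lambda>k. (derived b ^^ k) S"
  have id: "ideal_of (?D k) S b" for k by (rule S.ideal_derived_pow)
  obtain m where m: "?D m = {0}" using form S by (auto simp: formation_def soluble_def)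
  have step: "HH (?D k) b" if H: "HH (?D (Suc k)) b" for k
  proof -
    have gm: "gmod S b (?D k) b" by (rule S.adjoint_ideal[OF id])
    obtain Z d q where Z: "lie_alg Z d" "surj_hom S b Z d q" "kern S q = ?D (Suc k)"
      using quotient_exists[OF F_lie[OF S] id] by metis
    note q = surj_homD[OF Z(2)]
    have Dk: "subsp (?D k)" "?D k \<subseteq> S" "\<And>x y. x \<in> S \<Longrightarrow> y \<in> ?D k \<Longrightarrow> b x y \<in> ?D k"
      using id[of k] by (auto simp: ideal_of_def)
    have qz: "q x = 0 \<longleftrightarrow> x \<in> ?D (Suc k)" if "x \<in> S" for x
      using that unfolding Z(3)[symmetric] by (simp add: kern_def)
    have A: "ideal_of (q ` ?D k) Z d"
      unfolding ideal_of_def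
    proof (intro conjI ballI)
      show "subsp (q ` ?D k)" using subsp_image[OF Dk(1) linear_on_subset[OF q(1) Dk(2)]] .
      show "q ` ?D k \<subseteq> Z" using q(4) Dk by blast
      fix x y assume "x \<in> Z" "y \<in> q ` ?D k"
      then obtain s v where "s \<in> S" "x = q s" "v \<in> ?D k" "y = q v" using q(2) by blast
      then have "d x y = q (b s v)" "b s v \<in> ?D k" using q(3)[of s v] Dk by auto
      then show "d x y \<in> q ` ?D k" by blast
    qed
    have ab: "d x y = 0" if xy: "x \<in> q ` ?D k" "y \<in> q ` ?D k" for x y
    proof -
      obtain s v where sv: "s \<in> ?D k" "x = q s" "v \<in> ?D k" "y = q v" using xy by blast
      then have "b s v \<in> {b x y | x y. x \<in> ?D k \<and> y \<in> ?D k}" by blast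
      then have "b s v \<in> ?D (Suc k)" by (simp add: derived_def subsetD[OF vspan_superset])
      then have "q (b s v) = 0" using qz[of "b s v"] sv Dk by auto
      moreover have "q (b s v) = d x y" using q(3)[of s v] sv Dk by auto
      ultimately show ?thesis by simp
    qed
    have hom: "surj_hom (PR S (?D k)) (SB b b) (PR Z (q ` ?D k)) (SB d d) (\<lambda>x. pr (q (p1 x)) (q (p2 x)))"
      by (rule surj_hom_semidirect[OF Z(2) linear_on_subset[OF q(1) Dk(2)] refl]) (use Dk q in auto)
    show ?thesis
    proof (rule HH_climb[OF gm _ _ _ H F_fibre[OF F_image[OF S Z(2,1)] A ab] hom])
      show "subsp (?D (Suc k))" "\<And>x v. x \<in> S \<Longrightarrow> v \<in> ?D (Suc k) \<Longrightarrow> b x v \<in> ?D (Suc k)"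
        using id[of "Suc k"] by (auto simp: ideal_of_def)
      show "?D (Suc k) \<subseteq> ?D k" using S.ideal_derived(2)[OF id[of k]] by simp
      fix n assume n: "n \<in> ?D k"
      have q0: "q 0 = 0" using lin_0[OF q(1)] by simp
      have "pr 0 (q n) = 0 \<longleftrightarrow> q n = 0" by (auto simp: pr_eq_iff[of "pr _ _"])
      then show "pr (q (p1 (pr 0 n))) (q (p2 (pr 0 n))) = 0 \<longleftrightarrow> n \<in> ?D (Suc k)"
        using qz[of n] n Dk q0 by auto
    qed
  qed
  have "HH (?D (m - j)) b" for j
  proof (induction j)
    case 0
    have "gmod S b S b" by (rule S.adjoint_ideal) (auto simp: ideal_of_def)
    then show ?case using HH_zero m by simp
  next
    case (Suc j)
    show ?case
    proof (cases "j < m")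
      case True
      then have "m - j = Suc (m - Suc j)" by simp
      then show ?thesis using step Suc by metis
    qed (use Suc in simp)
  qed
  note low = this
  show ?thesis
  proof (cases "k \<le> m")
    case True
    then show ?thesis using low[of "m - k"] by simp
  next
    case False
    then have "?D k = ?D m"
    proof -
      have z: "derived b {0} = {0}" using S.ideal_derived(2)[of "{0}"] subsp_0[of "derived b {0}"]
        by (auto simp: ideal_of_def derived_def)
      have "?D (m + j) = {0}" for j by (induction j) (simp_all add: m z)
      then show ?thesis using False m by (metis le_add_diff_inverse nat_le_linear)
    qed
    then show ?thesis using low[of 0] by simp
  qed
qed

end

section \<open>Climbing the subnormal chain\<close>

locale subnormal_member = formation_member FF S b + X: lie X b
  for FF :: "('a::field) lie_class" and S X b +
  assumes sn: "subnormal S X b" and S0: "S \<noteq> {0}"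
begin

lemma SX: "S \<subseteq> X" "subalg S X b"
proof -
  obtain Ss where "Ss \<noteq> []" "hd Ss = S" "\<forall>T\<in>set Ss. subalg T X b" using sn by (auto simp: subnormal_def)
  then show "subalg S X b" by (metis hd_in_set)
  then show "S \<subseteq> X" by (simp add: subalg_def)
qed

text \<open>Brackets of \<open>S\<close> with \<open>B\<close> fall into \<open>A\<close>, as
  \<open>S \<subseteq> A\<close> and \<open>A\<close> is an ideal of \<open>B\<close>. Hence every
  subspace between \<open>A\<close> and \<open>B\<close> is stable under \<open>S\<close>, and a
  maximal one with \<open>HH\<close> can be enlarged by one vector: the new factor is
  one-dimensional and trivial, and the algebra from \<open>EE_F\<close> represents it in
  \<open>HH_climb\<close>.\<close>

lemma HH_step:
  assumes A: "subalg A X b" "S \<subseteq> A" "HH A b" and B: "subalg B X b" "ideal_of A B b"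
  shows "HH B b"
proof -
  have A': "subsp A" "A \<subseteq> X" "A \<subseteq> B" "\<And>x y. x \<in> B \<Longrightarrow> y \<in> A \<Longrightarrow> b x y \<in> A"
    and B': "subsp B" "B \<subseteq> X" using A B by (auto simp: subalg_def ideal_of_def)
  have SB: "b s v \<in> A" if "s \<in> S" "v \<in> B" for s v
  proof -
    interpret B: lie B b by unfold_locales (rule lie_subalg[OF X.lie B(1)])
    show ?thesis using B.ideal_r[OF B(2)] that A(2) by blast
  qed
  have gX: "gmod S b X b"
  proof -
    interpret lmod X b X b by unfold_locales (rule X.adjoint_ideal, auto simp: ideal_of_def)
    show ?thesis using restrict SX by blast
  qed
  interpret gX: lmod S b X b by unfold_locales (rule gX)
  define P where "P N \<longleftrightarrow> subsp N \<and> A \<subseteq> N \<and> N \<subseteq> B \<and> HH N b" for N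
  obtain N where N: "P N" and max: "\<And>N'. P N' \<Longrightarrow> N \<subseteq> N' \<Longrightarrow> N' = N"
    using ex_max_subspace[of B P A] A' A B' fdsub_subset[OF X.fd] by (auto simp: P_def)
  have N': "subsp N" "A \<subseteq> N" "N \<subseteq> B" "HH N b" using N by (auto simp: P_def)
  have "N = B"
  proof (rule ccontr)
    assume "N \<noteq> B"
    then obtain v where v: "v \<in> B" "v \<notin> N" using N' by blast
    obtain g where g: "linear_on UNIV g" "\<And>x. g x - x \<in> N" "\<And>x. x \<in> N \<Longrightarrow> g x = 0"
      using ex_projection[OF N'(1)] by blast
    have "g v \<noteq> 0" using g(2)[of v] v N' subsp_minus[of N "- v"] by auto
    then obtain i where i: "g v i \<noteq> 0" by (metis ext zero_fun_apply)
    \<comment> \<open>The functional vanishes on \<open>N\<close> and is normalised by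
      \<open>l v = 1\<close>, so on \<open>N1\<close> it reads off the coefficient of
      \<open>v\<close>.\<close>
    define l where "l = (\<lambda>x. g x i / g v i)"
    define N1 where "N1 = {n + smult c v | n c. n \<in> N}"
    have lN: "l (n + smult c v) = c" if "n \<in> N" for n c
      using g i that by (simp add: l_def lin_add lin_smult pointwise)
    have N1v: "n + smult c v \<in> N1" if "n \<in> N" for n c using that by (auto simp: N1_def)
    have N1s: "subsp N1"
    proof (rule subspI)
      show "0 \<in> N1" using N1v[of 0 0] N' by simp
    next
      fix x y assume "x \<in> N1" "y \<in> N1"
      then obtain n c m d where "x = n + smult c v" "y = m + smult d v" "n \<in> N" "m \<in> N" by (auto simp: N1_def)
      then show "x + y \<in> N1" using N1v[of "n + m" "c + d"] N' by (simp add: subsp_add smult_distrib algebra_simps)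
    next
      fix k x assume "x \<in> N1"
      then obtain n c where "x = n + smult c v" "n \<in> N" by (auto simp: N1_def)
      then show "smult k x \<in> N1" using N1v[of "smult k n" "k * c"] N' by (simp add: subsp_smult smult_distrib)
    qed
    have N1: "N \<subseteq> N1" "N1 \<subseteq> B" "v \<in> N1"
      using N1v[of _ 0] N1v[of 0 1] N' v B' by (auto simp: N1_def subset_iff subsp_add subsp_smult)
    have stab: "b x n \<in> N" if "x \<in> S" "n \<in> N1" for x n using SB N1 that N' by blast
    have gm: "gmod S b N1 b"
      by (rule gX.submodule) (use N1s N1 B' stab in auto)
    interpret M: lmod S b N1 b by unfold_locales (rule gm)
    let ?f = "\<lambda>k. smult (l (p2 k)) (unitv 0) :: 'a vec"
    have hom: "surj_hom (PR S N1) (SB b b) EE (\<lambda>_ _. 0) ?f"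
    proof (rule surj_homI)
      show "linear_on (PR S N1) ?f"
        using g(1) by (auto intro!: linear_onI simp: l_def lin_add lin_smult pointwise smult_distrib(2)[symmetric] add_divide_distrib)
      show "?f ` PR S N1 = EE"
      proof
        show "EE \<subseteq> ?f ` PR S N1"
        proof
          fix e :: "'a vec" assume "e \<in> EE"
          then obtain c where c: "e = smult c (unitv 0)" by (auto simp: EE_def)
          have "e = ?f (pr 0 (0 + smult c v))" using c lN[of 0 c] N' by simp
          then show "e \<in> ?f ` PR S N1" using N1v[of 0 c] N' by (intro image_eqI[of _ _ "pr 0 (0 + smult c v)"]) auto
        qed
      qed auto
      fix x y assume "x \<in> PR S N1" "y \<in> PR S N1"
      then have "p2 (SB b b x y) \<in> N" using stab N' by (auto intro: subsp_diff)
      then have "l (p2 (SB b b x y)) = 0" using lN[of _ 0] by simp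
      then show "?f (SB b b x y) = 0" by simp
    qed
    have "HH N1 b"
    proof (rule HH_climb[OF gm N'(1) N1(1) _ N'(4) EE_F[OF S0] hom])
      show "b x v \<in> N" if "x \<in> S" "v \<in> N" for x v using that stab N1 by blast
      fix n assume "n \<in> N1"
      then obtain m c where n: "n = m + smult c v" "m \<in> N" by (auto simp: N1_def)
      have u: "unitv 0 \<noteq> (0 :: 'a vec)" by (auto simp: unitv_def fun_eq_iff pointwise)
      have "smult c (unitv 0 :: 'a vec) = 0 \<longleftrightarrow> c = 0" using u by (metis smult_simps(2,3,4) left_inverse smult_simps(1))
      moreover have "n \<in> N \<longleftrightarrow> c = 0"
        using n lN[of n 0] lN[of m c] by auto
      ultimately show "?f (pr 0 n) = 0 \<longleftrightarrow> n \<in> N" using lN[OF n(2)] n by simp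
    qed
    then have "P N1" using N1 N1s N' by (auto simp: P_def)
    then show False using max N1 v by blast
  qed
  then show ?thesis using N' by simp
qed

lemma HH_adjoint: "HH X b"
proof -
  obtain Ss where Ss: "Ss \<noteq> []" "hd Ss = S" "last Ss = X" "\<forall>T\<in>set Ss. subalg T X b"
    "\<forall>i. Suc i < length Ss \<longrightarrow> ideal_of (Ss ! i) (Ss ! Suc i) b"
    using sn by (auto simp: subnormal_def)
  have "i < length Ss \<Longrightarrow> S \<subseteq> Ss ! i \<and> HH (Ss ! i) b" for i
  proof (induction i)
    case 0
    then show ?case using Ss HH_derived[of 0] by (simp add: hd_conv_nth)
  next
    case (Suc i)
    then have *: "S \<subseteq> Ss ! i" "HH (Ss ! i) b" "ideal_of (Ss ! i) (Ss ! Suc i) b" using Ss(5) by auto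
    then show ?case using HH_step[of "Ss ! i" "Ss ! Suc i"] Ss(4) Suc.prems by (auto simp: ideal_of_def)
  qed
  from this[of "length Ss - 1"] show ?thesis using Ss by (simp add: last_conv_nth)
qed

end

section \<open>Hypercentral modules\<close>

lemma comp_series_exists:
  fixes U :: "('k::field) vec set"
  assumes n: "U \<subseteq> vsupp n" and U: "submod X \<rho> U U" and 0: "submod X \<rho> U {0}"
  obtains Ns where "comp_series X \<rho> U Ns"
proof -
  have "\<exists>Ns. Ns \<noteq> [] \<and> hd Ns = {0} \<and> last Ns = V \<and> (\<forall>N\<in>set Ns. submod X \<rho> U N) \<and>
     (\<forall>i. Suc i < length Ns \<longrightarrow> Ns ! i \<subset> Ns ! Suc i \<and>
        \<not> (\<exists>T. submod X \<rho> U T \<and> Ns ! i \<subset> T \<and> T \<subset> Ns ! Suc i))" if "submod X \<rho> U V" for V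
    using that
  proof (induction "vdim V" arbitrary: V rule: less_induct)
    case less
    have V: "subsp V" "V \<subseteq> vsupp n" using less.prems n by (auto simp: submod_def)
    show ?case
    proof (cases "V = {0}")
      case True
      then show ?thesis using 0 by (intro exI[of _ "[{0}]"]) auto
    next
      case False
      let ?P = "\<lambda>N. submod X \<rho> U N \<and> N \<subset> V"
      have fdV: "fdsub V" using V by (auto simp: fdsub_def)
      have P0: "?P {0}" using 0 False subsp_0[OF V(1)] by auto
      have Ps: "\<And>N. ?P N \<Longrightarrow> subsp N \<and> N \<subseteq> V" by (auto simp: submod_def)
      obtain N where N: "?P N" and max: "\<And>N'. ?P N' \<Longrightarrow> N \<subseteq> N' \<Longrightarrow> N' = N"
        by (rule ex_max_subspace[OF fdV, of ?P, OF P0 Ps]) (assumption | rule that)+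
      have "vdim N < vdim V" using vdim_less[of N V n] N V by (auto simp: submod_def)
      then obtain Ns where Ns: "Ns \<noteq> []" "hd Ns = {0}" "last Ns = N" "\<forall>N\<in>set Ns. submod X \<rho> U N"
        "\<And>i. Suc i < length Ns \<Longrightarrow> Ns ! i \<subset> Ns ! Suc i \<and> \<not> (\<exists>T. submod X \<rho> U T \<and> Ns ! i \<subset> T \<and> T \<subset> Ns ! Suc i)"
        using less.hyps[of N] N by auto
      have "(Ns @ [V]) ! i \<subset> (Ns @ [V]) ! Suc i \<and>
          \<not> (\<exists>T. submod X \<rho> U T \<and> (Ns @ [V]) ! i \<subset> T \<and> T \<subset> (Ns @ [V]) ! Suc i)"
        if i: "Suc i < length (Ns @ [V])" for i
      proof (cases "Suc i < length Ns")
        case True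
        then show ?thesis using Ns(5)[of i] by (simp add: nth_append)
      next
        case False
        then have "i = length Ns - 1" using i by simp
        then have "(Ns @ [V]) ! i = N" "(Ns @ [V]) ! Suc i = V"
          using Ns(1,3) by (auto simp: nth_append last_conv_nth)
        then show ?thesis using N max by (metis psubset_imp_subset psubset_eq)
      qed
      then show ?thesis using Ns less.prems by (intro exI[of _ "Ns @ [V]"]) auto
    qed
  qed
  from this[OF U] show ?thesis using that unfolding comp_series_def by blast
qed

lemma comp_series_submod:
  assumes "comp_series X \<rho> U Ns" "i < length Ns" shows "submod X \<rho> U (Ns ! i)"
  using assms by (auto simp: comp_series_def)

lemma lie_mod_gmod: "lie_mod X b n \<rho> \<longleftrightarrow> gmod X b (vsupp n) \<rho>"
  by (auto simp: lie_mod_def gmod_def fdsub_def)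

context lmod
begin

lemma submod_whole: "submod X \<rho> U U" and submod_zero: "submod X \<rho> U {0}"
  by (auto simp: submod_def)

lemma submod_gmod: "submod X \<rho> U N \<Longrightarrow> gmod X b N \<rho>"
  by (rule submodule) (auto simp: submod_def)

end

text \<open>\<open>fcentral_factor\<close> picks preimages by \<open>SOME\<close>. Two preimages
  differ by an element of the submodule \<open>N\<close>, so the action on the factor does not
  depend on the choice.\<close>

lemma quotient_action:
  assumes N: "submod X \<rho> U N" and N': "submod X \<rho> U N'" and lin: "\<And>x. x \<in> X \<Longrightarrow> linear_on U (\<rho> x)"
    and \<pi>: "linear_on N' \<pi>" "kern N' \<pi> = N" and x: "x \<in> X" and v: "v \<in> N'"
  shows "\<pi> (\<rho> x (SOME w. w \<in> N' \<and> \<pi> w = \<pi> v)) = \<pi> (\<rho> x v)"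
proof -
  let ?w = "SOME w. w \<in> N' \<and> \<pi> w = \<pi> v"
  have w: "?w \<in> N' \<and> \<pi> ?w = \<pi> v" by (rule someI[of _ v]) (use v in simp)
  have s: "subsp N'" "N' \<subseteq> U" using N' by (auto simp: submod_def)
  have "?w - v \<in> N" using \<pi> w v s by (auto simp: kern_def subsp_diff lin_diff)
  then have "\<rho> x (?w - v) \<in> N" using N x by (auto simp: submod_def)
  then have 1: "\<pi> (\<rho> x (?w - v)) = 0" using \<pi> by (auto simp: kern_def)
  have "\<rho> x (?w - v) = \<rho> x ?w - \<rho> x v"
    using lin_diff[OF linear_on_subset[OF lin[OF x] s(2)] s(1)] w v by blast
  moreover have "\<rho> x ?w \<in> N'" "\<rho> x v \<in> N'" using N' x w v by (auto simp: submod_def)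
  ultimately have "\<pi> (\<rho> x (?w - v)) = \<pi> (\<rho> x ?w) - \<pi> (\<rho> x v)" using lin_diff[OF \<pi>(1) s(1)] by simp
  then show ?thesis using 1 by simp
qed

section \<open>The coordinate model of a split extension\<close>

lemma fcentral_factorE:
  assumes "fcentral_factor FF S b \<rho> N N'"
  obtains m Q \<pi> Y c f \<sigma> bSD where "Q \<subseteq> vsupp m" "linear_on N' \<pi>" "\<pi> ` N' = Q" "kern N' \<pi> = N"
    "\<sigma> = (\<lambda>x q. \<pi> (\<rho> x (SOME v. v \<in> N' \<and> \<pi> v = q)))"
    "bSD = (\<lambda>u w. vjoin m (\<sigma> (vsnd m u) (vfst m w) - \<sigma> (vsnd m w) (vfst m u)) (b (vsnd m u) (vsnd m w)))"
    "surj_hom {vjoin m q x | q x. q \<in> Q \<and> x \<in> S} bSD Y c f"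
    "kern {vjoin m q x | q x. q \<in> Q \<and> x \<in> S} f = {vjoin m 0 x | x. x \<in> {x\<in>S. \<forall>v\<in>N'. \<rho> x v \<in> N}}"
    "(Y, c) \<in> FF"
  using assms unfolding fcentral_factor_def Let_def
  by (elim exE conjE) (rule that[OF _ _ _ _ refl refl])

lemma vjoin_simps [simp]:
  "q \<in> vsupp m \<Longrightarrow> vfst m (vjoin m q x) = q" "vsnd m (vjoin m q x) = x"
  by (auto simp: vjoin_def vfst_def vsnd_def vsupp_def fun_eq_iff)

lemma vjoin_linear:
  fixes q x :: "('a::field) vec"
  shows "vjoin m (q + q') (x + x') = vjoin m q x + vjoin m q' x'"
    "vjoin m (smult c q) (smult c x) = smult c (vjoin m q x)"
  by (auto simp: vjoin_def fun_eq_iff pointwise)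

lemma vjoin_eq_iff: "q \<in> vsupp m \<Longrightarrow> q' \<in> vsupp m \<Longrightarrow> vjoin m q x = vjoin m q' x' \<longleftrightarrow> q = q' \<and> x = x'"
  by (metis vjoin_simps)

context formation_member
begin

text \<open>\<open>vjoin\<close>, \<open>\<sigma>\<close> and \<open>bSD\<close> spell out the coordinate model of the split extension that
  \<open>fcentral_factor\<close> uses.\<close>

lemma split_extension_hom:
  assumes gm: "gmod S b U \<rho>" and N: "submod S \<rho> U N" and N': "submod S \<rho> U N'"
    and \<pi>: "linear_on N' \<pi>" "kern N' \<pi> = N" and Q: "\<pi> ` N' \<subseteq> vsupp m"
    and \<sigma>: "\<sigma> = (\<lambda>x q. \<pi> (\<rho> x (SOME v. v \<in> N' \<and> \<pi> v = q)))"
    and bSD: "bSD = (\<lambda>u w. vjoin m (\<sigma> (vsnd m u) (vfst m w) - \<sigma> (vsnd m w) (vfst m u)) (b (vsnd m u) (vsnd m w)))"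
  shows "surj_hom (PR S N') (SB b \<rho>) {vjoin m q x | q x. q \<in> \<pi> ` N' \<and> x \<in> S} bSD (\<lambda>k. vjoin m (\<pi> (p2 k)) (p1 k))"
proof (rule surj_homI)
  interpret lmod S b U \<rho> by unfold_locales (rule gm)
  interpret M: lmod S b N' \<rho> by unfold_locales (rule submod_gmod[OF N'])
  show "linear_on (PR S N') (\<lambda>k. vjoin m (\<pi> (p2 k)) (p1 k))"
    using \<pi>(1) by (auto intro!: linear_onI simp: lin_add lin_smult vjoin_linear)
  show "(\<lambda>k. vjoin m (\<pi> (p2 k)) (p1 k)) ` PR S N' = {vjoin m q x | q x. q \<in> \<pi> ` N' \<and> x \<in> S}"
  proof
    show "{vjoin m q x | q x. q \<in> \<pi> ` N' \<and> x \<in> S} \<subseteq> (\<lambda>k. vjoin m (\<pi> (p2 k)) (p1 k)) ` PR S N'"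
    proof
      fix z assume "z \<in> {vjoin m q x | q x. q \<in> \<pi> ` N' \<and> x \<in> S}"
      then obtain v x where "z = vjoin m (\<pi> v) x" "v \<in> N'" "x \<in> S" by blast
      then show "z \<in> (\<lambda>k. vjoin m (\<pi> (p2 k)) (p1 k)) ` PR S N'" by (intro image_eqI[of _ _ "pr x v"]) auto
    qed
    show "(\<lambda>k. vjoin m (\<pi> (p2 k)) (p1 k)) ` PR S N' \<subseteq> {vjoin m q x | q x. q \<in> \<pi> ` N' \<and> x \<in> S}"
      using mem_PR by blast
  qed
  fix k l assume kl: "k \<in> PR S N'" "l \<in> PR S N'"
  have q: "\<pi> (p2 k) \<in> vsupp m" "\<pi> (p2 l) \<in> vsupp m" using Q kl by auto
  have "\<sigma> x (\<pi> v) = \<pi> (\<rho> x v)" if "x \<in> S" "v \<in> N'" for x v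
    unfolding \<sigma> by (rule quotient_action[OF N N' act_lin \<pi> that])
  then show "vjoin m (\<pi> (p2 (SB b \<rho> k l))) (p1 (SB b \<rho> k l)) =
      bSD (vjoin m (\<pi> (p2 k)) (p1 k)) (vjoin m (\<pi> (p2 l)) (p1 l))"
    using kl q \<pi>(1) by (simp add: bSD lin_diff)
qed

text \<open>The composition series is climbed with \<open>HH_climb\<close>. The algebra witnessing
  that a factor is central serves as \<open>Y\<close>: only elements of the Lie algebra part are
  divided out there, so the kernel meets the module part exactly in the lower term.\<close>

lemma fhypercentral_imp_HH:
  assumes gm: "gmod S b (vsupp n) \<rho>" and h: "fhypercentral FF S b n \<rho>"
  shows "HH (vsupp n) \<rho>"
proof -
  interpret lmod S b "vsupp n" \<rho> by unfold_locales (rule gm)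
  obtain Ns where Ns: "comp_series S \<rho> (vsupp n) Ns"
    using comp_series_exists[OF subset_refl submod_whole submod_zero] by blast
  have cs: "Ns \<noteq> []" "hd Ns = {0}" "last Ns = vsupp n"
    "\<And>i. Suc i < length Ns \<Longrightarrow> Ns ! i \<subset> Ns ! Suc i" using Ns by (auto simp: comp_series_def)
  have "i < length Ns \<Longrightarrow> HH (Ns ! i) \<rho>" for i
  proof (induction i)
    case 0
    then show ?case using cs HH_zero[OF gm] by (simp add: hd_conv_nth)
  next
    case (Suc i)
    let ?N = "Ns ! i" and ?N' = "Ns ! Suc i"
    have N: "submod S \<rho> (vsupp n) ?N" and N': "submod S \<rho> (vsupp n) ?N'"
      using comp_series_submod[OF Ns] Suc.prems by simp_all
    have sub: "?N \<subseteq> ?N'" using cs(4) Suc.prems by blast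
    have "fcentral_factor FF S b \<rho> ?N ?N'" using h Ns Suc.prems by (auto simp: fhypercentral_def)
    then obtain m Q \<pi> Y c f \<sigma> bSD where \<pi>: "Q \<subseteq> vsupp m" "linear_on ?N' \<pi>" "\<pi> ` ?N' = Q" "kern ?N' \<pi> = ?N"
      and \<sigma>: "\<sigma> = (\<lambda>x q. \<pi> (\<rho> x (SOME v. v \<in> ?N' \<and> \<pi> v = q)))"
      and bSD: "bSD = (\<lambda>u w. vjoin m (\<sigma> (vsnd m u) (vfst m w) - \<sigma> (vsnd m w) (vfst m u)) (b (vsnd m u) (vsnd m w)))"
      and f: "surj_hom {vjoin m q x | q x. q \<in> Q \<and> x \<in> S} bSD Y c f"
      and ker: "kern {vjoin m q x | q x. q \<in> Q \<and> x \<in> S} f = {vjoin m 0 x | x. x \<in> {x\<in>S. \<forall>v\<in>?N'. \<rho> x v \<in> ?N}}"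
      and Y: "(Y, c) \<in> FF"
      by (rule fcentral_factorE) (rule that)
    have hom: "surj_hom (PR S ?N') (SB b \<rho>) Y c (\<lambda>k. f (vjoin m (\<pi> (p2 k)) (p1 k)))"
      by (rule surj_hom_comp[OF split_extension_hom[OF gm N N' \<pi>(2,4) _ \<sigma> bSD] f[folded \<pi>(3)]])
        (use \<pi> in simp)
    have n: "subsp ?N" "\<And>x v. x \<in> S \<Longrightarrow> v \<in> ?N \<Longrightarrow> \<rho> x v \<in> ?N" using N by (auto simp: submod_def)
    show ?case
    proof (rule HH_climb[OF submod_gmod[OF N'] n(1) sub n(2) _ Y hom])
      show "HH ?N \<rho>" using Suc by simp
      fix v assume v: "v \<in> ?N'"
      let ?SD = "{vjoin m q x | q x. q \<in> Q \<and> x \<in> S}" and ?C = "{x\<in>S. \<forall>v\<in>?N'. \<rho> x v \<in> ?N}"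
      have q: "\<pi> v \<in> Q" "\<pi> v \<in> vsupp m" using \<pi> v by auto
      have C0: "0 \<in> ?C" using n N' by (auto simp: submod_def)
      have "f (vjoin m (\<pi> v) 0) = 0 \<longleftrightarrow> vjoin m (\<pi> v) 0 \<in> kern ?SD f"
        unfolding kern_def using q S.sub subsp_0 by blast
      also have "\<dots> \<longleftrightarrow> \<pi> v = 0"
      proof
        assume "vjoin m (\<pi> v) 0 \<in> kern ?SD f"
        then obtain x where "vjoin m (\<pi> v) 0 = vjoin m 0 x" unfolding ker by blast
        then show "\<pi> v = 0" using vjoin_eq_iff[of "\<pi> v" m 0 0 x] q by simp
      next
        assume "\<pi> v = 0"
        then show "vjoin m (\<pi> v) 0 \<in> kern ?SD f" unfolding ker using C0 by auto
      qed
      also have "\<dots> \<longleftrightarrow> v \<in> ?N" using \<pi>(4) v by (auto simp: kern_def)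
      finally show "f (vjoin m (\<pi> (p2 (pr 0 v))) (p1 (pr 0 v))) = 0 \<longleftrightarrow> v \<in> ?N" by simp
    qed
  qed
  from this[of "length Ns - 1"] show ?thesis using cs by (simp add: last_conv_nth)
qed

text \<open>The term \<open>N'\<close> of the series inherits \<open>HH\<close> as a submodule. The
  split extension over \<open>S\<close> is an image of its semidirect product, and dividing by the
  centraliser, which is an ideal there, stays in the class.\<close>

lemma HH_imp_fhypercentral:
  assumes gm: "gmod S b (vsupp n) \<rho>" and H: "HH (vsupp n) \<rho>"
  shows "fhypercentral FF S b n \<rho>"
  unfolding fhypercentral_def
proof (intro allI impI)
  interpret lmod S b "vsupp n" \<rho> by unfold_locales (rule gm)
  fix Ns i assume Ns: "comp_series S \<rho> (vsupp n) Ns" and i: "Suc i < length Ns"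
  let ?N = "Ns ! i" and ?N' = "Ns ! Suc i"
  have N: "submod S \<rho> (vsupp n) ?N" and N': "submod S \<rho> (vsupp n) ?N'"
    using comp_series_submod[OF Ns] i by simp_all
  have sub: "?N \<subseteq> ?N'" using Ns i by (auto simp: comp_series_def)
  have n: "subsp ?N" "?N \<subseteq> vsupp n" "\<And>x v. x \<in> S \<Longrightarrow> v \<in> ?N \<Longrightarrow> \<rho> x v \<in> ?N"
    and n': "subsp ?N'" "?N' \<subseteq> vsupp n" "\<And>x v. x \<in> S \<Longrightarrow> v \<in> ?N' \<Longrightarrow> \<rho> x v \<in> ?N'"
    using N N' by (auto simp: submod_def)
  interpret M: lmod S b ?N' \<rho> by unfold_locales (rule submod_gmod[OF N'])
  obtain \<pi> where \<pi>: "linear_on UNIV \<pi>" "\<And>x. \<pi> x - x \<in> ?N" "\<And>x. x \<in> ?N \<Longrightarrow> \<pi> x = 0"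
    using ex_projection[OF n(1)] by blast
  have \<pi>l: "linear_on ?N' \<pi>" using \<pi>(1) linear_on_subset by blast
  have \<pi>k: "kern ?N' \<pi> = ?N"
  proof
    show "kern ?N' \<pi> \<subseteq> ?N" using \<pi>(2) subsp_minus[OF n(1)] by (auto simp: kern_def) (metis diff_0 minus_minus)
    show "?N \<subseteq> kern ?N' \<pi>" using \<pi>(3) sub by (auto simp: kern_def)
  qed
  have \<pi>N: "\<pi> v \<in> ?N'" if "v \<in> ?N'" for v using \<pi>(2)[of v] that sub n' by (metis diff_add_cancel subsetD subsp_add)
  have Q: "\<pi> ` ?N' \<subseteq> vsupp n" using \<pi>N n' by auto
  define \<sigma> where "\<sigma> = (\<lambda>x q. \<pi> (\<rho> x (SOME v. v \<in> ?N' \<and> \<pi> v = q)))"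
  define bSD where "bSD = (\<lambda>u w. vjoin n (\<sigma> (vsnd n u) (vfst n w) - \<sigma> (vsnd n w) (vfst n u)) (b (vsnd n u) (vsnd n w)))"
  let ?SD = "{vjoin n q x | q x. q \<in> \<pi> ` ?N' \<and> x \<in> S}" and ?C = "{x\<in>S. \<forall>v\<in>?N'. \<rho> x v \<in> ?N}"
  let ?h = "\<lambda>k. vjoin n (\<pi> (p2 k)) (p1 k)"
  have hom: "surj_hom (PR S ?N') (SB b \<rho>) ?SD bSD ?h"
    by (rule split_extension_hom[OF gm N N' \<pi>l \<pi>k Q \<sigma>_def bSD_def])
  note h = surj_homD[OF hom]
  obtain d where d: "S \<subseteq> vsupp d" using S.fd by (auto simp: fdsub_def)
  have "?SD \<subseteq> vsupp (n + d)" using d by (auto simp: vjoin_def vsupp_def subset_iff)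
  then have SD: "lie_alg ?SD bSD"
    by (intro lie_image[OF M.lie_semidirect h(1) _ h(2)] h(3))
  have "(PR S ?N', SB b \<rho>) \<in> FF" using HH_submodule[OF gm H n'] by (simp add: HH_def)
  then have SDF: "(?SD, bSD) \<in> FF" using F_image hom SD by blast
  have \<sigma>: "\<sigma> x (\<pi> v) = \<pi> (\<rho> x v)" if "x \<in> S" "v \<in> ?N'" for x v
    unfolding \<sigma>_def by (rule quotient_action[OF N N' act_lin \<pi>l \<pi>k that])
  have C: "ideal_of {vjoin n 0 x | x. x \<in> ?C} ?SD bSD"
    unfolding ideal_of_def
  proof (intro conjI ballI)
    have Cs: "subsp ?C"
    proof (rule subspI)
      show "0 \<in> ?C" using n n' by auto
    next
      fix x y assume "x \<in> ?C" "y \<in> ?C"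
      then show "x + y \<in> ?C" using n n' by (auto simp: subset_iff act_ladd subsp_add)
    next
      fix k x assume "x \<in> ?C"
      then show "smult k x \<in> ?C" using n n' by (auto simp: subset_iff act_lsmult subsp_smult)
    qed
    have "linear_on ?C (\<lambda>x. vjoin n 0 x)"
      using vjoin_linear[of n 0 0] vjoin_linear(2)[of n _ 0] by (intro linear_onI) auto
    then have "subsp ((\<lambda>x. vjoin n 0 x) ` ?C)" using subsp_image Cs by blast
    moreover have "(\<lambda>x. vjoin n 0 x) ` ?C = {vjoin n 0 x | x. x \<in> ?C}" by blast
    ultimately show "subsp {vjoin n 0 x | x. x \<in> ?C}" by simp
    have "0 = \<pi> 0" using \<pi>(3) n by simp
    then have "0 \<in> \<pi> ` ?N'" using n' subsp_0 by blast
    then show "{vjoin n 0 x | x. x \<in> ?C} \<subseteq> ?SD" by blast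
    fix u w assume "u \<in> ?SD" "w \<in> {vjoin n 0 x | x. x \<in> ?C}"
    then obtain v y x where u: "u = vjoin n (\<pi> v) y" "v \<in> ?N'" "y \<in> S" and w: "w = vjoin n 0 x" "x \<in> ?C" by blast
    have x: "x \<in> S" using w by simp
    have "\<sigma> y 0 = 0" using \<sigma>[of y 0] u \<pi>(3) n n' by simp
    moreover have "\<sigma> x (\<pi> v) = 0" using \<sigma>[OF x u(2)] w u \<pi>(3) by simp
    ultimately have e: "bSD u w = vjoin n 0 (b y x)" using u w Q by (simp add: bSD_def image_subset_iff)
    have "\<rho> (b y x) t \<in> ?N" if t: "t \<in> ?N'" for t
    proof -
      have "\<rho> (b y x) t = \<rho> y (\<rho> x t) - \<rho> x (\<rho> y t)" using act_brk u x t n' by blast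
      moreover have "\<rho> y (\<rho> x t) \<in> ?N" using n u w t by blast
      moreover have "\<rho> x (\<rho> y t) \<in> ?N" using n' u w t by blast
      ultimately show ?thesis using n by (simp add: subsp_diff)
    qed
    then have "b y x \<in> ?C" using u x by simp
    then show "bSD u w \<in> {vjoin n 0 x | x. x \<in> ?C}" using e by blast
  qed
  obtain Y c f where Y: "lie_alg Y c" "surj_hom ?SD bSD Y c f" "kern ?SD f = {vjoin n 0 x | x. x \<in> ?C}"
    by (rule quotient_exists[OF SD C]) (rule that)
  have YF: "(Y, c) \<in> FF" using F_image SDF Y by blast
  show "fcentral_factor FF S b \<rho> ?N ?N'"
    unfolding fcentral_factor_def Let_def
    by (rule exI[of _ n], rule exI[of _ "\<pi> ` ?N'"], rule exI[of _ \<pi>], intro conjI subsp_image n' \<pi>l Q refl \<pi>k,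
        rule exI[of _ Y], rule exI[of _ c], rule exI[of _ f],
        intro conjI Y(1) Y(2)[unfolded bSD_def \<sigma>_def] Y(3) YF)
qed

end

section \<open>Shuffle products and matrix coefficients\<close>

text \<open>Scaling over an arbitrary index type lets one Leibniz rule serve both functions on words
  and vectors.\<close>

definition fscale :: "'k::comm_ring_1 \<Rightarrow> ('i \<Rightarrow> 'k) \<Rightarrow> 'i \<Rightarrow> 'k" where
  "fscale c f = (\<lambda>i. c * f i)"

lemma fscale_simps: "fscale 1 f = f" "fscale 0 f = 0"
  by (auto simp: fscale_def fun_eq_iff pointwise)

lemma sum_pascal:
  fixes h :: "nat \<Rightarrow> 'k::comm_ring_1"
  shows "(\<Sum>k\<le>Suc n. of_nat (Suc n choose k) * h k) =
    (\<Sum>k\<le>n. of_nat (n choose k) * h (Suc k)) + (\<Sum>k\<le>n. of_nat (n choose k) * h k)"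
proof -
  have "(\<Sum>k\<le>n. of_nat (n choose k) * h k) = (\<Sum>k\<le>Suc n. of_nat (n choose k) * h k)"
    by (simp add: binomial_eq_0)
  also have "\<dots> = h 0 + (\<Sum>k\<le>n. of_nat (n choose Suc k) * h (Suc k))"
    by (subst sum.atMost_Suc_shift) simp
  finally show ?thesis
    by (subst sum.atMost_Suc_shift) (simp add: sum.distrib algebra_simps)
qed

text \<open>Two uses dictate the form: \<open>T\<close> the shuffle product, with all three
  operators prefixing one fixed letter, and \<open>T\<close> the action map, with
  \<open>ad x\<close> on the Lie algebra and \<open>\<rho> x\<close> on the module. The sets
  \<open>A\<close>, \<open>B\<close> and \<open>C\<close> confine the laws to carriers.\<close>

lemma leibniz_power:
  fixes T :: "'u \<Rightarrow> 'v \<Rightarrow> ('i \<Rightarrow> 'k::comm_ring_1)"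
  assumes A: "\<And>a. a \<in> A \<Longrightarrow> D1 a \<in> A" and B: "\<And>b. b \<in> B \<Longrightarrow> D2 b \<in> B"
    and C: "\<And>a b. a \<in> A \<Longrightarrow> b \<in> B \<Longrightarrow> T a b \<in> C"
    and lin: "\<And>I c f. finite (I :: nat set) \<Longrightarrow> (\<And>i. i \<in> I \<Longrightarrow> f i \<in> C) \<Longrightarrow>
       D (\<Sum>i\<in>I. fscale (c i) (f i)) = (\<Sum>i\<in>I. fscale (c i) (D (f i)))"
    and der: "\<And>a b. a \<in> A \<Longrightarrow> b \<in> B \<Longrightarrow> D (T a b) = T (D1 a) b + T a (D2 b)"
    and a: "a \<in> A" and b: "b \<in> B"
  shows "(D ^^ n) (T a b) = (\<Sum>k\<le>n. fscale (of_nat (n choose k)) (T ((D1 ^^ k) a) ((D2 ^^ (n - k)) b)))"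
proof (induction n)
  case 0
  show ?case by (simp add: fscale_simps)
next
  case (Suc n)
  have mem: "(D1 ^^ k) a \<in> A" "(D2 ^^ k) b \<in> B" for k
    by (induction k) (use A B a b in auto)
  define h where "h k = T ((D1 ^^ k) a) ((D2 ^^ (Suc n - k)) b)" for k
  have "(D ^^ Suc n) (T a b) = (\<Sum>k\<le>n. fscale (of_nat (n choose k)) (D (T ((D1 ^^ k) a) ((D2 ^^ (n - k)) b))))"
    using Suc by (simp add: lin mem C)
  also have "\<dots> = (\<Sum>k\<le>n. fscale (of_nat (n choose k)) (h (Suc k) + h k))"
    by (intro sum.cong refl arg_cong[of _ _ "fscale _"]) (simp add: der mem h_def Suc_diff_le)
  also have "\<dots> = (\<Sum>k\<le>Suc n. fscale (of_nat (Suc n choose k)) (h k))"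
  proof
    fix i
    show "(\<Sum>k\<le>n. fscale (of_nat (n choose k)) (h (Suc k) + h k)) i = (\<Sum>k\<le>Suc n. fscale (of_nat (Suc n choose k)) (h k)) i"
      using sum_pascal[of n "\<lambda>k. h k i"]
      by (simp add: sum_apply fscale_def pointwise algebra_simps sum.distrib del: sum.atMost_Suc binomial_Suc_Suc)
  qed
  finally show ?case by (simp add: h_def)
qed

lemma leibniz_prime:
  fixes T :: "'u \<Rightarrow> 'v \<Rightarrow> ('i \<Rightarrow> 'k::comm_ring_1)"
  assumes p: "prime p" "CHAR('k) = p"
    and A: "\<And>a. a \<in> A \<Longrightarrow> D1 a \<in> A" and B: "\<And>b. b \<in> B \<Longrightarrow> D2 b \<in> B"
    and C: "\<And>a b. a \<in> A \<Longrightarrow> b \<in> B \<Longrightarrow> T a b \<in> C"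
    and lin: "\<And>I c f. finite (I :: nat set) \<Longrightarrow> (\<And>i. i \<in> I \<Longrightarrow> f i \<in> C) \<Longrightarrow>
       D (\<Sum>i\<in>I. fscale (c i) (f i)) = (\<Sum>i\<in>I. fscale (c i) (D (f i)))"
    and der: "\<And>a b. a \<in> A \<Longrightarrow> b \<in> B \<Longrightarrow> D (T a b) = T (D1 a) b + T a (D2 b)"
    and a: "a \<in> A" and b: "b \<in> B"
  shows "(D ^^ p) (T a b) = T ((D1 ^^ p) a) b + T a ((D2 ^^ p) b)"
proof -
  have z: "of_nat (p choose k) = (0 :: 'k)" if "k \<in> {..p} - {0, p}" for k
    using dvd_choose_prime[OF _ _ _ p(1), of k] that p(2) by (auto simp: of_nat_eq_0_iff_char_dvd)
  have "p > 0" using p(1) by (simp add: prime_gt_0_nat)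
  have "(D ^^ p) (T a b) = (\<Sum>k\<le>p. fscale (of_nat (p choose k)) (T ((D1 ^^ k) a) ((D2 ^^ (p - k)) b)))"
    by (rule leibniz_power[of A D1 B D2 T C D a b p]) (use assms in blast)+
  also have "\<dots> = (\<Sum>k\<in>{0, p}. fscale (of_nat (p choose k)) (T ((D1 ^^ k) a) ((D2 ^^ (p - k)) b)))"
    by (rule sum.mono_neutral_right) (use z in \<open>auto simp: fscale_simps\<close>)
  also have "\<dots> = T ((D1 ^^ p) a) b + T a ((D2 ^^ p) b)"
    using \<open>p > 0\<close> by (simp add: fscale_simps)
  finally show ?thesis .
qed

section \<open>The shuffle product of functions on words\<close>

fun shuf :: "('x list \<Rightarrow> 'k::comm_ring_1) \<Rightarrow> ('x list \<Rightarrow> 'k) \<Rightarrow> 'x list \<Rightarrow> 'k" where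
  "shuf f g [] = f [] * g []"
| "shuf f g (x # w) = shuf (\<lambda>v. f (x # v)) g w + shuf f (\<lambda>v. g (x # v)) w"

lemma shuf_cong:
  "(\<And>w. w \<in> lists X \<Longrightarrow> f w = f' w) \<Longrightarrow> (\<And>w. w \<in> lists X \<Longrightarrow> g w = g' w) \<Longrightarrow> w \<in> lists X \<Longrightarrow>
    shuf f g w = shuf f' g' w"
proof (induction w arbitrary: f g f' g')
  case Nil
  then show ?case by simp
next
  case (Cons x w)
  have "x \<in> X" "w \<in> lists X" using Cons.prems(3) by auto
  then have "shuf (\<lambda>v. f (x # v)) g w = shuf (\<lambda>v. f' (x # v)) g' w" "shuf f (\<lambda>v. g (x # v)) w = shuf f' (\<lambda>v. g' (x # v)) w"
    using Cons.prems(1,2) by (intro Cons.IH; simp)+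
  then show ?case by simp
qed

lemma shuf_linear:
  "shuf (\<lambda>v. f v + f' v) g w = shuf f g w + shuf f' g w" "shuf f (\<lambda>v. g v + g' v) w = shuf f g w + shuf f g' w"
  "shuf (\<lambda>v. f v - f' v) g w = shuf f g w - shuf f' g w" "shuf f (\<lambda>v. g v - g' v) w = shuf f g w - shuf f g' w"
  "shuf (\<lambda>v. c * f v) g w = c * shuf f g w" "shuf f (\<lambda>v. c * g v) w = c * shuf f g w"
  by (induction w arbitrary: f f' g g') (simp_all add: algebra_simps)

text \<open>The recursion of \<open>shuf\<close> says that prefixing a letter is a derivation, so
  \<open>leibniz_prime\<close> applies to it.\<close>

lemma shuf_prime_power:
  fixes f g :: "'x list \<Rightarrow> 'k::comm_ring_1"
  assumes p: "prime p" "CHAR('k) = p"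
  shows "shuf f g (replicate p x @ w) = shuf (\<lambda>v. f (replicate p x @ v)) g w + shuf f (\<lambda>v. g (replicate p x @ v)) w"
proof -
  let ?D = "\<lambda>f :: 'x list \<Rightarrow> 'k. \<lambda>w. f (x # w)"
  have pow: "(?D ^^ n) f = (\<lambda>w. f (replicate n x @ w))" for n and f :: "'x list \<Rightarrow> 'k"
    by (induction n arbitrary: f) (simp_all del: funpow.simps add: funpow_0 funpow_Suc_right)
  have "(?D ^^ p) (shuf f g) = shuf ((?D ^^ p) f) g + shuf f ((?D ^^ p) g)"
    by (rule leibniz_prime[OF p, of UNIV _ UNIV _ shuf UNIV])
      (auto simp: fun_eq_iff sum_apply fscale_def pointwise)
  then have "(?D ^^ p) (shuf f g) w = shuf ((?D ^^ p) f) g w + shuf f ((?D ^^ p) g) w" by (simp add: pointwise)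
  then show ?thesis by (simp add: pow)
qed

section \<open>Representations, over the ground field or over a second field\<close>

locale lrep =
  fixes X :: "('a::field) vec set" and b :: "'a br" and U :: "('k::field) vec set" and \<rho> :: "'a vec \<Rightarrow> 'k vec \<Rightarrow> 'k vec"
  assumes rsub [simp]: "subsp U" and rcl: "\<And>x y. x \<in> X \<Longrightarrow> y \<in> X \<Longrightarrow> b x y \<in> X"
    and ract [simp, intro]: "\<And>x v. x \<in> X \<Longrightarrow> v \<in> U \<Longrightarrow> \<rho> x v \<in> U"
    and rlin: "\<And>x. x \<in> X \<Longrightarrow> linear_on U (\<rho> x)"
    and rbrk: "\<And>x y v. x \<in> X \<Longrightarrow> y \<in> X \<Longrightarrow> v \<in> U \<Longrightarrow> \<rho> (b x y) v = \<rho> x (\<rho> y v) - \<rho> y (\<rho> x v)"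
begin

lemma radd: "x \<in> X \<Longrightarrow> v \<in> U \<Longrightarrow> w \<in> U \<Longrightarrow> \<rho> x (v + w) = \<rho> x v + \<rho> x w"
  and rsmult: "x \<in> X \<Longrightarrow> v \<in> U \<Longrightarrow> \<rho> x (smult k v) = smult k (\<rho> x v)"
  and rdiff: "x \<in> X \<Longrightarrow> v \<in> U \<Longrightarrow> w \<in> U \<Longrightarrow> \<rho> x (v - w) = \<rho> x v - \<rho> x w"
  and rzero [simp]: "x \<in> X \<Longrightarrow> \<rho> x 0 = 0"
  using lin_add[OF rlin] lin_smult[OF rlin] lin_diff[OF rlin] lin_0[OF rlin] by auto

lemma fold_in [simp, intro]: "w \<in> lists X \<Longrightarrow> v \<in> U \<Longrightarrow> fold \<rho> w v \<in> U"
  by (induction w arbitrary: v) auto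

lemma fold_linear: "w \<in> lists X \<Longrightarrow> linear_on U (fold \<rho> w)"
proof (induction w)
  case (Cons x w)
  then show ?case using linear_on_comp[OF rlin, of x U "fold \<rho> w"] by (auto simp: comp_def)
qed (auto simp: linear_on_def)

lemma pow_in [simp]: "x \<in> X \<Longrightarrow> v \<in> U \<Longrightarrow> (\<rho> x ^^ n) v \<in> U"
  by (induction n) auto

lemma pow_linear: "x \<in> X \<Longrightarrow> linear_on U (\<rho> x ^^ n)"
proof (induction n)
  case (Suc n)
  have "linear_on U (\<lambda>v. \<rho> x ((\<rho> x ^^ n) v))"
    by (rule linear_on_comp[OF Suc.IH[OF Suc.prems] rlin[OF Suc.prems]]) (use Suc.prems in auto)
  then show ?case by (simp add: comp_def)
qed (auto simp: linear_on_def)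

end

text \<open>The action of \<open>x^p - x^[p]\<close>, which is central in the enveloping algebra; a
  character gives its eigenvalues.\<close>

definition zeta :: "nat \<Rightarrow> ('x \<Rightarrow> 'x) \<Rightarrow> ('x \<Rightarrow> ('k::field) vec \<Rightarrow> 'k vec) \<Rightarrow> 'x \<Rightarrow> 'k vec \<Rightarrow> 'k vec" where
  "zeta p pm \<rho> x v = (\<rho> x ^^ p) v - \<rho> (pm x) v"

locale lrep_p = lrep X b U \<rho>
  for X :: "('a::field) vec set" and b and U :: "('k::field) vec set" and \<rho> +
  fixes p :: nat and pm :: "'a vec \<Rightarrow> 'a vec"
  assumes p: "prime p" "CHAR('k) = p"
    and pm: "\<And>x. x \<in> X \<Longrightarrow> pm x \<in> X" "\<And>x y. x \<in> X \<Longrightarrow> y \<in> X \<Longrightarrow> b (pm x) y = (b x ^^ p) y"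
begin

abbreviation "\<zeta> \<equiv> zeta p pm \<rho>"

lemma zeta_in [simp]: "x \<in> X \<Longrightarrow> v \<in> U \<Longrightarrow> \<zeta> x v \<in> U"
  using pm by (auto simp: zeta_def subsp_diff)

lemma zeta_linear: "x \<in> X \<Longrightarrow> linear_on U (\<zeta> x)"
  using lin_add[OF pow_linear] lin_smult[OF pow_linear] pm
  by (auto intro!: linear_onI simp: zeta_def radd rsmult smult_distrib)

text \<open>The Leibniz rule for \<open>p\<close>-th powers turns the commutator of the
  \<open>p\<close>-th power of \<open>\<rho> x\<close> with \<open>\<rho> y\<close> into the action
  of \<open>(ad x)^p y\<close>. By restrictedness this is \<open>b (pm x) y\<close>, which the
  second summand of \<open>zeta\<close> cancels.\<close>

lemma zeta_commute:
  assumes x: "x \<in> X" and y: "y \<in> X" and v: "v \<in> U"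
  shows "\<zeta> x (\<rho> y v) = \<rho> y (\<zeta> x v)"
proof -
  have lin: "\<rho> x (\<Sum>i\<in>I. fscale (c i) (f i)) = (\<Sum>i\<in>I. fscale (c i) (\<rho> x (f i)))"
    if f: "\<And>i. i \<in> I \<Longrightarrow> f i \<in> U" for I :: "nat set" and c f
  proof -
    have s: "fscale (c i) (g :: 'k vec) = smult (c i) g" for i g by (simp add: fscale_def smult_def)
    have "\<rho> x (\<Sum>i\<in>I. smult (c i) (f i)) = (\<Sum>i\<in>I. \<rho> x (smult (c i) (f i)))"
      using f by (intro lin_sum[OF rlin[OF x] rsub]) (simp add: subsp_smult)
    also have "\<dots> = (\<Sum>i\<in>I. smult (c i) (\<rho> x (f i)))"
      using f x by (intro sum.cong refl) (simp add: rsmult)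
    finally show ?thesis by (simp add: s)
  qed
  have "(\<rho> x ^^ p) (\<rho> y v) = \<rho> ((b x ^^ p) y) v + \<rho> y ((\<rho> x ^^ p) v)"
    by (rule leibniz_prime[OF p, of X "b x" U "\<rho> x" \<rho> U "\<rho> x" y v]) (use x y v rcl lin in \<open>auto simp: rbrk\<close>)
  also have "(b x ^^ p) y = b (pm x) y" using pm x y by simp
  also have "\<rho> (b (pm x) y) v = \<rho> (pm x) (\<rho> y v) - \<rho> y (\<rho> (pm x) v)" using rbrk pm x y v by blast
  finally show ?thesis using x y v pm by (simp add: zeta_def rdiff)
qed

end

text \<open>Functionals with values in the closure on a module over the ground field: finite
  combinations of coordinates. Extending scalars here, and not in the module, keeps the module
  within reach of the formation.\<close>

inductive cfun :: "('a \<Rightarrow> 'k) \<Rightarrow> (('a::field) vec \<Rightarrow> 'k::field) \<Rightarrow> bool" for emb where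
  cfun_0: "cfun emb (\<lambda>_. 0)"
| cfun_step: "cfun emb K \<Longrightarrow> cfun emb (\<lambda>y. K y + \<kappa> * emb (y i))"

lemma cfun_coord: "cfun emb (\<lambda>y. \<kappa> * emb (y i))"
  using cfun_step[OF cfun_0, of emb \<kappa> i] by simp

lemma cfun_add: "cfun emb K \<Longrightarrow> cfun emb L \<Longrightarrow> cfun emb (\<lambda>y. K y + L y)"
proof (induction K rule: cfun.induct)
  case (cfun_step K \<kappa> i)
  then have "cfun emb (\<lambda>y. (K y + L y) + \<kappa> * emb (y i))" by (intro cfun.cfun_step)
  then show ?case by (simp add: algebra_simps)
qed simp

lemma cfun_scale: "cfun emb K \<Longrightarrow> cfun emb (\<lambda>y. c * K y)"
proof (induction K rule: cfun.induct)
  case (cfun_step K \<kappa> i)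
  then have "cfun emb (\<lambda>y. c * K y + (c * \<kappa>) * emb (y i))" by (intro cfun.cfun_step)
  then show ?case by (simp add: algebra_simps)
qed (simp add: cfun_0)

lemma cfun_p1: "cfun emb K \<Longrightarrow> cfun emb (\<lambda>y. K (p1 y))"
  by (induction K rule: cfun.induct) (auto simp: cfun_0 p1_def intro!: cfun_step)

lemma cfun_p2: "cfun emb K \<Longrightarrow> cfun emb (\<lambda>y. K (p2 y))"
  by (induction K rule: cfun.induct) (auto simp: cfun_0 p2_def intro!: cfun_step)

text \<open>The coordinate of \<open>tens u v\<close> at \<open>prod_encode (i, j)\<close> is a
  product of two coordinates, so a product of functionals is a functional on tensors.\<close>

lemma cfun_tens:
  assumes K: "cfun emb K" and L: "cfun emb L" and mult: "\<And>x y. emb (x * y) = emb x * emb y"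
  obtains H where "cfun emb H" "\<And>u v. H (tens u v) = K u * L v"
proof -
  have 1: "\<exists>H. cfun emb H \<and> (\<forall>u v. H (tens u v) = \<kappa> * emb (u i) * L v)" for \<kappa> i
    using L
  proof (induction L rule: cfun.induct)
    case cfun_0
    show ?case by (rule exI[of _ "\<lambda>_. 0"]) (simp add: cfun.cfun_0)
  next
    case (cfun_step L \<mu> j)
    then obtain H where H: "cfun emb H" "\<And>u v. H (tens u v) = \<kappa> * emb (u i) * L v" by blast
    have "cfun emb (\<lambda>y. H y + (\<kappa> * \<mu>) * emb (y (prod_encode (i, j))))" by (rule cfun.cfun_step[OF H(1)])
    then show ?case
      by (rule_tac exI[of _ "\<lambda>y. H y + (\<kappa> * \<mu>) * emb (y (prod_encode (i, j)))"])
        (simp add: H(2) tens_encode mult algebra_simps)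
  qed
  have "\<exists>H. cfun emb H \<and> (\<forall>u v. H (tens u v) = K u * L v)"
    using K
  proof (induction K rule: cfun.induct)
    case cfun_0
    show ?case by (rule exI[of _ "\<lambda>_. 0"]) (simp add: cfun.cfun_0)
  next
    case (cfun_step K \<kappa> i)
    then obtain H where H: "cfun emb H" "\<And>u v. H (tens u v) = K u * L v" by blast
    obtain H' where H': "cfun emb H'" "\<And>u v. H' (tens u v) = \<kappa> * emb (u i) * L v" using 1 by blast
    show ?case using cfun_add[OF H(1) H'(1)] H(2) H'(2)
      by (intro exI[of _ "\<lambda>y. H y + H' y"]) (simp add: algebra_simps)
  qed
  then show ?thesis using that by blast
qed

lemma cfun_linear:
  assumes K: "cfun emb K" and add: "\<And>x y. emb (x + y) = emb x + emb y" and mult: "\<And>x y. emb (x * y) = emb x * emb y"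
  shows "K (x + y) = K x + K y" "K (smult c x) = emb c * K x"
  using K by (induction K rule: cfun.induct) (simp_all add: pointwise add mult algebra_simps)

section \<open>Matrix coefficients with values in the algebraic closure\<close>

locale main = subnormal_member FF S X b
  for FF :: "('a::field) lie_class" and S X b +
  fixes emb :: "'a \<Rightarrow> 'k::field" and p :: nat and pm :: "'a vec \<Rightarrow> 'a vec"
  assumes closure: "is_alg_closure emb" and p: "prime p" "CHAR('a) = p"
    and restr: "restricted p X b pm" and zp: "\<forall>z\<in>centre X b. pm z = 0"
begin

lemma emb_add: "emb (x + y) = emb x + emb y" and emb_mult: "emb (x * y) = emb x * emb y" and emb_1 [simp]: "emb 1 = 1"
  using closure by (auto simp: is_alg_closure_def)

lemma emb_0 [simp]: "emb 0 = 0"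
  using emb_add[of 0 0] by (simp only: add_0_right add_cancel_right_right)

lemma emb_minus: "emb (- x) = - emb x"
  using emb_add[of x "- x"] by (simp add: eq_neg_iff_add_eq_0 add.commute)

lemma emb_diff: "emb (x - y) = emb x - emb y"
  using emb_add[of x "- y"] emb_minus by simp

lemma emb_eq_0 [simp]: "emb x = 0 \<longleftrightarrow> x = 0"
proof
  assume "emb x = 0"
  show "x = 0"
  proof (rule ccontr)
    assume "x \<noteq> 0"
    then have "emb x * emb (inverse x) = 1" by (simp add: emb_mult[symmetric])
    then show False using \<open>emb x = 0\<close> by simp
  qed
qed simp

lemma emb_of_nat: "emb (of_nat n) = of_nat n"
  by (induction n) (simp_all add: emb_add)

lemma char_k: "CHAR('k) = p"
proof (rule CHAR_eqI)
  show "of_nat p = (0 :: 'k)" using emb_of_nat[of p] p by (metis emb_0 of_nat_CHAR)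
  fix n assume "of_nat n = (0 :: 'k)"
  then have "of_nat n = (0 :: 'a)" by (metis emb_of_nat emb_eq_0)
  then show "p dvd n" using p by (simp add: of_nat_eq_0_iff_char_dvd)
qed

lemma pm_in [simp]: "x \<in> X \<Longrightarrow> pm x \<in> X" and pm_brk: "x \<in> X \<Longrightarrow> y \<in> X \<Longrightarrow> b (pm x) y = (b x ^^ p) y"
  using restr by (auto simp: restricted_def)

lemma gmod_lrep: "gmod X b U \<rho> \<Longrightarrow> lrep_p X b U \<rho> p pm"
proof -
  assume g: "gmod X b U \<rho>"
  interpret M: lmod X b U \<rho> by unfold_locales (rule g)
  show ?thesis
  proof unfold_locales
    show "prime p" "CHAR('a) = p" by (fact p)+
    show "pm x \<in> X" if "x \<in> X" for x by (rule pm_in[OF that])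
    show "b (pm x) y = (b x ^^ p) y" if "x \<in> X" "y \<in> X" for x y by (rule pm_brk[OF that])
  qed (simp_all add: M.act_lin M.act_brk)
qed

lemma frob: "((x :: 'k) + y) ^ p = x ^ p + y ^ p"
  by (rule freshmans_dream) (simp_all only: char_k p)

definition LM :: "'a vec set \<Rightarrow> ('a vec \<Rightarrow> 'a vec \<Rightarrow> 'a vec) \<Rightarrow> bool" where
  "LM U \<rho> \<longleftrightarrow> gmod X b U \<rho> \<and> HH U \<rho>"

lemma LM_S: "LM U \<rho> \<Longrightarrow> gmod S b U \<rho>"
proof -
  assume "LM U \<rho>"
  then interpret lmod X b U \<rho> by unfold_locales (simp add: LM_def)
  show ?thesis using restrict SX by blast
qed

lemma LM_sum: "LM U \<rho> \<Longrightarrow> LM V \<sigma> \<Longrightarrow> LM (PR U V) (\<lambda>x f. pr (\<rho> x (p1 f)) (\<sigma> x (p2 f)))"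
proof -
  assume 1: "LM U \<rho>" "LM V \<sigma>"
  then have 2: "gmod X b U \<rho>" "gmod X b V \<sigma>" "HH U \<rho>" "HH V \<sigma>" by (auto simp: LM_def)
  show ?thesis unfolding LM_def by (intro conjI gmod_sum HH_sum LM_S 1 2)
qed

lemma LM_tensor: "LM U \<rho> \<Longrightarrow> LM V \<sigma> \<Longrightarrow> LM (TU U V) (tact \<rho> \<sigma>)"
proof -
  assume 1: "LM U \<rho>" "LM V \<sigma>"
  interpret lmod2 X b U \<rho> V \<sigma> by unfold_locales (use 1 in \<open>auto simp: LM_def\<close>)
  show ?thesis using gmod_tensor HH_tensor 1 LM_S by (simp add: LM_def)
qed

lemma LM_EE: "LM EE (\<lambda>_ _. 0)"
  using gmod_EE HH_EE S0 by (simp add: LM_def)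

lemma LM_adjoint: "LM X b"
  using HH_adjoint X.adjoint_ideal[of X] by (auto simp: LM_def ideal_of_def)

text \<open>Words act with their first letter first.\<close>

definition coef :: "('a vec list \<Rightarrow> 'k) \<Rightarrow> bool" where
  "coef \<Psi> \<longleftrightarrow> (\<exists>U \<rho> m K. LM U \<rho> \<and> m \<in> U \<and> cfun emb K \<and> (\<forall>w\<in>lists X. \<Psi> w = K (fold \<rho> w m)))"

lemma coefI: "LM U \<rho> \<Longrightarrow> m \<in> U \<Longrightarrow> cfun emb K \<Longrightarrow> (\<And>w. w \<in> lists X \<Longrightarrow> \<Psi> w = K (fold \<rho> w m)) \<Longrightarrow> coef \<Psi>"
  by (auto simp: coef_def)

lemma fold_sum: "fold (\<lambda>x f. pr (\<rho> x (p1 f)) (\<sigma> x (p2 f))) w f = pr (fold \<rho> w (p1 f)) (fold \<sigma> w (p2 f))"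
  by (induction w arbitrary: f) simp_all

text \<open>In a direct sum the pair of base vectors serves all coefficients of both summands, so
  finitely many coefficients come from one vector \<open>m\<close>. Having a single vector matters
  because it is the annihilator of \<open>m\<close> that is compared later.\<close>

lemma coef_common:
  assumes "finite F" "\<And>\<Psi>. \<Psi> \<in> F \<Longrightarrow> coef \<Psi>"
  shows "\<exists>U \<rho> m. LM U \<rho> \<and> m \<in> U \<and> (\<forall>\<Psi>\<in>F. \<exists>K. cfun emb K \<and> (\<forall>w\<in>lists X. \<Psi> w = K (fold \<rho> w m)))"
  using assms
proof (induction F rule: finite_induct)
  case empty
  show ?case using LM_EE EE_mem by blast
next
  case (insert \<Phi> F)
  obtain U \<rho> m where 1: "LM U \<rho>" "m \<in> U" "\<And>\<Psi>. \<Psi> \<in> F \<Longrightarrow> \<exists>K. cfun emb K \<and> (\<forall>w\<in>lists X. \<Psi> w = K (fold \<rho> w m))"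
    using insert by auto
  obtain V \<sigma> l L where 2: "LM V \<sigma>" "l \<in> V" "cfun emb L" "\<And>w. w \<in> lists X \<Longrightarrow> \<Phi> w = L (fold \<sigma> w l)"
    using insert.prems[of \<Phi>] by (auto simp: coef_def)
  let ?\<tau> = "\<lambda>x f. pr (\<rho> x (p1 f)) (\<sigma> x (p2 f))"
  have "\<exists>K. cfun emb K \<and> (\<forall>w\<in>lists X. \<Psi> w = K (fold ?\<tau> w (pr m l)))" if \<Psi>: "\<Psi> \<in> insert \<Phi> F" for \<Psi>
  proof (cases "\<Psi> = \<Phi>")
    case True
    then show ?thesis using 2 cfun_p2[OF 2(3)] by (intro exI[of _ "\<lambda>y. L (p2 y)"]) (simp add: fold_sum)
  next
    case False
    then obtain K where "cfun emb K" "\<forall>w\<in>lists X. \<Psi> w = K (fold \<rho> w m)" using 1 \<Psi> by blast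
    then show ?thesis using cfun_p1[of emb K] by (intro exI[of _ "\<lambda>y. K (p1 y)"]) (simp add: fold_sum)
  qed
  moreover have "pr m l \<in> PR U V" using 1 2 by simp
  ultimately show ?case using LM_sum[OF 1(1) 2(1)] by blast
qed

lemma coef_add: assumes "coef \<Phi>" "coef \<Psi>" shows "coef (\<lambda>w. \<Phi> w + \<Psi> w)"
proof -
  obtain U \<rho> m where 1: "LM U \<rho>" "m \<in> U" "\<forall>\<Psi>\<in>{\<Phi>, \<Psi>}. \<exists>K. cfun emb K \<and> (\<forall>w\<in>lists X. \<Psi> w = K (fold \<rho> w m))"
    using coef_common[of "{\<Phi>, \<Psi>}"] assms by blast
  then obtain K L where "cfun emb K" "\<forall>w\<in>lists X. \<Phi> w = K (fold \<rho> w m)" "cfun emb L" "\<forall>w\<in>lists X. \<Psi> w = L (fold \<rho> w m)"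
    by auto
  then show ?thesis using 1 by (intro coefI[OF _ _ cfun_add[of emb K L]]) auto
qed

lemma coef_scale: assumes "coef \<Phi>" shows "coef (\<lambda>w. c * \<Phi> w)"
proof -
  obtain U \<rho> m K where "LM U \<rho>" "m \<in> U" "cfun emb K" "\<forall>w\<in>lists X. \<Phi> w = K (fold \<rho> w m)"
    using assms by (auto simp: coef_def)
  then show ?thesis by (intro coefI[OF _ _ cfun_scale[of emb K c]]) auto
qed

text \<open>The one-dimensional trivial module yields the counit of the enveloping algebra: every
  letter acts as zero. It is the unit for shuffling.\<close>

lemma coef_empty_word: "coef (\<lambda>w. if w = [] then 1 else 0)"
proof (rule coefI[OF LM_EE])
  show "unitv 0 \<in> EE" using EE_mem[of 1] by simp
  show "cfun emb (\<lambda>y. 1 * emb (y 0))" by (rule cfun_coord)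
  have "fold (\<lambda>_ _. 0) w (0 :: 'a vec) = 0" for w :: "'a vec list" by (induction w) auto
  then have "fold (\<lambda>_ _. 0) w (unitv 0 :: 'a vec) = (if w = [] then unitv 0 else 0)" for w :: "'a vec list"
    by (cases w) auto
  then show "(if w = [] then 1 else 0) = 1 * emb (fold (\<lambda>_ _. 0) w (unitv 0) 0)" for w :: "'a vec list"
    by (simp add: unitv_def pointwise)
qed

lemma coef_adjoint: "v \<in> X \<Longrightarrow> coef (\<lambda>w. c * emb (fold b w v i))"
  by (rule coefI[OF LM_adjoint _ cfun_coord]) auto

lemma coef_sum: "finite I \<Longrightarrow> (\<And>i. i \<in> I \<Longrightarrow> coef (\<Psi> i)) \<Longrightarrow> coef (\<lambda>w. \<Sum>i\<in>I. \<Psi> i w)"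
proof (induction I rule: finite_induct)
  case empty
  have "coef (\<lambda>w. 0 * (if w = [] then 1 else 0))" using coef_scale[OF coef_empty_word] .
  then show ?case by simp
qed (auto intro: coef_add)

text \<open>Letters act on a tensor product by the Leibniz rule, so a word acting on
  \<open>m \<otimes> l\<close> distributes its letters over the two factors in all possible ways,
  which is the recursion of \<open>shuf\<close>.\<close>

lemma coef_shuf: assumes "coef \<Phi>" "coef \<Psi>" shows "coef (shuf \<Phi> \<Psi>)"
proof -
  obtain U \<rho> m K where 1: "LM U \<rho>" "m \<in> U" "cfun emb K" "\<And>w. w \<in> lists X \<Longrightarrow> \<Phi> w = K (fold \<rho> w m)"
    using assms(1) by (auto simp: coef_def)
  obtain V \<sigma> l L where 2: "LM V \<sigma>" "l \<in> V" "cfun emb L" "\<And>w. w \<in> lists X \<Longrightarrow> \<Psi> w = L (fold \<sigma> w l)"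
    using assms(2) by (auto simp: coef_def)
  interpret lmod2 X b U \<rho> V \<sigma> by unfold_locales (use 1 2 in \<open>auto simp: LM_def\<close>)
  interpret T: lrep_p X b "TU U V" "tact \<rho> \<sigma>" p pm by (rule gmod_lrep[OF gmod_tensor])
  obtain H where H: "cfun emb H" "\<And>u v. H (tens u v) = K u * L v"
    using cfun_tens[OF 1(3) 2(3) emb_mult] by blast
  have *: "shuf (\<lambda>w. K (fold \<rho> w m)) (\<lambda>w. L (fold \<sigma> w l)) w = H (fold (tact \<rho> \<sigma>) w (tens m l))"
    if "w \<in> lists X" "m \<in> U" "l \<in> V" for w m l
    using that
  proof (induction w arbitrary: m l)
    case Nil
    then show ?case by (simp add: H)
  next
    case (Cons x w)
    then have "fold (tact \<rho> \<sigma>) (x # w) (tens m l) = fold (tact \<rho> \<sigma>) w (tens (\<rho> x m) l) + fold (tact \<rho> \<sigma>) w (tens m (\<sigma> x l))"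
      using lin_add[OF T.fold_linear[of w]] by (simp add: tact_tens TU_superset)
    then show ?case using Cons by (simp add: cfun_linear[OF H(1) emb_add emb_mult])
  qed
  show ?thesis
  proof (rule coefI[OF LM_tensor[OF 1(1) 2(1)] TU_superset[OF 1(2) 2(2)] H(1)])
    fix w assume w: "w \<in> lists X"
    show "shuf \<Phi> \<Psi> w = H (fold (tact \<rho> \<sigma>) w (tens m l))"
      using shuf_cong[of X \<Phi> _ \<Psi>, OF 1(4) 2(4) w] *[OF w 1(2) 2(2)] by simp
  qed
qed

text \<open>The dual form of having character \<open>\<chi>\<close>. The second clause anticipates \<open>z^[p] = 0\<close> on the centre.\<close>

definition eig :: "('a vec list \<Rightarrow> 'k) \<Rightarrow> ('a vec \<Rightarrow> 'k) \<Rightarrow> bool" where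
  "eig \<Psi> \<chi> \<longleftrightarrow> (\<forall>x\<in>X. \<forall>w\<in>lists X. \<Psi> (replicate p x @ w) - \<Psi> (pm x # w) = \<chi> x ^ p * \<Psi> w)
    \<and> (\<forall>z\<in>centre X b. \<forall>w\<in>lists X. \<Psi> (z # w) = \<chi> z * \<Psi> w)"

text \<open>Prefixing \<open>x^p\<close>, \<open>pm x\<close> or \<open>z\<close> is a derivation of
  the shuffle product, so eigenvalues add. The Frobenius identity turns the sum of
  \<open>p\<close>-th powers into the \<open>p\<close>-th power of the sum, and thus
  \<open>\<chi>\<close> itself is additive.\<close>

lemma eig_shuf:
  assumes f: "eig f \<chi>" and g: "eig g \<psi>" shows "eig (shuf f g) (\<lambda>x. \<chi> x + \<psi> x)"
  unfolding eig_def
proof (intro conjI ballI)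
  fix x w assume x: "x \<in> X" and w: "w \<in> lists X"
  have "shuf f g (replicate p x @ w) - shuf f g (pm x # w) =
      shuf (\<lambda>v. f (replicate p x @ v) - f (pm x # v)) g w + shuf f (\<lambda>v. g (replicate p x @ v) - g (pm x # v)) w"
    by (simp add: shuf_prime_power[OF p(1) char_k] shuf_linear)
  also have "\<dots> = shuf (\<lambda>v. \<chi> x ^ p * f v) g w + shuf f (\<lambda>v. \<psi> x ^ p * g v) w"
    using f g x w by (intro arg_cong2[of _ _ _ _ "(+)"] shuf_cong[of X]) (auto simp: eig_def)
  also have "\<dots> = (\<chi> x + \<psi> x) ^ p * shuf f g w"
    by (simp only: shuf_linear frob distrib_right)
  finally show "shuf f g (replicate p x @ w) - shuf f g (pm x # w) = (\<chi> x + \<psi> x) ^ p * shuf f g w" .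
next
  fix z w assume z: "z \<in> centre X b" and w: "w \<in> lists X"
  have "shuf f g (z # w) = shuf (\<lambda>v. \<chi> z * f v) g w + shuf f (\<lambda>v. \<psi> z * g v) w"
    using f g z w by (simp, intro arg_cong2[of _ _ _ _ "(+)"] shuf_cong[of X]) (auto simp: eig_def)
  then show "shuf f g (z # w) = (\<chi> z + \<psi> z) * shuf f g w"
    by (simp only: shuf_linear distrib_right)
qed

end

section \<open>Normal forms in the enveloping algebra\<close>

text \<open>\<open>\<Lambda>\<close> is closed under scalars but not assumed closed under sums. So
  only vectors are corrected: \<open>l0\<close> is a rescaled member with \<open>l0 y0 = 1\<close>,
  the system is found by recursion on its kernel, and \<open>y0\<close> is then adjusted so that the
  earlier functionals vanish on it. Every \<open>lam i\<close> keeps the shape of a member of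
  \<open>\<Lambda>\<close>.\<close>

lemma dual_system:
  fixes \<Lambda> :: "(('a::field) vec \<Rightarrow> 'a) set"
  assumes X: "fdsub X"
    and add: "\<And>l x y. l \<in> \<Lambda> \<Longrightarrow> x \<in> X \<Longrightarrow> y \<in> X \<Longrightarrow> l (x + y) = l x + l y"
    and mult: "\<And>l k x. l \<in> \<Lambda> \<Longrightarrow> x \<in> X \<Longrightarrow> l (smult k x) = k * l x"
    and scale: "\<And>l k. l \<in> \<Lambda> \<Longrightarrow> (\<lambda>x. k * l x) \<in> \<Lambda>"
  obtains r :: nat and e lam where "\<And>i. i < r \<Longrightarrow> e i \<in> X" "\<And>i. i < r \<Longrightarrow> lam i \<in> \<Lambda>"
    "\<And>i j. i < r \<Longrightarrow> j < r \<Longrightarrow> lam i (e j) = (if i = j then 1 else 0)"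
    "\<And>x l. x \<in> X \<Longrightarrow> l \<in> \<Lambda> \<Longrightarrow> l (x - (\<Sum>i<r. smult (lam i x) (e i))) = 0"
proof -
  obtain n where n: "X \<subseteq> vsupp n" and sX: "subsp X" using X by (auto simp: fdsub_def)
  have zero: "l 0 = 0" if "l \<in> \<Lambda>" for l using mult[OF that subsp_0[OF sX], of 0] by simp
  have diff: "l (x - y) = l x - l y" if "l \<in> \<Lambda>" "x \<in> X" "y \<in> X" for l x y
    using add[OF that(1), of "x - y" y] that sX by (simp add: subsp_diff)
  have sum: "l (\<Sum>i\<in>I. smult (c i) (f i)) = (\<Sum>i\<in>I. c i * l (f i))" if "finite I" "l \<in> \<Lambda>" "\<And>i. i \<in> I \<Longrightarrow> f i \<in> X" for l c f and I :: "nat set"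
    using that sX by (induction I rule: finite_induct) (simp_all add: zero add mult subsp_smult subsp_sum)
  have "\<exists>(r :: nat) e lam. (\<forall>i<r. e i \<in> Y \<and> lam i \<in> \<Lambda>) \<and> (\<forall>i<r. \<forall>j<r. lam i (e j) = (if i = j then 1 else 0)) \<and>
     (\<forall>y\<in>Y. \<forall>l\<in>\<Lambda>. l (y - (\<Sum>i<r. smult (lam i y) (e i))) = 0)" if "subsp Y" "Y \<subseteq> X" for Y
    using that
  proof (induction "vdim Y" arbitrary: Y rule: less_induct)
    case less
    show ?case
    proof (cases "\<forall>l\<in>\<Lambda>. \<forall>y\<in>Y. l y = 0")
      case True
      then show ?thesis by - (rule exI[of _ "0::nat"], rule exI, rule exI, simp)
    next
      case False
      then obtain l1 y0 where l1: "l1 \<in> \<Lambda>" "y0 \<in> Y" "l1 y0 \<noteq> 0" by blast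
      define l0 where "l0 = (\<lambda>x. inverse (l1 y0) * l1 x)"
      have l0: "l0 \<in> \<Lambda>" "l0 y0 = 1" using l1 scale by (auto simp: l0_def)
      let ?Y = "{y \<in> Y. l0 y = 0}"
      have Ys: "subsp ?Y"
        using less.prems l0 sX by (auto intro!: subspI simp: subsp_add subsp_smult zero add mult subset_iff)
      have "y0 \<notin> ?Y" using l0 by simp
      then have "?Y \<subset> Y" using l1(2) by blast
      then have "vdim ?Y < vdim Y" by (rule vdim_less[OF Ys less.prems(1)]) (use n less.prems(2) in blast)
      note small = this
      have YX: "?Y \<subseteq> X" using less.prems(2) by blast
      obtain r :: nat and e lam where IH0: "\<forall>i<r. e i \<in> ?Y \<and> lam i \<in> \<Lambda>"
        "\<forall>i<r. \<forall>j<r. lam i (e j) = (if i = j then 1 else 0)"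
        "\<forall>y\<in>?Y. \<forall>l\<in>\<Lambda>. l (y - (\<Sum>i<r. smult (lam i y) (e i))) = 0"
        using less.hyps[OF small Ys YX] by (elim exE conjE) (rule that)
      have IH: "\<And>i. i < r \<Longrightarrow> e i \<in> ?Y" "\<And>i. i < r \<Longrightarrow> lam i \<in> \<Lambda>"
        "\<And>i j. i < r \<Longrightarrow> j < r \<Longrightarrow> lam i (e j) = (if i = j then 1 else 0)"
        "\<And>y l. y \<in> ?Y \<Longrightarrow> l \<in> \<Lambda> \<Longrightarrow> l (y - (\<Sum>i<r. smult (lam i y) (e i))) = 0"
        using IH0 by auto
      have eY: "e i \<in> Y" "l0 (e i) = 0" "e i \<in> X" if "i < r" for i using IH(1)[OF that] less.prems by auto
      define e0 where "e0 = y0 - (\<Sum>i<r. smult (lam i y0) (e i))"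
      have sumY: "(\<Sum>i<r. smult (c i) (e i)) \<in> Y" for c
        using less.prems eY by (intro subsp_sum) (auto intro: subsp_smult)
      have e0Y: "e0 \<in> Y" unfolding e0_def using less.prems l1 sumY by (intro subsp_diff) auto
      have mX: "y \<in> X" if "y \<in> Y" for y using that less.prems by blast
      have "l0 (\<Sum>i<r. smult (c i) (e i)) = (\<Sum>i<r. c i * l0 (e i))" for c
        using l0(1) eY by (intro sum) auto
      then have "l0 (\<Sum>i<r. smult (c i) (e i)) = 0" for c using eY(2) by simp
      then have l0e0: "l0 e0 = 1" unfolding e0_def using l0 mX[OF l1(2)] mX[OF sumY] by (simp add: diff)
      have ls: "lam i (\<Sum>j<r. smult (c j) (e j)) = c i" if "i < r" for i c
      proof -
        have "lam i (\<Sum>j<r. smult (c j) (e j)) = (\<Sum>j<r. c j * lam i (e j))"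
          using IH(2)[OF that] eY by (intro sum) auto
        also have "\<dots> = (\<Sum>j<r. if i = j then c j else 0)" using that IH(3) by (intro sum.cong) auto
        also have "\<dots> = c i" using that by simp
        finally show ?thesis .
      qed
      have le0: "lam i e0 = 0" if "i < r" for i
        unfolding e0_def using diff[OF IH(2)[OF that] mX[OF l1(2)] mX[OF sumY]] ls[OF that] by simp
      let ?e = "e(r := e0)" and ?lam = "lam(r := l0)"
      have A: "\<forall>y\<in>Y. \<forall>l\<in>\<Lambda>. l (y - (\<Sum>i<Suc r. smult (?lam i y) (?e i))) = 0"
      proof (intro ballI)
        fix y l assume y: "y \<in> Y" and l: "l \<in> \<Lambda>"
        let ?y = "y - smult (l0 y) e0"
        have "l0 ?y = 0" using l0 l0e0 y e0Y mX sX by (simp add: diff mult subsp_smult)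
        then have yY: "?y \<in> ?Y" using less.prems y e0Y by (simp add: subsp_diff subsp_smult)
        have "lam i ?y = lam i y" if "i < r" for i
          using IH(2)[OF that] le0[OF that] y e0Y mX sX by (simp add: diff mult subsp_smult)
        then have 1: "(\<Sum>i<r. smult (lam i ?y) (e i)) = (\<Sum>i<r. smult (lam i y) (e i))" by simp
        have 2: "(\<Sum>i<Suc r. smult (?lam i y) (?e i)) = smult (l0 y) e0 + (\<Sum>i<r. smult (lam i y) (e i))"
          by (simp add: add.commute)
        show "l (y - (\<Sum>i<Suc r. smult (?lam i y) (?e i))) = 0"
          using IH(4)[OF yY l] unfolding 1 2 diff_diff_eq .
      qed
      have B: "\<forall>i<Suc r. ?e i \<in> Y \<and> ?lam i \<in> \<Lambda>" using eY IH(2) e0Y l0 by (simp add: less_Suc_eq)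
      have C: "\<forall>i<Suc r. \<forall>j<Suc r. ?lam i (?e j) = (if i = j then 1 else 0)"
        using IH(3) eY(2) le0 l0e0 by (auto simp: less_Suc_eq)
      show ?thesis
        by (rule exI[of _ "Suc r"], rule exI[of _ ?e], rule exI[of _ ?lam], rule conjI[OF B conjI[OF C A]])
    qed
  qed
  from this[OF sX subset_refl] obtain r :: nat and e lam where
    "\<forall>i<r. e i \<in> X \<and> lam i \<in> \<Lambda>" "\<forall>i<r. \<forall>j<r. lam i (e j) = (if i = j then 1 else 0)"
    "\<forall>y\<in>X. \<forall>l\<in>\<Lambda>. l (y - (\<Sum>i<r. smult (lam i y) (e i))) = 0" by blast
  then show ?thesis by (intro that[of r e lam]) auto
qed

lemma sorted_split:
  fixes s :: "nat list"
  assumes "sorted s" shows "s = filter (\<lambda>x. x < i) s @ replicate (count_list s i) i @ filter (\<lambda>x. x > i) s"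
  using assms
proof (induction s)
  case (Cons x s)
  then have IH: "s = filter (\<lambda>x. x < i) s @ replicate (count_list s i) i @ filter (\<lambda>x. x > i) s" by simp
  have ge: "\<forall>y\<in>set s. x \<le> y" using Cons.prems by simp
  consider "x < i" | "x = i" | "x > i" by linarith
  then show ?case
  proof cases
    case 1 then show ?thesis using IH by simp
  next
    case 2
    then have "filter (\<lambda>x. x < i) s = []" using ge by (auto simp: filter_empty_conv)
    then show ?thesis using IH 2 by simp
  next
    case 3
    then have "filter (\<lambda>x. x < i) s = []" "count_list s i = 0" "filter (\<lambda>x. x > i) s = s"
      using ge by (auto simp: filter_empty_conv count_list_0_iff filter_id_conv)
    then show ?thesis using 3 by simp
  qed
qed simp

text \<open>Orders of vanishing add: each way of distributing fewer than \<open>m + n\<close>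
  letters leaves one factor with too short a word.\<close>

lemma shuf_order:
  assumes "\<And>w. w \<in> lists X \<Longrightarrow> length w < m \<Longrightarrow> f w = 0" "\<And>w. w \<in> lists X \<Longrightarrow> length w < n \<Longrightarrow> g w = 0"
    "w \<in> lists X" "length w < m + n"
  shows "shuf f g w = 0"
  using assms
proof (induction w arbitrary: f g m n)
  case Nil
  then show ?case by (cases "m > 0") auto
next
  case (Cons x w)
  have x: "x \<in> X" "w \<in> lists X" using Cons.prems(3) by auto
  \<comment> \<open>Truncated subtraction also covers \<open>m = 0\<close>, where the head letter
    uses up none of the bound; likewise for \<open>n\<close> below.\<close>
  have "shuf (\<lambda>v. f (x # v)) g w = 0"
    by (rule Cons.IH[where m = "m - 1" and n = n]) (use Cons.prems x in auto)
  moreover have "shuf f (\<lambda>v. g (x # v)) w = 0"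
    by (rule Cons.IH[where m = m and n = "n - 1"]) (use Cons.prems x in auto)
  ultimately show ?case by simp
qed

lemma shuf_order_head:
  assumes "\<And>v. v \<in> lists X \<Longrightarrow> length v < length w \<Longrightarrow> g v = 0" "w \<in> lists X"
  shows "shuf h g w = h [] * g w"
  using assms
proof (induction w arbitrary: g)
  case (Cons x w)
  have x: "x \<in> X" "w \<in> lists X" using Cons.prems(2) by auto
  have "shuf (\<lambda>v. h (x # v)) g w = 0"
    by (rule shuf_order[where m = 0 and n = "Suc (length w)" and X = X]) (use Cons.prems x in auto)
  moreover have "shuf h (\<lambda>v. g (x # v)) w = h [] * g (x # w)"
    by (rule Cons.IH) (use Cons.prems x in auto)
  ultimately show ?case by simp
qed simp

text \<open>In the lowest degree only the splittings that give \<open>f\<close> a single letter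
  survive: \<open>f\<close> vanishes on the empty word, and \<open>g\<close> on words shorter than
  \<open>w\<close> by two or more letters.\<close>

lemma shuf_order_eval:
  assumes "f [] = 0" "\<And>v. v \<in> lists X \<Longrightarrow> Suc (length v) < length w \<Longrightarrow> g v = 0" "w \<in> lists X"
  shows "shuf f g w = (\<Sum>k<length w. f [w ! k] * g (take k w @ drop (Suc k) w))"
  using assms
proof (induction w arbitrary: g)
  case (Cons x w)
  have x: "x \<in> X" "w \<in> lists X" using Cons.prems(3) by auto
  have "shuf (\<lambda>v. f (x # v)) g w = f [x] * g w"
    by (rule shuf_order_head[where X = X]) (use Cons.prems x in auto)
  moreover have "shuf f (\<lambda>v. g (x # v)) w = (\<Sum>k<length w. f [w ! k] * g (x # (take k w @ drop (Suc k) w)))"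
    by (rule Cons.IH) (use Cons.prems x in auto)
  ultimately show ?case by (simp add: sum.lessThan_Suc_shift del: sum.lessThan_Suc)
qed simp

text \<open>The \<open>e i\<close> form a basis of \<open>X\<close> modulo its centre, with dual
  functionals \<open>lam i\<close>. Each \<open>lam i\<close> is a scaled matrix entry of the
  adjoint representation, which makes it a coefficient of a module with \<open>HH\<close>.\<close>

locale pbw = main FF S X b emb p pm
  for FF :: "('a::field) lie_class" and S X b and emb :: "'a \<Rightarrow> 'k::field" and p pm +
  fixes r :: nat and e :: "nat \<Rightarrow> 'a vec" and lam :: "nat \<Rightarrow> 'a vec \<Rightarrow> 'a"
  assumes eX [simp]: "\<And>i. i < r \<Longrightarrow> e i \<in> X"
    and lam_coef: "\<And>i. i < r \<Longrightarrow> \<exists>c v j. v \<in> X \<and> lam i = (\<lambda>x. c * b x v j)"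
    and dual: "\<And>i j. i < r \<Longrightarrow> j < r \<Longrightarrow> lam i (e j) = (if i = j then 1 else 0)"
    and decomp: "\<And>x. x \<in> X \<Longrightarrow> x - (\<Sum>i<r. smult (lam i x) (e i)) \<in> centre X b"

context main
begin

text \<open>The common zeros of all matrix entries of the adjoint representation form the centre, so
  a dual system for these entries decomposes \<open>X\<close> up to central elements.\<close>

lemma pbw_exists: obtains r e lam where "pbw FF S X b emb p pm r e lam"
proof -
  let ?L = "{l. \<exists>c v j. v \<in> X \<and> l = (\<lambda>x. c * b x v j)}"
  obtain r :: nat and e lam where d: "\<And>i. i < r \<Longrightarrow> e i \<in> X" "\<And>i. i < r \<Longrightarrow> lam i \<in> ?L"
    "\<And>i j. i < r \<Longrightarrow> j < r \<Longrightarrow> lam i (e j) = (if i = j then 1 else 0)"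
    "\<And>x l. x \<in> X \<Longrightarrow> l \<in> ?L \<Longrightarrow> l (x - (\<Sum>i<r. smult (lam i x) (e i))) = 0"
  proof (rule dual_system[OF X.fd, of ?L])
    fix l x y assume "l \<in> ?L" "x \<in> X" "y \<in> X"
    then show "l (x + y) = l x + l y" by (auto simp: X.add_l pointwise algebra_simps)
  next
    fix l k x assume "l \<in> ?L" "x \<in> X"
    then show "l (smult k x) = k * l x" by (auto simp: X.smult_l pointwise)
  next
    fix l k assume "l \<in> ?L"
    then obtain c v j where "v \<in> X" "l = (\<lambda>x. c * b x v j)" by blast
    then have "v \<in> X \<and> (\<lambda>x. k * l x) = (\<lambda>x. (k * c) * b x v j)" by (simp add: mult.assoc)
    then show "(\<lambda>x. k * l x) \<in> ?L" by blast
  qed (rule that)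
  have "x - (\<Sum>i<r. smult (lam i x) (e i)) \<in> centre X b" if x: "x \<in> X" for x
  proof -
    let ?y = "x - (\<Sum>i<r. smult (lam i x) (e i))"
    have "?y \<in> X" using x d(1) by (auto intro!: subsp_diff subsp_sum subsp_smult)
    moreover have "b ?y v = 0" if v: "v \<in> X" for v
    proof
      fix j
      have "(\<lambda>x. 1 * b x v j) \<in> ?L" using v by blast
      from d(4)[OF x this] show "b ?y v j = 0 j" by (simp add: pointwise)
    qed
    ultimately show ?thesis by (auto simp: centre_def)
  qed
  then have "pbw FF S X b emb p pm r e lam"
    using d(1-3) by unfold_locales auto
  then show ?thesis by (rule that)
qed

end

section \<open>Rewriting words as ordered monomials over central generators\<close>

context pbw
begin

lemma centreX: "z \<in> centre X b \<Longrightarrow> z \<in> X" and centre_brk: "z \<in> centre X b \<Longrightarrow> y \<in> X \<Longrightarrow> b z y = 0"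
  by (auto simp: centre_def)

text \<open>Central generators are kept as codes because they have to act on all modules at once:
  \<open>Inl i\<close> codes the element \<open>e i ^ p - (e i)^[p]\<close>, \<open>Inr z\<close> a
  central element \<open>z\<close>.\<close>

definition cact :: "('a vec \<Rightarrow> 'a vec \<Rightarrow> 'a vec) \<Rightarrow> nat + 'a vec \<Rightarrow> 'a vec \<Rightarrow> 'a vec" where
  "cact \<rho> g = (case g of Inl i \<Rightarrow> zeta p pm \<rho> (e i) | Inr z \<Rightarrow> \<rho> z)"

definition central :: "(nat + 'a vec) set" where
  "central = Inl ` {..<r} \<union> Inr ` centre X b"

definition wact :: "nat list \<Rightarrow> ('a vec \<Rightarrow> 'a vec \<Rightarrow> 'a vec) \<Rightarrow> 'a vec \<Rightarrow> 'a vec" where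
  "wact w \<rho> = fold (\<lambda>i. \<rho> (e i)) w"

definition tev :: "('a vec \<Rightarrow> 'a vec \<Rightarrow> 'a vec) \<Rightarrow> 'a \<times> (nat + 'a vec) list \<times> nat list \<Rightarrow> 'a vec \<Rightarrow> 'a vec" where
  "tev \<rho> = (\<lambda>(c, G, a) v. smult c (wact a \<rho> (fold (cact \<rho>) G v)))"

definition standard :: "nat list \<Rightarrow> bool" where
  "standard a \<longleftrightarrow> set a \<subseteq> {..<r} \<and> sorted a \<and> (\<forall>i. count_list a i < p)"

text \<open>\<open>NF d\<close> stands in for an element of the enveloping algebra: one expression in ordered monomials
  describes the operator on all modules at once.\<close>

definition NF :: "nat \<Rightarrow> (('a vec \<Rightarrow> 'a vec \<Rightarrow> 'a vec) \<Rightarrow> 'a vec \<Rightarrow> 'a vec) \<Rightarrow> bool" where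
  "NF d \<theta> \<longleftrightarrow> (\<exists>ts. (\<forall>(c, G, a)\<in>set ts. G \<in> lists central \<and> standard a \<and> length a \<le> d) \<and>
     (\<forall>U \<rho> v. gmod X b U \<rho> \<longrightarrow> v \<in> U \<longrightarrow> \<theta> \<rho> v = (\<Sum>t\<leftarrow>ts. tev \<rho> t v)))"

lemma wact_fold: "wact w \<rho> v = fold \<rho> (map e w) v"
  by (simp add: wact_def fold_map comp_def)

lemma wact_append: "wact (u @ w) \<rho> v = wact w \<rho> (wact u \<rho> v)"
  by (simp add: wact_def)

lemma map_e_lists [simp]: "set w \<subseteq> {..<r} \<Longrightarrow> map e w \<in> lists X"
  by (auto simp: subset_iff)

end

locale pbw_mod = pbw FF S X b emb p pm r e lam + M: lrep_p X b U \<rho> p pm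
  for FF :: "('a::field) lie_class" and S X b and emb :: "'a \<Rightarrow> 'k::field" and p pm r e lam and U :: "'a vec set" and \<rho>
begin

lemma wact_in [simp]: "set w \<subseteq> {..<r} \<Longrightarrow> v \<in> U \<Longrightarrow> wact w \<rho> v \<in> U"
  by (simp add: wact_fold M.fold_in)

lemma wact_linear: "set w \<subseteq> {..<r} \<Longrightarrow> linear_on U (wact w \<rho>)"
  using M.fold_linear[of "map e w"] by (simp add: wact_fold[abs_def])

lemma cact_in [simp]: "g \<in> central \<Longrightarrow> v \<in> U \<Longrightarrow> cact \<rho> g v \<in> U"
  by (auto simp: central_def cact_def centreX)

lemma cact_linear: "g \<in> central \<Longrightarrow> linear_on U (cact \<rho> g)"
  by (auto simp: central_def cact_def[abs_def] centreX M.zeta_linear M.rlin)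

lemma cact_commute: assumes g: "g \<in> central" and x: "x \<in> X" and v: "v \<in> U" shows "cact \<rho> g (\<rho> x v) = \<rho> x (cact \<rho> g v)"
proof (cases g)
  case (Inl i)
  then show ?thesis using g x v by (auto simp: central_def cact_def M.zeta_commute)
next
  case (Inr z)
  then have z: "z \<in> centre X b" using g by (auto simp: central_def)
  have "\<rho> 0 v = 0" using M.rbrk[of x x v] x v by simp
  then have "\<rho> (b z x) v = 0" using z x centre_brk by simp
  then have "\<rho> z (\<rho> x v) = \<rho> x (\<rho> z v)" using M.rbrk[of z x v] x v z centreX by simp
  then show ?thesis using Inr by (simp add: cact_def)
qed

lemma cact_commute_wact: "g \<in> central \<Longrightarrow> set w \<subseteq> {..<r} \<Longrightarrow> v \<in> U \<Longrightarrow> wact w \<rho> (cact \<rho> g v) = cact \<rho> g (wact w \<rho> v)"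
proof (induction w arbitrary: v)
  case (Cons i w)
  then show ?case using cact_commute[of g "e i" v, symmetric] by (simp add: wact_def)
qed (simp add: wact_def)

lemma cfold_in [simp]: "G \<in> lists central \<Longrightarrow> v \<in> U \<Longrightarrow> fold (cact \<rho>) G v \<in> U"
  by (induction G arbitrary: v) auto

lemma cfold_linear: "G \<in> lists central \<Longrightarrow> linear_on U (fold (cact \<rho>) G)"
proof (induction G)
  case (Cons g G)
  have "linear_on U (\<lambda>v. fold (cact \<rho>) G (cact \<rho> g v))"
    by (rule linear_on_comp[OF cact_linear Cons.IH]) (use Cons.prems in auto)
  then show ?case by (simp add: comp_def)
qed (auto simp: linear_on_def)

lemma cfold_commute: "G \<in> lists central \<Longrightarrow> x \<in> X \<Longrightarrow> v \<in> U \<Longrightarrow> fold (cact \<rho>) G (\<rho> x v) = \<rho> x (fold (cact \<rho>) G v)"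
  by (induction G arbitrary: v) (auto simp: cact_commute)

end

context pbw
begin

lemma pbw_modI: "gmod X b U \<rho> \<Longrightarrow> pbw_mod FF S X b emb p pm r e lam U \<rho>"
  using gmod_lrep pbw_axioms by (simp add: pbw_mod_def)

lemma NFE:
  assumes "NF d \<theta>"
  obtains ts where "\<forall>(c, G, a)\<in>set ts. G \<in> lists central \<and> standard a \<and> length a \<le> d"
    "\<And>U \<rho> v. gmod X b U \<rho> \<Longrightarrow> v \<in> U \<Longrightarrow> \<theta> \<rho> v = (\<Sum>t\<leftarrow>ts. tev \<rho> t v)"
  using assms unfolding NF_def by (elim exE conjE) (rule that, assumption, simp)

lemma NFI:
  assumes "\<forall>(c, G, a)\<in>set ts. G \<in> lists central \<and> standard a \<and> length a \<le> d"
    "\<And>U \<rho> v. gmod X b U \<rho> \<Longrightarrow> v \<in> U \<Longrightarrow> \<theta> \<rho> v = (\<Sum>t\<leftarrow>ts. tev \<rho> t v)"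
  shows "NF d \<theta>"
  unfolding NF_def by (intro exI[of _ ts] conjI allI impI assms)

lemma NF_cong:
  assumes "NF d \<theta>" "\<And>U \<rho> v. gmod X b U \<rho> \<Longrightarrow> v \<in> U \<Longrightarrow> \<theta>' \<rho> v = \<theta> \<rho> v" shows "NF d \<theta>'"
proof (rule NFE[OF assms(1)])
  fix ts assume t: "\<forall>(c, G, a)\<in>set ts. G \<in> lists central \<and> standard a \<and> length a \<le> d"
    "\<And>U \<rho> v. gmod X b U \<rho> \<Longrightarrow> v \<in> U \<Longrightarrow> \<theta> \<rho> v = (\<Sum>t\<leftarrow>ts. tev \<rho> t v)"
  show ?thesis by (rule NFI[OF t(1)]) (simp add: t(2) assms(2))
qed

lemma NF_mono: "NF d \<theta> \<Longrightarrow> d \<le> d' \<Longrightarrow> NF d' \<theta>"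
  by (erule NFE, rule NFI) auto

lemma NF_add: assumes "NF d \<theta>" "NF d \<eta>" shows "NF d (\<lambda>\<rho> v. \<theta> \<rho> v + \<eta> \<rho> v)"
proof -
  obtain ts where t: "\<forall>(c, G, a)\<in>set ts. G \<in> lists central \<and> standard a \<and> length a \<le> d"
      "\<And>U \<rho> v. gmod X b U \<rho> \<Longrightarrow> v \<in> U \<Longrightarrow> \<theta> \<rho> v = (\<Sum>t\<leftarrow>ts. tev \<rho> t v)"
    by (rule NFE[OF assms(1)]) (rule that)
  obtain us where u: "\<forall>(c, G, a)\<in>set us. G \<in> lists central \<and> standard a \<and> length a \<le> d"
      "\<And>U \<rho> v. gmod X b U \<rho> \<Longrightarrow> v \<in> U \<Longrightarrow> \<eta> \<rho> v = (\<Sum>t\<leftarrow>us. tev \<rho> t v)"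
    by (rule NFE[OF assms(2)]) (rule that)
  show ?thesis by (rule NFI[of "ts @ us"]) (use t(1) u(1) in \<open>auto simp: t(2) u(2)\<close>)
qed

lemma NF_smult: assumes "NF d \<theta>" shows "NF d (\<lambda>\<rho> v. smult k (\<theta> \<rho> v))"
proof -
  obtain ts where t: "\<forall>(c, G, a)\<in>set ts. G \<in> lists central \<and> standard a \<and> length a \<le> d"
      "\<And>U \<rho> v. gmod X b U \<rho> \<Longrightarrow> v \<in> U \<Longrightarrow> \<theta> \<rho> v = (\<Sum>t\<leftarrow>ts. tev \<rho> t v)"
    by (rule NFE[OF assms]) (rule that)
  have "smult k (\<Sum>t\<leftarrow>us. tev \<rho> t v) = (\<Sum>t\<leftarrow>map (\<lambda>(c, G, a). (k * c, G, a)) us. tev \<rho> t v)" for us \<rho> v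
    by (induction us) (auto simp: tev_def smult_distrib)
  note sm = this
  show ?thesis
    by (rule NFI[of "map (\<lambda>(c, G, a). (k * c, G, a)) ts"]) (use t(1) in \<open>auto simp: t(2) sm\<close>)
qed

lemma NF_zero: "NF d (\<lambda>\<rho> v. 0)"
  by (rule NFI[of "[]"]) simp_all

lemma NF_sum: "finite I \<Longrightarrow> (\<And>i. i \<in> I \<Longrightarrow> NF d (\<theta> i)) \<Longrightarrow> NF d (\<lambda>\<rho> v. \<Sum>i\<in>I. \<theta> i \<rho> v)"
  by (induction I rule: finite_induct) (auto simp: NF_zero NF_add)

lemma NF_pre: assumes "NF d \<theta>" "g \<in> central" shows "NF d (\<lambda>\<rho> v. \<theta> \<rho> (cact \<rho> g v))"
proof -
  obtain ts where t: "\<forall>(c, G, a)\<in>set ts. G \<in> lists central \<and> standard a \<and> length a \<le> d"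
      "\<And>U \<rho> v. gmod X b U \<rho> \<Longrightarrow> v \<in> U \<Longrightarrow> \<theta> \<rho> v = (\<Sum>t\<leftarrow>ts. tev \<rho> t v)"
    by (rule NFE[OF assms(1)]) (rule that)
  have e: "(\<Sum>t\<leftarrow>us. tev \<rho> t (cact \<rho> g v)) = (\<Sum>t\<leftarrow>map (\<lambda>(c, G, a). (c, g # G, a)) us. tev \<rho> t v)" for us \<rho> v
    by (induction us) (auto simp: tev_def)
  have "\<theta> \<rho> (cact \<rho> g v) = (\<Sum>t\<leftarrow>map (\<lambda>(c, G, a). (c, g # G, a)) ts. tev \<rho> t v)" if "gmod X b U \<rho>" "v \<in> U" for U \<rho> v
  proof -
    interpret pbw_mod FF S X b emb p pm r e lam U \<rho> by (rule pbw_modI[OF that(1)])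
    show ?thesis using t(2)[OF that(1), of "cact \<rho> g v"] that assms(2) e by simp
  qed
  note pre = this
  show ?thesis
    by (rule NFI[of "map (\<lambda>(c, G, a). (c, g # G, a)) ts", OF _ pre]) (use t(1) assms(2) in fastforce)
qed

lemma NF_pre_list: "NF d \<theta> \<Longrightarrow> G \<in> lists central \<Longrightarrow> NF d (\<lambda>\<rho> v. \<theta> \<rho> (fold (cact \<rho>) G v))"
proof (induction G arbitrary: \<theta> rule: rev_induct)
  case (snoc g G)
  then have "NF d (\<lambda>\<rho> v. \<theta> \<rho> (cact \<rho> g v))" by (intro NF_pre) auto
  then show ?case using snoc by auto
qed simp

text \<open>Commutators and \<open>p\<close>-th powers insert an arbitrary element of
  \<open>X\<close> into a word. It expands into the \<open>e k\<close>, which gives words of length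
  at most \<open>d\<close>, and a central remainder, which moves to the front.\<close>

lemma NF_letter:
  assumes IH: "\<And>w. set w \<subseteq> {..<r} \<Longrightarrow> length w \<le> d \<Longrightarrow> NF d (wact w)"
    and w: "set w1 \<subseteq> {..<r}" "set w2 \<subseteq> {..<r}" "length w1 + length w2 < d" and x: "x \<in> X"
  shows "NF d (\<lambda>\<rho> v. wact w2 \<rho> (\<rho> x (wact w1 \<rho> v)))"
proof -
  define z where "z = x - (\<Sum>i<r. smult (lam i x) (e i))"
  have z: "z \<in> centre X b" using decomp[OF x] by (simp add: z_def)
  have 1: "NF d (\<lambda>\<rho> v. \<Sum>k<r. smult (lam k x) (wact (w1 @ k # w2) \<rho> v))"
    by (intro NF_sum NF_smult IH) (use w in auto)
  have 2: "NF d (\<lambda>\<rho> v. wact (w1 @ w2) \<rho> (cact \<rho> (Inr z) v))"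
    by (intro NF_pre IH) (use w z in \<open>auto simp: central_def\<close>)
  show ?thesis
  proof (rule NF_cong[OF NF_add[OF 1 2]])
    fix U \<rho> v assume gm: "gmod X b U \<rho>" and v: "v \<in> U"
    interpret pbw_mod FF S X b emb p pm r e lam U \<rho> by (rule pbw_modI[OF gm])
    interpret L: lmod X b U \<rho> by unfold_locales (rule gm)
    let ?q = "wact w1 \<rho> v"
    have q: "?q \<in> U" using w v by simp
    have sum: "\<rho> (\<Sum>i\<in>I. smult (c i) (e i)) ?q = (\<Sum>i\<in>I. smult (c i) (\<rho> (e i) ?q))" if "finite I" "I \<subseteq> {..<r}" for c and I :: "nat set"
      using that q
      by (induction I rule: finite_induct) (simp_all add: L.act_ladd L.act_lsmult subsp_smult subsp_sum subset_iff)
    have "x = (\<Sum>i<r. smult (lam i x) (e i)) + z" by (simp add: z_def)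
    then have "\<rho> x ?q = \<rho> ((\<Sum>i<r. smult (lam i x) (e i)) + z) ?q" by simp
    also have "\<dots> = (\<Sum>i<r. smult (lam i x) (\<rho> (e i) ?q)) + \<rho> z ?q"
    proof -
      have sX: "(\<Sum>i<r. smult (lam i x) (e i)) \<in> X" by (intro subsp_sum subsp_smult) auto
      show ?thesis using L.act_ladd[OF sX centreX[OF z] q] sum[of "{..<r}" "\<lambda>i. lam i x"] by simp
    qed
    also have "\<rho> z ?q = cact \<rho> (Inr z) ?q" by (simp add: cact_def)
    finally have e: "\<rho> x ?q = (\<Sum>i<r. smult (lam i x) (\<rho> (e i) ?q)) + cact \<rho> (Inr z) ?q" .
    have g: "Inr z \<in> central" using z by (simp add: central_def)
    have "wact w2 \<rho> (\<rho> x ?q) = (\<Sum>i<r. smult (lam i x) (wact w2 \<rho> (\<rho> (e i) ?q))) + wact w2 \<rho> (cact \<rho> (Inr z) ?q)"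
    proof -
      note l = wact_linear[OF w(2)]
      have m: "smult (lam i x) (\<rho> (e i) ?q) \<in> U" "\<rho> (e i) ?q \<in> U" if "i < r" for i
        using that q by (auto intro: subsp_smult)
      have "(\<Sum>i<r. smult (lam i x) (\<rho> (e i) ?q)) \<in> U" by (intro subsp_sum) (use m in auto)
      moreover have "wact w2 \<rho> (\<Sum>i<r. smult (lam i x) (\<rho> (e i) ?q)) = (\<Sum>i<r. wact w2 \<rho> (smult (lam i x) (\<rho> (e i) ?q)))"
        by (rule lin_sum[OF l]) (use m in auto)
      moreover have "\<dots> = (\<Sum>i<r. smult (lam i x) (wact w2 \<rho> (\<rho> (e i) ?q)))"
        by (intro sum.cong refl lin_smult[OF l]) (use m in auto)
      ultimately show ?thesis unfolding e using lin_add[OF l] cact_in[OF g q] by simp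
    qed
    also have "cact \<rho> (Inr z) ?q = wact w1 \<rho> (cact \<rho> (Inr z) v)" using cact_commute_wact[OF g w(1) v] by simp
    finally show "wact w2 \<rho> (\<rho> x ?q) = (\<Sum>k<r. smult (lam k x) (wact (w1 @ k # w2) \<rho> v)) + wact (w1 @ w2) \<rho> (cact \<rho> (Inr z) v)"
      by (simp add: wact_append) (simp add: wact_def)
  qed
qed

lemma NF_diff_trans:
  assumes "NF d (\<lambda>\<rho> v. \<theta> \<rho> v - \<eta> \<rho> v)" "NF d (\<lambda>\<rho> v. \<eta> \<rho> v - \<xi> \<rho> v)" shows "NF d (\<lambda>\<rho> v. \<theta> \<rho> v - \<xi> \<rho> v)"
  by (rule NF_cong[OF NF_add[OF assms]]) simp

text \<open>Induction on the degree. Exchanging neighbouring letters costs a commutator, hence a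
  shorter word, so insertion sort is performed modulo lower degree; in the sorted word a block of
  \<open>p\<close> equal letters is replaced by its central generator plus the single letter
  \<open>pm (e i)\<close>.\<close>

lemma NF_wact: "set w \<subseteq> {..<r} \<Longrightarrow> length w \<le> d \<Longrightarrow> NF d (wact w)"
proof (induction d arbitrary: w)
  case 0
  have "p > 0" using p by (simp add: prime_gt_0_nat)
  then show ?case using 0
    by (intro NFI[of "[(1, [], [])]"]) (auto simp: tev_def wact_def standard_def)
next
  case (Suc d)
  \<comment> \<open>Words act with the first letter first, so the commutator that appears is
    \<open>b (e y) (e x)\<close>.\<close>
  have swap: "NF d (\<lambda>\<rho> v. wact (u @ x # y # s) \<rho> v - wact (u @ y # x # s) \<rho> v)"
    if "set (u @ x # y # s) \<subseteq> {..<r}" "length (u @ x # y # s) = Suc d" for u x y s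
  proof (rule NF_cong)
    show "NF d (\<lambda>\<rho> v. wact s \<rho> (\<rho> (b (e y) (e x)) (wact u \<rho> v)))"
      by (rule NF_letter[OF Suc.IH]) (use that in auto)
    fix U \<rho> v assume gm: "gmod X b U \<rho>" and v: "v \<in> U"
    interpret pbw_mod FF S X b emb p pm r e lam U \<rho> by (rule pbw_modI[OF gm])
    let ?q = "wact u \<rho> v"
    have q: "?q \<in> U" using that v by simp
    have "wact (u @ x # y # s) \<rho> v - wact (u @ y # x # s) \<rho> v =
        wact s \<rho> (\<rho> (e y) (\<rho> (e x) ?q)) - wact s \<rho> (\<rho> (e x) (\<rho> (e y) ?q))"
      by (simp add: wact_append) (simp add: wact_def)
    also have "\<dots> = wact s \<rho> (\<rho> (e y) (\<rho> (e x) ?q) - \<rho> (e x) (\<rho> (e y) ?q))"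
      using that q by (intro lin_diff[OF wact_linear, symmetric]) auto
    also have "\<dots> = wact s \<rho> (\<rho> (b (e y) (e x)) ?q)" using M.rbrk[of "e y" "e x" ?q] that q by simp
    finally show "wact (u @ x # y # s) \<rho> v - wact (u @ y # x # s) \<rho> v = wact s \<rho> (\<rho> (b (e y) (e x)) ?q)" .
  qed
  have refl: "NF d (\<lambda>\<rho> v. \<theta> \<rho> v - \<theta> \<rho> v)" for \<theta>
    using NF_zero by simp
  have ins: "NF d (\<lambda>\<rho> v. wact (u @ x # s) \<rho> v - wact (u @ insort x s) \<rho> v)"
    if "set (u @ x # s) \<subseteq> {..<r}" "length (u @ x # s) = Suc d" for u x s
    using that
  proof (induction s arbitrary: u)
    case Nil
    then show ?case using refl by simp
  next
    case (Cons y s)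
    show ?case
    proof (cases "x \<le> y")
      case True
      then show ?thesis using refl by simp
    next
      case False
      have "NF d (\<lambda>\<rho> v. wact ((u @ [y]) @ x # s) \<rho> v - wact ((u @ [y]) @ insort x s) \<rho> v)"
        by (rule Cons.IH) (use Cons.prems in auto)
      then have "NF d (\<lambda>\<rho> v. wact (u @ y # x # s) \<rho> v - wact (u @ y # insort x s) \<rho> v)" by simp
      from NF_diff_trans[OF swap[OF Cons.prems] this] show ?thesis using False by simp
    qed
  qed
  have srt: "NF d (\<lambda>\<rho> v. wact (u @ w) \<rho> v - wact (u @ sort w) \<rho> v)"
    if "set (u @ w) \<subseteq> {..<r}" "length (u @ w) = Suc d" for u w
    using that
  proof (induction w arbitrary: u)
    case Nil
    then show ?case using refl by simp
  next
    case (Cons x w)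
    have 1: "NF d (\<lambda>\<rho> v. wact ((u @ [x]) @ w) \<rho> v - wact ((u @ [x]) @ sort w) \<rho> v)"
      by (rule Cons.IH) (use Cons.prems in auto)
    have 2: "NF d (\<lambda>\<rho> v. wact (u @ x # sort w) \<rho> v - wact (u @ insort x (sort w)) \<rho> v)"
      by (rule ins) (use Cons.prems in auto)
    show ?case using NF_diff_trans[OF 1[simplified] 2] by simp
  qed
  show ?case
  proof (cases "length w = Suc d")
    case False
    then show ?thesis using Suc NF_mono[of d _ "Suc d"] by simp
  next
    case True
    let ?s = "sort w"
    have s: "set ?s \<subseteq> {..<r}" "sorted ?s" "length ?s = Suc d" using Suc.prems True by auto
    have "NF (Suc d) (wact ?s)"
    proof (cases "\<forall>i. count_list ?s i < p")
      case True
      then show ?thesis using s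
        by (intro NFI[of "[(1, [], ?s)]"]) (auto simp: tev_def standard_def)
    next
      case False
      then obtain i where i: "count_list ?s i \<ge> p" by (auto simp: not_less)
      \<comment> \<open>Trading \<open>p\<close> letters for the single letter
        \<open>pm (e i)\<close> lowers the degree because \<open>p\<close> is at least 2.\<close>
      have p2: "p \<ge> 2" using p by (simp add: prime_ge_2_nat)
      define s1 where "s1 = filter (\<lambda>x. x < i) ?s"
      define s2 where "s2 = replicate (count_list ?s i - p) i @ filter (\<lambda>x. x > i) ?s"
      have "replicate (count_list ?s i) i = replicate p i @ replicate (count_list ?s i - p) i"
        using i by (simp add: replicate_add[symmetric])
      then have split: "?s = s1 @ replicate p i @ s2"
        using sorted_split[OF s(2), of i] by (simp add: s1_def s2_def)
      have "i \<in> set ?s" using i p2 count_list_0_iff[of ?s i] by fastforce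
      then have ir: "i < r" using s by blast
      have s12: "set s1 \<subseteq> {..<r}" "set s2 \<subseteq> {..<r}" using s(1) split by (metis set_append Un_subset_iff)+
      have len: "length s1 + length s2 + p = Suc d" using s(3) split by (metis length_append length_replicate add.assoc add.commute)
      have 1: "NF d (\<lambda>\<rho> v. wact s2 \<rho> (\<rho> (pm (e i)) (wact s1 \<rho> v)))"
        by (rule NF_letter[OF Suc.IH]) (use s12 ir len p2 in auto)
      have 2: "NF d (\<lambda>\<rho> v. wact (s1 @ s2) \<rho> (cact \<rho> (Inl i) v))"
        by (intro NF_pre Suc.IH) (use s12 ir len p2 in \<open>auto simp: central_def\<close>)
      have "NF d (wact ?s)"
      proof (rule NF_cong[OF NF_add[OF 2 1]])
        fix U \<rho> v assume gm: "gmod X b U \<rho>" and v: "v \<in> U"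
        interpret pbw_mod FF S X b emb p pm r e lam U \<rho> by (rule pbw_modI[OF gm])
        let ?q = "wact s1 \<rho> v"
        have q: "?q \<in> U" using s12 v by simp
        have g: "Inl i \<in> central" using ir by (simp add: central_def)
        have rep: "wact (replicate n i) \<rho> u = (\<rho> (e i) ^^ n) u" for n u
          by (induction n arbitrary: u) (simp_all add: wact_def funpow_Suc_right del: funpow.simps)
        have "wact ?s \<rho> v = wact s2 \<rho> ((\<rho> (e i) ^^ p) ?q)"
          by (subst split) (simp add: wact_append rep)
        also have "(\<rho> (e i) ^^ p) ?q = cact \<rho> (Inl i) ?q + \<rho> (pm (e i)) ?q"
          by (simp add: cact_def zeta_def)
        also have "wact s2 \<rho> \<dots> = wact s2 \<rho> (cact \<rho> (Inl i) ?q) + wact s2 \<rho> (\<rho> (pm (e i)) ?q)"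
          using q g ir s12 by (intro lin_add[OF wact_linear]) auto
        also have "cact \<rho> (Inl i) ?q = wact s1 \<rho> (cact \<rho> (Inl i) v)" using cact_commute_wact[OF g s12(1) v] by simp
        finally show "wact ?s \<rho> v = wact (s1 @ s2) \<rho> (cact \<rho> (Inl i) v) + wact s2 \<rho> (\<rho> (pm (e i)) ?q)"
          by (simp add: wact_append)
      qed
      then show ?thesis using NF_mono by fastforce
    qed
    moreover have "NF (Suc d) (\<lambda>\<rho> v. wact w \<rho> v - wact ?s \<rho> v)"
      using srt[of "[]" w] Suc.prems True NF_mono[of d _ "Suc d"] by simp
    ultimately have "NF (Suc d) (\<lambda>\<rho> v. wact ?s \<rho> v + (wact w \<rho> v - wact ?s \<rho> v))" by (intro NF_add)
    then show ?thesis by (rule NF_cong) simp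
  qed
qed

text \<open>Closure under the action from the outside: applying all normal forms to a vector
  therefore gives a submodule.\<close>

lemma NF_act:
  assumes \<theta>: "NF d \<theta>" and x: "x \<in> X" shows "NF (Suc d) (\<lambda>\<rho> v. \<rho> x (\<theta> \<rho> v))"
proof -
  obtain ts where t: "\<forall>(c, G, a)\<in>set ts. G \<in> lists central \<and> standard a \<and> length a \<le> d"
      "\<And>U \<rho> v. gmod X b U \<rho> \<Longrightarrow> v \<in> U \<Longrightarrow> \<theta> \<rho> v = (\<Sum>t\<leftarrow>ts. tev \<rho> t v)"
    by (rule NFE[OF \<theta>]) (rule that)
  have "NF (Suc d) (\<lambda>\<rho> v. \<rho> x (\<Sum>t\<leftarrow>ts. tev \<rho> t v))"
    using t(1)
  proof (induction ts)
    case Nil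
    show ?case
    proof (rule NF_cong[OF NF_zero])
      fix U \<rho> v assume "gmod X b U \<rho>" "v \<in> U"
      then interpret pbw_mod FF S X b emb p pm r e lam U \<rho> by (intro pbw_modI)
      show "\<rho> x (\<Sum>t\<leftarrow>[]. tev \<rho> t v) = 0" using x by simp
    qed
  next
    case (Cons t ts)
    obtain c G a where [simp]: "t = (c, G, a)" by (cases t)
    have G: "G \<in> lists central" "standard a" "length a \<le> d" using Cons.prems by auto
    then have a: "set a \<subseteq> {..<r}" by (simp add: standard_def)
    have "NF (Suc d) (\<lambda>\<rho> v. wact [] \<rho> (\<rho> x (wact a \<rho> v)))"
      by (rule NF_letter[OF NF_wact]) (use a G x in auto)
    then have 1: "NF (Suc d) (\<lambda>\<rho> v. smult c (wact [] \<rho> (\<rho> x (wact a \<rho> (fold (cact \<rho>) G v)))))"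
      using G(1) by (intro NF_smult NF_pre_list[of _ "\<lambda>\<rho> v. wact [] \<rho> (\<rho> x (wact a \<rho> v))"])
    have 2: "NF (Suc d) (\<lambda>\<rho> v. \<rho> x (\<Sum>t\<leftarrow>ts. tev \<rho> t v))" using Cons by auto
    show ?case
    proof (rule NF_cong[OF NF_add[OF 1 2]])
      fix U \<rho> v assume gm: "gmod X b U \<rho>" and v: "v \<in> U"
      interpret pbw_mod FF S X b emb p pm r e lam U \<rho> by (rule pbw_modI[OF gm])
      have tU: "tev \<rho> t v \<in> U" if "case t of (c, G, a) \<Rightarrow> G \<in> lists central \<and> standard a \<and> length a \<le> d" for t
      proof -
        obtain c G a where "t = (c, G, a)" by (cases t)
        then show ?thesis using that v by (simp add: tev_def standard_def) (intro subsp_smult wact_in cfold_in; simp)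
      qed
      have sU: "(\<Sum>t\<leftarrow>us. tev \<rho> t v) \<in> U" if "\<forall>t\<in>set us. case t of (c, G, a) \<Rightarrow> G \<in> lists central \<and> standard a \<and> length a \<le> d" for us
        using that by (induction us) (auto simp: subsp_add tU)
      have "\<rho> x (\<Sum>t\<leftarrow>t # ts. tev \<rho> t v) = \<rho> x (tev \<rho> t v) + \<rho> x (\<Sum>t\<leftarrow>ts. tev \<rho> t v)"
        using x tU[of t] sU[of ts] Cons.prems by (simp add: M.radd)
      also have "\<rho> x (tev \<rho> t v) = smult c (wact [] \<rho> (\<rho> x (wact a \<rho> (fold (cact \<rho>) G v))))"
        using x a G v by (simp add: tev_def M.rsmult) (simp add: wact_def)
      finally show "\<rho> x (\<Sum>t\<leftarrow>t # ts. tev \<rho> t v) =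
        smult c (wact [] \<rho> (\<rho> x (wact a \<rho> (fold (cact \<rho>) G v)))) + \<rho> x (\<Sum>t\<leftarrow>ts. tev \<rho> t v)" .
    qed
  qed
  then show ?thesis
  proof (rule NF_cong)
    fix U \<rho> v assume "gmod X b U \<rho>" "v \<in> U"
    then show "\<rho> x (\<theta> \<rho> v) = \<rho> x (\<Sum>t\<leftarrow>ts. tev \<rho> t v)" using t(2) by simp
  qed
qed

section \<open>Dual functionals as coefficients and their shuffle products\<close>

lemma dual_coef:
  assumes i: "i < r"
  obtains f where "coef f" "eig f (\<lambda>_. 0)" "f [] = 0" "\<And>x. x \<in> X \<Longrightarrow> f [x] = emb (lam i x)"
proof -
  obtain c v j where v: "v \<in> X" and l: "lam i = (\<lambda>x. c * b x v j)" using lam_coef[OF i] by blast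
  interpret A: lrep_p X b X b p pm
    by (rule gmod_lrep[OF X.adjoint_ideal]) (auto simp: ideal_of_def)
  \<comment> \<open>Entry \<open>j\<close> of the word acting on \<open>v\<close> gives
    \<open>lam i\<close> on one-letter words; the second summand only corrects the value at the
    empty word to zero. \<open>eig\<close> is unaffected, as its left-hand sides involve nonempty
    words only and the eigenvalue is zero.\<close>
  let ?f = "\<lambda>w. emb c * emb (fold b w v j) + (- (emb c * emb (v j))) * (if w = [] then 1 else 0)"
  have p0: "p > 0" using p by (simp add: prime_gt_0_nat)
  have "coef ?f" by (intro coef_add coef_adjoint coef_scale[OF coef_empty_word] v)
  moreover have "eig ?f (\<lambda>_. 0)"
    unfolding eig_def
  proof (intro conjI ballI)
    fix x w assume x: "x \<in> X" and w: "w \<in> lists X"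
    have rep: "fold b (replicate n x) u = (b x ^^ n) u" for n u
      by (induction n arbitrary: u) (simp_all add: funpow_Suc_right del: funpow.simps)
    have "fold b (replicate p x @ w) v = fold b (pm x # w) v" using pm_brk[OF x v] by (simp add: rep)
    then show "?f (replicate p x @ w) - ?f (pm x # w) = 0 ^ p * ?f w" using p0 by simp
  next
    fix z w assume z: "z \<in> centre X b" and w: "w \<in> lists X"
    then have "fold b (z # w) v = 0" using lin_0[OF A.fold_linear[OF w]] centre_brk v by simp
    then show "?f (z # w) = 0 * ?f w" by (simp add: pointwise)
  qed
  moreover have "?f [] = 0" by simp
  moreover have "?f [x] = emb (lam i x)" for x by (simp add: l emb_mult)
  ultimately show ?thesis using that by blast
qed

text \<open>The shuffle products of dual functionals detect the ordered monomials; the factor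
  \<open>dual_const a\<close> is the product of the factorials of the exponents.\<close>

definition dual_fun :: "nat \<Rightarrow> 'a vec list \<Rightarrow> 'k" where
  "dual_fun i = (SOME f. coef f \<and> eig f (\<lambda>_. 0) \<and> f [] = 0 \<and> (\<forall>x\<in>X. f [x] = emb (lam i x)))"

lemma dual_fun:
  assumes "i < r"
  shows "coef (dual_fun i)" "eig (dual_fun i) (\<lambda>_. 0)" "dual_fun i [] = 0" "x \<in> X \<Longrightarrow> dual_fun i [x] = emb (lam i x)"
proof -
  have "\<exists>f. coef f \<and> eig f (\<lambda>_. 0) \<and> f [] = 0 \<and> (\<forall>x\<in>X. f [x] = emb (lam i x))"
    using dual_coef[OF assms] by metis
  from someI_ex[OF this] show "coef (dual_fun i)" "eig (dual_fun i) (\<lambda>_. 0)" "dual_fun i [] = 0" "x \<in> X \<Longrightarrow> dual_fun i [x] = emb (lam i x)"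
    by (auto simp: dual_fun_def)
qed

definition dual_word :: "('a vec list \<Rightarrow> 'k) \<Rightarrow> nat list \<Rightarrow> 'a vec list \<Rightarrow> 'k" where
  "dual_word \<Psi> a = foldr (\<lambda>i. shuf (dual_fun i)) a \<Psi>"

fun dual_const :: "nat list \<Rightarrow> 'k" where
  "dual_const [] = 1"
| "dual_const (i # a) = of_nat (count_list (i # a) i) * dual_const a"

text \<open>Every factor is a positive integer below \<open>p\<close>, hence invertible in
  characteristic \<open>p\<close>.\<close>

lemma dual_const_nonzero: "\<forall>i. count_list a i < p \<Longrightarrow> dual_const a \<noteq> 0"
proof (induction a)
  case (Cons i a)
  have "count_list (i # a) i < p" using Cons.prems by blast
  moreover have "count_list (i # a) i > 0" by simp
  ultimately have "of_nat (count_list (i # a) i) \<noteq> (0 :: 'k)"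
    using char_k by (metis of_nat_eq_0_iff_char_dvd nat_dvd_not_less)
  moreover have "\<forall>j. count_list a j < p" using Cons.prems by (metis count_list.simps(2) less_Suc_eq add_lessD1)
  ultimately show ?case using Cons.IH by simp
qed simp

lemma dual_word_coef: "set a \<subseteq> {..<r} \<Longrightarrow> coef \<Psi> \<Longrightarrow> coef (dual_word \<Psi> a)"
  by (induction a) (auto simp: dual_word_def coef_shuf dual_fun)

lemma dual_word_eig: "set a \<subseteq> {..<r} \<Longrightarrow> eig \<Psi> \<chi> \<Longrightarrow> eig (dual_word \<Psi> a) \<chi>"
proof (induction a)
  case (Cons i a)
  then show ?case using eig_shuf[OF dual_fun(2)[of i], of "dual_word \<Psi> a" \<chi>] by (simp add: dual_word_def)
qed (simp add: dual_word_def)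

lemma dual_word_order: "set a \<subseteq> {..<r} \<Longrightarrow> w \<in> lists X \<Longrightarrow> length w < length a \<Longrightarrow> dual_word \<Psi> a w = 0"
proof (induction a arbitrary: w)
  case (Cons i a)
  have "shuf (dual_fun i) (dual_word \<Psi> a) w = 0"
    by (rule shuf_order[where m = 1 and n = "length a" and X = X]) (use Cons dual_fun(3)[of i] in auto)
  then show ?case by (simp add: dual_word_def)
qed simp

text \<open>Shuffling with \<open>dual_fun i\<close> removes one letter \<open>i\<close> in every
  possible position, so in the lowest degree the value counts the ways of striking out the letters
  of \<open>a\<close> one after another. What remains is the empty word, where \<open>\<Psi>\<close>
  is evaluated. Together with \<open>dual_word_order\<close> this makes the pairing with monomials
  triangular.\<close>

lemma dual_word_eval:
  "set a \<subseteq> {..<r} \<Longrightarrow> set w \<subseteq> {..<r} \<Longrightarrow> length w = length a \<Longrightarrow>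
    dual_word \<Psi> a (map e w) = (if mset w = mset a then dual_const a * \<Psi> [] else 0)"
proof (induction a arbitrary: w)
  case Nil
  then show ?case by (simp add: dual_word_def)
next
  case (Cons i a)
  have i: "i < r" using Cons.prems by simp
  have "dual_word \<Psi> (i # a) (map e w) = shuf (dual_fun i) (dual_word \<Psi> a) (map e w)" by (simp add: dual_word_def)
  also have "\<dots> = (\<Sum>k<length (map e w). dual_fun i [map e w ! k] * dual_word \<Psi> a (take k (map e w) @ drop (Suc k) (map e w)))"
    by (rule shuf_order_eval[where X = X]) (use Cons.prems dual_fun(3)[OF i] dual_word_order in auto)
  also have "\<dots> = (\<Sum>k<length w. (if w ! k = i then (if mset w = mset (i # a) then dual_const a * \<Psi> [] else 0) else 0))"
  proof (rule sum.cong)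
    fix k assume "k \<in> {..<length w}"
    then have k: "k < length w" by simp
    then have wk: "w ! k < r" using Cons.prems nth_mem by blast
    have f: "dual_fun i [map e w ! k] = (if w ! k = i then 1 else 0)"
      using dual_fun(4)[OF i, of "e (w ! k)"] dual[OF i wk] wk k by auto
    let ?w = "take k w @ drop (Suc k) w"
    have ms: "mset w = add_mset (w ! k) (mset ?w)"
      using id_take_nth_drop[OF k] by (metis mset_append mset.simps(2) union_mset_add_mset_right)
    have "dual_word \<Psi> a (map e ?w) = (if mset ?w = mset a then dual_const a * \<Psi> [] else 0)"
      by (rule Cons.IH) (use Cons.prems k in \<open>auto dest: in_set_takeD in_set_dropD\<close>)
    then show "dual_fun i [map e w ! k] * dual_word \<Psi> a (take k (map e w) @ drop (Suc k) (map e w)) =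
      (if w ! k = i then (if mset w = mset (i # a) then dual_const a * \<Psi> [] else 0) else 0)"
      unfolding f using ms by (simp add: take_map drop_map)
  qed simp
  also have "\<dots> = (if mset w = mset (i # a) then of_nat (count_list w i) * (dual_const a * \<Psi> []) else 0)"
  proof -
    have "card {k. k < length w \<and> w ! k = i} = count_list w i"
      by (simp add: count_list_eq_length_filter length_filter_conv_card eq_commute)
    moreover have "{..<length w} \<inter> {k. w ! k = i} = {k. k < length w \<and> w ! k = i}" by auto
    ultimately show ?thesis by (simp add: sum.If_cases)
  qed
  also have "\<dots> = (if mset w = mset (i # a) then dual_const (i # a) * \<Psi> [] else 0)"
  proof (cases "mset w = mset (i # a)")
    case True
    then have "count_list w i = count_list (i # a) i" by (metis count_mset)
    then show ?thesis using True by (simp only: if_True dual_const.simps mult.assoc)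
  qed simp
  finally show ?case .
qed

end

section \<open>Characters\<close>

lemma vsupp_expand:
  assumes "g \<in> vsupp n" shows "(g :: ('k::field) vec) = (\<Sum>j<n. smult (g j) (unitv j))"
proof
  fix i
  have "(\<Sum>j<n. smult (g j) (unitv j)) i = (\<Sum>j<n. if i = j then g j else 0)"
    unfolding sum_apply by (rule sum.cong) (auto simp: pointwise unitv_def)
  also have "\<dots> = g i" using assms by (auto simp: vsupp_def)
  finally show "g i = (\<Sum>j<n. smult (g j) (unitv j)) i" by simp
qed

lemma unitv_vsupp [simp]: "j < n \<Longrightarrow> unitv j \<in> vsupp n"
  by (auto simp: unitv_def vsupp_def)

section \<open>Polynomials in an operator and Schur's lemma on a composition factor\<close>

definition pop :: "('k::field vec \<Rightarrow> 'k vec) \<Rightarrow> 'k poly \<Rightarrow> 'k vec \<Rightarrow> 'k vec" where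
  "pop g q v = (\<Sum>i\<le>degree q. smult (coeff q i) ((g ^^ i) v))"

lemma pop_bound: "degree q \<le> m \<Longrightarrow> pop g q v = (\<Sum>i\<le>m. smult (coeff q i) ((g ^^ i) v))"
  unfolding pop_def by (rule sum.mono_neutral_left) (auto simp: coeff_eq_0)

lemma pop_linear_factor:
  assumes g: "linear_on U g" "g ` U \<subseteq> U" "subsp U" and v: "v \<in> U"
  shows "pop g ([:- c, 1:] * q) v = g (pop g q v) - smult c (pop g q v)"
proof -
  let ?m = "degree q"
  have gi: "(g ^^ i) v \<in> U" for i using g v by (induction i) auto
  have d: "degree ([:- c, 1:] * q) \<le> Suc ?m"
    using degree_mult_le[of "[:- c, 1:]" q] by simp
  have co: "coeff ([:- c, 1:] * q) i = (if i = 0 then 0 else coeff q (i - 1)) - c * coeff q i" for i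
    by (cases i) simp_all
  have "pop g ([:- c, 1:] * q) v =
      (\<Sum>i\<le>Suc ?m. smult (if i = 0 then 0 else coeff q (i - 1)) ((g ^^ i) v)) - (\<Sum>i\<le>Suc ?m. smult (c * coeff q i) ((g ^^ i) v))"
    unfolding pop_bound[OF d] co smult_distrib sum_subtractf ..
  also have "(\<Sum>i\<le>Suc ?m. smult (if i = 0 then 0 else coeff q (i - 1)) ((g ^^ i) v)) = (\<Sum>i\<le>?m. smult (coeff q i) ((g ^^ Suc i) v))"
    by (subst sum.atMost_Suc_shift) simp
  also have "\<dots> = (\<Sum>i\<le>?m. g (smult (coeff q i) ((g ^^ i) v)))"
    using g gi by (intro sum.cong refl) (simp add: lin_smult)
  also have "\<dots> = g (pop g q v)"
    unfolding pop_def using g gi by (intro lin_sum[symmetric, OF g(1,3)]) (simp add: subsp_smult)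
  also have "(\<Sum>i\<le>Suc ?m. smult (c * coeff q i) ((g ^^ i) v)) = smult c (pop g q v)"
    by (simp add: pop_def smult_sum coeff_eq_0)
  finally show ?thesis .
qed

text \<open>The spaces spanned by \<open>N\<close> and the first \<open>k\<close> iterates of
  \<open>v\<close> cannot grow more than \<open>n\<close> times, so some iterate depends on the
  earlier ones modulo \<open>N\<close>. The monic polynomial of this relation is
  \<open>q\<close>.\<close>

lemma ex_annihilating_poly:
  assumes N: "subsp N" "N \<subseteq> vsupp n" and v: "\<And>i. (g ^^ i) v \<in> vsupp n"
  shows "\<exists>q. q \<noteq> 0 \<and> pop g q v \<in> N"
proof -
  let ?C = "\<lambda>k. {x + (\<Sum>i<k. smult (a i) ((g ^^ i) v)) | x a. x \<in> N}"
  have C: "subsp (?C k)" for k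
  proof (rule subspI)
    show "0 \<in> ?C k" using N by (intro CollectI exI[of _ 0] exI[of _ "\<lambda>_. 0"]) simp
  next
    fix x y assume "x \<in> ?C k"
    then obtain x' a where x: "x = x' + (\<Sum>i<k. smult (a i) ((g ^^ i) v))" "x' \<in> N" by blast
    assume "y \<in> ?C k"
    then obtain y' c where y: "y = y' + (\<Sum>i<k. smult (c i) ((g ^^ i) v))" "y' \<in> N" by blast
    have "x + y = (x' + y') + (\<Sum>i<k. smult (a i + c i) ((g ^^ i) v))"
      by (simp add: x y smult_distrib sum.distrib algebra_simps)
    then show "x + y \<in> ?C k" using subsp_add[OF N(1) x(2) y(2)]
      by (intro CollectI exI[of _ "x' + y'"] exI[of _ "\<lambda>i. a i + c i"] conjI)
  next
    fix c x assume "x \<in> ?C k"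
    then obtain x' a where x: "x = x' + (\<Sum>i<k. smult (a i) ((g ^^ i) v))" "x' \<in> N" by blast
    have "smult c x = smult c x' + (\<Sum>i<k. smult (c * a i) ((g ^^ i) v))"
      by (simp add: x smult_distrib smult_sum)
    then show "smult c x \<in> ?C k" using subsp_smult[OF N(1) x(2)]
      by (intro CollectI exI[of _ "smult c x'"] exI[of _ "\<lambda>i. c * a i"] conjI)
  qed
  have Cn: "?C k \<subseteq> vsupp n" for k
    using N v by (auto intro!: subsp_add[OF subsp_vsupp] subsp_sum[OF subsp_vsupp] subsp_smult[OF subsp_vsupp])
  have mono: "?C k \<subseteq> ?C (Suc k)" for k
  proof
    fix x assume "x \<in> ?C k"
    then obtain x' a where x: "x = x' + (\<Sum>i<k. smult (a i) ((g ^^ i) v))" "x' \<in> N" by blast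
    have "(\<Sum>i<k. smult (a i) ((g ^^ i) v)) = (\<Sum>i<k. smult ((a(k := 0)) i) ((g ^^ i) v))" by (intro sum.cong) auto
    then have "x = x' + (\<Sum>i<Suc k. smult ((a(k := 0)) i) ((g ^^ i) v))" by (simp add: x)
    then show "x \<in> ?C (Suc k)" using x(2) by (intro CollectI exI[of _ x'] exI[of _ "a(k := 0)"] conjI)
  qed
  have new: "(g ^^ k) v \<in> ?C (Suc k)" for k
  proof -
    have "(\<Sum>i<k. smult (if i = k then 1 else 0) ((g ^^ i) v)) = 0" by (intro sum.neutral) auto
    then have "(g ^^ k) v = 0 + (\<Sum>i<Suc k. smult (if i = k then 1 else 0) ((g ^^ i) v))" by simp
    then show ?thesis using N by (intro CollectI exI[of _ 0] exI[of _ "\<lambda>i. if i = k then 1 else 0"] conjI) auto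
  qed
  have "\<exists>k. (g ^^ k) v \<in> ?C k"
  proof (rule ccontr)
    assume no: "\<nexists>k. (g ^^ k) v \<in> ?C k"
    have "?C k \<subset> ?C (Suc k)" for k using mono[of k] new[of k] no by blast
    then have less: "vdim (?C k) < vdim (?C (Suc k))" for k by (intro vdim_less[OF C C _ Cn])
    have "k \<le> vdim (?C k)" for k
    proof (induction k)
      case (Suc k)
      then show ?case using less[of k] by linarith
    qed simp
    from this[of "Suc n"] vdim_le[OF Cn, of "Suc n"] show False by linarith
  qed
  then obtain k x a where k: "(g ^^ k) v = x + (\<Sum>i<k. smult (a i) ((g ^^ i) v))" "x \<in> N" by blast
  define q where "q = monom 1 k - (\<Sum>i<k. monom (a i) i)"
  have co: "coeff q i = (if i = k then 1 else if i < k then - a i else 0)" for i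
  proof -
    have "(\<Sum>j<k. coeff (monom (a j) j) i) = (\<Sum>j<k. if j = i then a j else 0)" by (intro sum.cong) auto
    then show ?thesis by (simp add: q_def coeff_sum)
  qed
  have "q \<noteq> 0" using co[of k] by auto
  moreover have "degree q \<le> k" by (rule degree_le) (simp add: co)
  then have "pop g q v = (\<Sum>i\<le>k. smult (coeff q i) ((g ^^ i) v))" by (rule pop_bound)
  then have "pop g q v = (\<Sum>i<k. smult (- a i) ((g ^^ i) v)) + (g ^^ k) v"
    by (simp add: co lessThan_Suc_atMost[symmetric])
  then have "pop g q v = x" unfolding k(1) by (simp add: sum_negf)
  ultimately show ?thesis using k(2) by blast
qed

context lrep
begin

text \<open>Among all polynomials that send some \<open>v\<close> outside \<open>N\<close> into
  \<open>N\<close>, take one of least degree and split off a root \<open>c\<close>. The cofactor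
  applied to \<open>v\<close> gives an eigenvector modulo \<open>N\<close> that by minimality is not
  in \<open>N\<close>. The eigenvectors modulo \<open>N\<close> form a submodule, which
  irreducibility makes all of \<open>N'\<close>.\<close>

lemma schur:
  assumes closed: "\<And>q :: 'k poly. degree q > 0 \<Longrightarrow> \<exists>z. poly q z = 0"
    and U: "U = vsupp n" and Ns: "comp_series X \<rho> U Ns" "Suc i < length Ns"
    and g: "linear_on U g" "g ` U \<subseteq> U" "g ` (Ns ! i) \<subseteq> Ns ! i" "g ` (Ns ! Suc i) \<subseteq> Ns ! Suc i"
    and comm: "\<And>x v. x \<in> X \<Longrightarrow> v \<in> U \<Longrightarrow> g (\<rho> x v) = \<rho> x (g v)"
  obtains c where "\<And>v. v \<in> Ns ! Suc i \<Longrightarrow> g v - smult c v \<in> Ns ! i"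
proof -
  let ?N = "Ns ! i" and ?N' = "Ns ! Suc i"
  have sub: "submod X \<rho> U ?N" "submod X \<rho> U ?N'" using comp_series_submod[OF Ns(1)] Ns(2) by auto
  have N: "subsp ?N" "?N \<subseteq> U" "\<And>x v. x \<in> X \<Longrightarrow> v \<in> ?N \<Longrightarrow> \<rho> x v \<in> ?N"
    and N': "subsp ?N'" "?N' \<subseteq> U" "\<And>x v. x \<in> X \<Longrightarrow> v \<in> ?N' \<Longrightarrow> \<rho> x v \<in> ?N'"
    using sub by (auto simp: submod_def)
  have lt: "?N \<subset> ?N'" and irr: "\<And>T. submod X \<rho> U T \<Longrightarrow> ?N \<subset> T \<Longrightarrow> \<not> T \<subset> ?N'"
    using Ns by (auto simp: comp_series_def)
  define Q where "Q d \<longleftrightarrow> (\<exists>q v. q \<noteq> 0 \<and> degree q = d \<and> v \<in> ?N' \<and> v \<notin> ?N \<and> pop g q v \<in> ?N)" for d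
  have gi: "(g ^^ j) v \<in> ?N'" if "v \<in> ?N'" for v j using g that by (induction j) auto
  have "\<exists>d. Q d"
  proof -
    obtain v where v: "v \<in> ?N'" "v \<notin> ?N" using lt by blast
    then have "(g ^^ j) v \<in> vsupp n" for j using gi N' U by blast
    then obtain q where "q \<noteq> 0" "pop g q v \<in> ?N" using ex_annihilating_poly[of ?N n g v] N U by blast
    then show ?thesis using v by (auto simp: Q_def)
  qed
  then have "Q (LEAST d. Q d)" by (rule LeastI_ex)
  then obtain q v where q: "q \<noteq> 0" "degree q = (LEAST d. Q d)" "v \<in> ?N'" "v \<notin> ?N" "pop g q v \<in> ?N"
    by (auto simp: Q_def)
  have "degree q > 0"
  proof (rule ccontr)
    assume "\<not> degree q > 0"
    then have d: "degree q = 0" by simp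
    then have "coeff q 0 \<noteq> 0" using q(1) leading_coeff_0_iff[of q] by simp
    moreover have "smult (coeff q 0) v \<in> ?N" using q(5) d by (simp add: pop_def)
    then have "smult (inverse (coeff q 0)) (smult (coeff q 0) v) \<in> ?N" by (rule subsp_smult[OF N(1)])
    ultimately show False using q(4) by simp
  qed
  then obtain c where "poly q c = 0" using closed by blast
  then obtain s where s: "q = [:- c, 1:] * s" using poly_eq_0_iff_dvd by (metis dvdE)
  have s0: "s \<noteq> 0" using q(1) s by auto
  have deg: "degree s < degree q" unfolding s using s0 by (subst degree_mult_eq) auto
  define u where "u = pop g s v"
  have u: "u \<in> ?N'" unfolding u_def pop_def using gi[OF q(3)] N' by (intro subsp_sum subsp_smult)
  have "u \<notin> ?N"
  proof
    assume "u \<in> ?N"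
    then have "Q (degree s)" using s0 q by (auto simp: Q_def u_def)
    then show False using deg q(2) not_less_Least by metis
  qed
  have gu: "g u - smult c u \<in> ?N"
    using q(5) pop_linear_factor[OF g(1,2) rsub, of v c s] q(3) N' unfolding s u_def by auto
  let ?T = "{v \<in> ?N'. g v - smult c v \<in> ?N}"
  have "submod X \<rho> U ?T" unfolding submod_def
  proof (intro conjI ballI)
    have "linear_on ?N' (\<lambda>v. g v - smult c v)"
      using linear_on_subset[OF g(1) N'(2)]
      by (intro linear_onI) (simp_all add: lin_add lin_smult smult_distrib mult.commute)
    then show "subsp ?T" using subsp_vimage N' N by blast
    fix x v assume x: "x \<in> X" and v: "v \<in> ?T"
    then have "g (\<rho> x v) - smult c (\<rho> x v) = \<rho> x (g v - smult c v)"
      using N' g comm by (auto simp: rdiff rsmult subsp_smult subset_iff image_subset_iff)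
    then show "\<rho> x v \<in> ?T" using x v N N' by auto
  qed (use N' in auto)
  moreover have "?N \<subseteq> ?T" using lt g N by (auto intro!: subsp_diff subsp_smult)
  moreover have "u \<in> ?T" using u gu by simp
  ultimately have "?T = ?N'" using irr[of ?T] \<open>u \<notin> ?N\<close> by blast
  then show ?thesis using that[of c] by blast
qed

end

section \<open>Extension of scalars and characters\<close>

context main
begin

definition E :: "'a vec \<Rightarrow> 'k vec" where "E v = (\<lambda>i. emb (v i))"

lemma E_apply: "E v i = emb (v i)" by (simp add: E_def)

lemma E_linear: "E (v + w) = E v + E w" "E (smult c v) = smult (emb c) (E v)" "E (v - w) = E v - E w" "E 0 = 0"
  by (auto simp: E_def fun_eq_iff pointwise emb_add emb_mult emb_diff)

lemma E_unitv: "E (unitv j) = unitv j"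
  by (auto simp: E_def unitv_def fun_eq_iff)

lemma E_vsupp: "v \<in> vsupp n \<Longrightarrow> E v \<in> vsupp n"
  by (auto simp: E_def vsupp_def)

lemma E_eq_0: "E v = 0 \<longleftrightarrow> v = 0"
  by (auto simp: E_def fun_eq_iff pointwise)

lemma coef_cong:
  assumes "\<And>w. w \<in> lists X \<Longrightarrow> \<Psi> w = \<Phi> w" "coef \<Phi>" shows "coef \<Psi>"
proof -
  obtain U \<rho> m K where *: "LM U \<rho>" "m \<in> U" "cfun emb K" "\<forall>w\<in>lists X. \<Phi> w = K (fold \<rho> w m)"
    using assms(2) unfolding coef_def by (elim exE conjE) (rule that)
  show ?thesis by (rule coefI[OF *(1-3)]) (use *(4) assms(1) in simp)
qed

lemma closed: "degree (q :: 'k poly) > 0 \<Longrightarrow> \<exists>z. poly q z = 0"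
  using closure by (auto simp: is_alg_closure_def)

end

locale main_mod = main FF S X b emb p pm + W: lmod X b "vsupp n" \<rho>
  for FF :: "('a::field) lie_class" and S X b and emb :: "'a \<Rightarrow> 'k::field" and p pm n \<rho>
begin

abbreviation "\<epsilon> \<equiv> ext_action emb n \<rho>"

lemma ext_in: "\<epsilon> x g \<in> vsupp n"
  by (auto simp: ext_action_def vsupp_def)

lemma ext_linear: "linear_on UNIV (\<epsilon> x)"
  by (rule linear_onI)
    (auto simp: ext_action_def fun_eq_iff pointwise sum.distrib sum_distrib_left algebra_simps)

lemma ext_E: assumes x: "x \<in> X" and v: "v \<in> vsupp n" shows "\<epsilon> x (E v) = E (\<rho> x v)"
proof
  fix i
  have "\<rho> x v = \<rho> x (\<Sum>j<n. smult (v j) (unitv j))" using vsupp_expand[OF v] by simp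
  also have "\<dots> = (\<Sum>j<n. \<rho> x (smult (v j) (unitv j)))"
    by (rule lin_sum[OF W.act_lin[OF x] W.Usub]) (auto intro: subsp_smult)
  also have "\<dots> = (\<Sum>j<n. smult (v j) (\<rho> x (unitv j)))"
    using x by (intro sum.cong refl W.act_smult) auto
  finally have "\<rho> x v i = (\<Sum>j<n. v j * \<rho> x (unitv j) i)" by (simp add: sum_apply pointwise)
  then have "E (\<rho> x v) i = (\<Sum>j<n. emb (\<rho> x (unitv j) i) * emb (v j))"
  proof -
    have "emb (\<Sum>j\<in>J. f j) = (\<Sum>j\<in>J. emb (f j))" for J :: "nat set" and f
      by (induction J rule: infinite_finite_induct) (simp_all add: emb_add)
    then show ?thesis using \<open>\<rho> x v i = _\<close> by (simp add: E_apply emb_mult mult.commute)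
  qed
  moreover have "i \<ge> n \<Longrightarrow> \<rho> x v i = 0" using W.act[OF x v] by (simp add: vsupp_def)
  ultimately show "\<epsilon> x (E v) i = E (\<rho> x v) i" by (auto simp: ext_action_def E_apply not_less)
qed

text \<open>Both sides are linear over the closure and agree on unit vectors, which come from the
  ground field.\<close>

lemma ext_brk:
  assumes x: "x \<in> X" and y: "y \<in> X" and g: "g \<in> vsupp n"
  shows "\<epsilon> (b x y) g = \<epsilon> x (\<epsilon> y g) - \<epsilon> y (\<epsilon> x g)"
proof -
  let ?d = "\<lambda>g. \<epsilon> x (\<epsilon> y g) - \<epsilon> y (\<epsilon> x g)"
  have l: "linear_on UNIV ?d"
    by (intro linear_onI) (simp_all add: lin_add[OF ext_linear] lin_smult[OF ext_linear] smult_distrib)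
  have e: "\<epsilon> (b x y) (unitv j) = ?d (unitv j)" if "j < n" for j
  proof -
    have "\<epsilon> (b x y) (unitv j) = E (\<rho> (b x y) (unitv j))"
      using ext_E[of "b x y" "unitv j"] that x y by (simp add: E_unitv)
    also have "\<dots> = E (\<rho> x (\<rho> y (unitv j))) - E (\<rho> y (\<rho> x (unitv j)))"
      using that x y by (simp add: W.act_brk E_linear)
    also have "\<dots> = ?d (E (unitv j))" using that x y by (simp add: ext_E)
    finally show ?thesis by (simp add: E_unitv)
  qed
  have u: "subsp (UNIV :: 'k vec set)" by (simp add: subsp_def)
  have "\<epsilon> (b x y) g = (\<Sum>j<n. smult (g j) (\<epsilon> (b x y) (unitv j)))"
    by (subst vsupp_expand[OF g]) (simp add: lin_sum[OF ext_linear u] lin_smult[OF ext_linear])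
  also have "\<dots> = (\<Sum>j<n. smult (g j) (?d (unitv j)))" using e by (intro sum.cong) auto
  also have "\<dots> = (\<Sum>j<n. ?d (smult (g j) (unitv j)))"
    by (intro sum.cong refl lin_smult[OF l, symmetric]) simp
  also have "\<dots> = ?d (\<Sum>j<n. smult (g j) (unitv j))" by (rule lin_sum[OF l u, symmetric]) simp
  also have "\<dots> = ?d g" by (rule arg_cong[OF vsupp_expand[OF g, symmetric], of ?d])
  finally show ?thesis .
qed

sublocale K: lrep_p X b "vsupp n" \<epsilon> p pm
proof unfold_locales
  show "prime p" "CHAR('k) = p" by (fact p(1), fact char_k)
  show "pm x \<in> X" if "x \<in> X" for x by (rule pm_in[OF that])
  show "b (pm x) y = (b x ^^ p) y" if "x \<in> X" "y \<in> X" for x y by (rule pm_brk[OF that])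
  show "\<epsilon> (b x y) v = \<epsilon> x (\<epsilon> y v) - \<epsilon> y (\<epsilon> x v)" if "x \<in> X" "y \<in> X" "v \<in> vsupp n" for x y v
    by (rule ext_brk[OF that])
  show "linear_on (vsupp n) (\<epsilon> x)" for x by (rule linear_on_subset[OF ext_linear]) simp
qed (simp_all add: ext_in)

sublocale L: lrep_p X b "vsupp n" \<rho> p pm
  by (rule gmod_lrep[OF W.gm])

lemma zeta_E: assumes x: "x \<in> X" and v: "v \<in> vsupp n" shows "zeta p pm \<epsilon> x (E v) = E (zeta p pm \<rho> x v)"
proof -
  have "(\<epsilon> x ^^ k) (E v) = E ((\<rho> x ^^ k) v)" for k
    using x v by (induction k) (simp_all add: ext_E)
  then show ?thesis using x v by (simp add: zeta_def ext_E E_linear)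
qed

lemma ext_series_exists: obtains Ns where "comp_series X \<epsilon> (vsupp n) Ns"
  by (rule comp_series_exists[OF subset_refl, of X \<epsilon> n]) (auto simp: submod_def ext_in that)

lemma ext_zero: assumes "v \<in> vsupp n" shows "\<epsilon> 0 v = 0"
  using K.rbrk[of 0 0 v] assms by simp

text \<open>\<open>zeta\<close> commutes with the action, so Schur's lemma makes it a scalar on the
  factor, and the closure contains a \<open>p\<close>-th root of that scalar. The value 0 outside
  \<open>X\<close> is the normalisation used in \<open>char_cluster\<close>.\<close>

lemma character_exists:
  assumes Ns: "comp_series X \<epsilon> (vsupp n) Ns" and i: "Suc i < length Ns"
  obtains \<chi> where "\<And>x. x \<notin> X \<Longrightarrow> \<chi> x = 0" "has_character p X pm \<epsilon> (Ns ! i) (Ns ! Suc i) \<chi>"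
proof -
  have sub: "submod X \<epsilon> (vsupp n) (Ns ! j)" if "j < length Ns" for j using comp_series_submod[OF Ns that] .
  have zs: "zeta p pm \<epsilon> x v \<in> Ns ! j" if "j < length Ns" "x \<in> X" "v \<in> Ns ! j" for j x v
  proof -
    have N: "subsp (Ns ! j)" "\<And>x v. x \<in> X \<Longrightarrow> v \<in> Ns ! j \<Longrightarrow> \<epsilon> x v \<in> Ns ! j"
      using sub[OF that(1)] by (auto simp: submod_def)
    have "(\<epsilon> x ^^ k) v \<in> Ns ! j" for k using that N by (induction k) auto
    then show ?thesis using that N by (simp add: zeta_def subsp_diff)
  qed
  have "\<exists>y. \<forall>v\<in>Ns ! Suc i. zeta p pm \<epsilon> x v - smult (y ^ p) v \<in> Ns ! i" if x: "x \<in> X" for x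
  proof -
    obtain c where c: "\<And>v. v \<in> Ns ! Suc i \<Longrightarrow> zeta p pm \<epsilon> x v - smult c v \<in> Ns ! i"
    proof (rule K.schur[OF closed refl Ns i, of "zeta p pm \<epsilon> x"])
      show "zeta p pm \<epsilon> x ` (Ns ! i) \<subseteq> Ns ! i" "zeta p pm \<epsilon> x ` (Ns ! Suc i) \<subseteq> Ns ! Suc i" using zs i x by auto
    qed (use x K.zeta_linear K.zeta_commute in auto)
    have p0: "p > 0" using p by (simp add: prime_gt_0_nat)
    have "degree (monom 1 p + [:- c:]) = p" using p0 by (subst degree_add_eq_left) (auto simp: degree_monom_eq)
    then obtain y where "poly (monom 1 p + [:- c:]) y = 0" using closed[of "monom 1 p + [:- c:]"] p0 by auto
    then have "y ^ p = c" by (simp add: poly_monom)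
    then show ?thesis using c by blast
  qed
  then obtain y where y: "\<And>x v. x \<in> X \<Longrightarrow> v \<in> Ns ! Suc i \<Longrightarrow> zeta p pm \<epsilon> x v - smult (y x ^ p) v \<in> Ns ! i"
    by metis
  show ?thesis
    by (rule that[of "\<lambda>x. if x \<in> X then y x else 0"]) (use y in \<open>auto simp: has_character_def zeta_def\<close>)
qed

text \<open>By Schur's lemma \<open>z\<close> acts on the factor as a scalar \<open>c\<close>. Since
  \<open>pm z = 0\<close>, the character condition reads \<open>c^p = \<chi>(z)^p\<close>, and the
  Frobenius map is injective.\<close>

lemma character_central:
  assumes Ns: "comp_series X \<epsilon> (vsupp n) Ns" and i: "Suc i < length Ns"
    and \<chi>: "has_character p X pm \<epsilon> (Ns ! i) (Ns ! Suc i) \<chi>" and z: "z \<in> centre X b" and v: "v \<in> Ns ! Suc i"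
  shows "\<epsilon> z v - smult (\<chi> z) v \<in> Ns ! i"
proof -
  let ?N = "Ns ! i" and ?N' = "Ns ! Suc i"
  have "submod X \<epsilon> (vsupp n) ?N" "submod X \<epsilon> (vsupp n) ?N'" using comp_series_submod[OF Ns] i by auto
  then have N: "subsp ?N" "?N \<subseteq> vsupp n" "\<And>x v. x \<in> X \<Longrightarrow> v \<in> ?N \<Longrightarrow> \<epsilon> x v \<in> ?N"
    and N': "subsp ?N'" "?N' \<subseteq> vsupp n" "\<And>x v. x \<in> X \<Longrightarrow> v \<in> ?N' \<Longrightarrow> \<epsilon> x v \<in> ?N'"
    by (auto simp: submod_def)
  have zX: "z \<in> X" and zb: "\<And>y. y \<in> X \<Longrightarrow> b z y = 0" using z by (auto simp: centre_def)
  obtain c where c: "\<And>v. v \<in> ?N' \<Longrightarrow> \<epsilon> z v - smult c v \<in> ?N"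
  proof (rule K.schur[OF closed refl Ns i, of "\<epsilon> z"])
    show "\<epsilon> z (\<epsilon> x v) = \<epsilon> x (\<epsilon> z v)" if "x \<in> X" "v \<in> vsupp n" for x v
      using K.rbrk[OF zX that(1,2)] zb[OF that(1)] ext_zero[OF that(2)] by simp
  qed (use zX N N' K.rlin in \<open>auto simp: ext_in\<close>)
  have pw: "(\<epsilon> z ^^ k) u - smult (c ^ k) u \<in> ?N" if "u \<in> ?N'" for u k
  proof (induction k)
    case 0
    then show ?case using N by simp
  next
    case (Suc k)
    have ku: "(\<epsilon> z ^^ k) u \<in> ?N'" using that N' zX by (induction k) auto
    have eq: "(\<epsilon> z ^^ Suc k) u - smult (c ^ Suc k) u =
        (\<epsilon> z ((\<epsilon> z ^^ k) u) - smult c ((\<epsilon> z ^^ k) u)) + smult c ((\<epsilon> z ^^ k) u - smult (c ^ k) u)"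
      by (simp add: smult_distrib)
    show ?case unfolding eq by (intro subsp_add[OF N(1)] subsp_smult[OF N(1)] c[OF ku] Suc)
  qed
  have "?N \<subset> ?N'" using Ns i by (simp add: comp_series_def)
  then obtain u where u: "u \<in> ?N'" "u \<notin> ?N" by blast
  have "(\<epsilon> z ^^ p) u - \<epsilon> (pm z) u - smult (\<chi> z ^ p) u \<in> ?N" using \<chi> zX u by (simp add: has_character_def)
  moreover have "\<epsilon> (pm z) u = 0" using zp z ext_zero u N' by auto
  ultimately have A: "(\<epsilon> z ^^ p) u - smult (\<chi> z ^ p) u \<in> ?N" by simp
  have "((\<epsilon> z ^^ p) u - smult (\<chi> z ^ p) u) - ((\<epsilon> z ^^ p) u - smult (c ^ p) u) \<in> ?N"
    by (rule subsp_diff[OF N(1) A pw[OF u(1)]])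
  then have "smult (c ^ p - \<chi> z ^ p) u \<in> ?N" by (simp add: smult_distrib)
  then have "c ^ p - \<chi> z ^ p = 0"
    using subsp_smult[OF N(1), of "smult (c ^ p - \<chi> z ^ p) u" "inverse (c ^ p - \<chi> z ^ p)"] u
    by (cases "c ^ p - \<chi> z ^ p = 0") auto
  moreover have "c ^ p = (c - \<chi> z) ^ p + \<chi> z ^ p" using frob[of "c - \<chi> z" "\<chi> z"] by simp
  ultimately have "c = \<chi> z" using p by (simp add: prime_gt_0_nat)
  then show ?thesis using c[OF v] by simp
qed

text \<open>Take \<open>u\<close> in the upper term and a functional \<open>\<xi>\<close> that
  vanishes on the lower term but not at \<open>u\<close>; the word function \<open>\<xi>\<close> of
  \<open>w\<close> applied to \<open>u\<close> has the character of the factor. Its data lie over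
  the closure, but expanding \<open>u\<close> in unit vectors exhibits it as a finite sum of
  coefficients of \<open>\<rho>\<close> over the ground field.\<close>

lemma coef_character:
  assumes H: "HH (vsupp n) \<rho>" and \<chi>: "\<chi> \<in> char_cluster p emb X pm n \<rho>"
  shows "\<exists>\<Psi>. coef \<Psi> \<and> eig \<Psi> \<chi> \<and> \<Psi> [] \<noteq> 0"
proof -
  obtain Ns i where Ns: "comp_series X \<epsilon> (vsupp n) Ns" "Suc i < length Ns"
    and ch: "has_character p X pm \<epsilon> (Ns ! i) (Ns ! Suc i) \<chi>"
    using \<chi> by (auto simp: char_cluster_def)
  let ?N = "Ns ! i" and ?N' = "Ns ! Suc i"
  have "submod X \<epsilon> (vsupp n) ?N" "submod X \<epsilon> (vsupp n) ?N'" using comp_series_submod[OF Ns(1)] Ns(2) by auto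
  then have N: "subsp ?N" "?N \<subseteq> vsupp n" "\<And>x v. x \<in> X \<Longrightarrow> v \<in> ?N \<Longrightarrow> \<epsilon> x v \<in> ?N" and N': "?N' \<subseteq> vsupp n"
    by (auto simp: submod_def)
  have "?N \<subset> ?N'" using Ns by (simp add: comp_series_def)
  then obtain u where u: "u \<in> ?N'" "u \<notin> ?N" by blast
  have un: "u \<in> vsupp n" using u N' by blast
  obtain f where f: "linear_on UNIV f" "\<And>x. f x - x \<in> ?N" "\<And>x. x \<in> ?N \<Longrightarrow> f x = 0"
    using ex_projection[OF N(1)] by blast
  have "f u \<noteq> 0" using f(2)[of u] u subsp_minus[OF N(1), of "- u"] by auto
  then obtain j where j: "f u j \<noteq> 0" by (metis ext zero_fun_apply)
  define \<xi> where "\<xi> y = f y j" for y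
  have \<xi>: "\<xi> (x + y) = \<xi> x + \<xi> y" "\<xi> (smult c x) = c * \<xi> x" "\<xi> (x - y) = \<xi> x - \<xi> y" for x y c
    using lin_add[OF f(1)] lin_smult[OF f(1)] lin_diff[OF f(1), of x y]
    by (simp_all add: \<xi>_def pointwise subsp_def)
  have \<xi>N: "\<xi> x = 0" if "x \<in> ?N" for x using f(3)[OF that] by (simp add: \<xi>_def pointwise)
  have \<xi>0: "\<xi> 0 = 0" using \<xi>(2)[of 0 0] by simp
  have \<xi>s: "\<xi> (\<Sum>i\<in>I. h i) = (\<Sum>i\<in>I. \<xi> (h i))" for I :: "nat set" and h
    by (induction I rule: infinite_finite_induct) (simp_all add: \<xi> \<xi>0)
  define \<Psi> where "\<Psi> w = \<xi> (fold \<epsilon> w u)" for w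
  have foldN: "fold \<epsilon> w y \<in> ?N" if "w \<in> lists X" "y \<in> ?N" for w y
    using that N by (induction w arbitrary: y) auto
  have "\<Psi> [] \<noteq> 0" using j by (simp add: \<Psi>_def \<xi>_def)
  moreover have "eig \<Psi> \<chi>"
    unfolding eig_def
  proof (intro conjI ballI)
    fix x w assume x: "x \<in> X" and w: "w \<in> lists X"
    have rep: "fold \<epsilon> (replicate k x) y = (\<epsilon> x ^^ k) y" for k y
      by (induction k arbitrary: y) (simp_all add: funpow_Suc_right del: funpow.simps)
    note l = K.fold_linear[OF w]
    define y where "y = (\<epsilon> x ^^ p) u - \<epsilon> (pm x) u - smult (\<chi> x ^ p) u"
    have y: "y \<in> ?N" using ch x u by (simp add: y_def has_character_def)
    have "(\<epsilon> x ^^ p) u = y + \<epsilon> (pm x) u + smult (\<chi> x ^ p) u" by (simp add: y_def)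
    then have "fold \<epsilon> w ((\<epsilon> x ^^ p) u) = fold \<epsilon> w y + fold \<epsilon> w (\<epsilon> (pm x) u) + smult (\<chi> x ^ p) (fold \<epsilon> w u)"
      using y N un x by (simp add: lin_add[OF l] lin_smult[OF l] subsp_add subsp_smult ext_in subset_iff)
    then show "\<Psi> (replicate p x @ w) - \<Psi> (pm x # w) = \<chi> x ^ p * \<Psi> w"
      using \<xi>N[OF foldN[OF w y]] by (simp add: \<Psi>_def rep \<xi>)
  next
    fix z w assume z: "z \<in> centre X b" and w: "w \<in> lists X"
    note l = K.fold_linear[OF w]
    define y where "y = \<epsilon> z u - smult (\<chi> z) u"
    have y: "y \<in> ?N" using character_central[OF Ns ch z u(1)] by (simp add: y_def)
    have "\<epsilon> z u = y + smult (\<chi> z) u" by (simp add: y_def)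
    then have "fold \<epsilon> w (\<epsilon> z u) = fold \<epsilon> w y + smult (\<chi> z) (fold \<epsilon> w u)"
      using y N un by (simp add: lin_add[OF l] lin_smult[OF l] subsp_smult subset_iff)
    then show "\<Psi> (z # w) = \<chi> z * \<Psi> w"
      using \<xi>N[OF foldN[OF w y]] by (simp add: \<Psi>_def \<xi>)
  qed
  moreover have "coef \<Psi>"
  proof -
    have LMW: "LM (vsupp n) \<rho>" using H W.gm by (simp add: LM_def)
    have cK: "cfun emb (\<lambda>y. \<Sum>i\<in>I. c i * emb (y i))" if "finite I" for I :: "nat set" and c
      using that
      by (induction I rule: finite_induct) (auto simp: cfun_0 intro: cfun_add cfun_coord)
    have foldE: "fold \<epsilon> w (E v) = E (fold \<rho> w v)" if "w \<in> lists X" "v \<in> vsupp n" for w v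
      using that by (induction w arbitrary: v) (simp_all add: ext_E)
    have "\<Psi> w = (\<Sum>k<n. \<Sum>i<n. (u k * \<xi> (unitv i)) * emb (fold \<rho> w (unitv k) i))" if w: "w \<in> lists X" for w
    proof -
      note l = K.fold_linear[OF w]
      have "fold \<epsilon> w u = (\<Sum>k<n. fold \<epsilon> w (smult (u k) (unitv k)))"
        by (subst vsupp_expand[OF un]) (rule lin_sum[OF l], auto intro: subsp_smult)
      also have "\<dots> = (\<Sum>k<n. smult (u k) (fold \<epsilon> w (unitv k)))"
        by (intro sum.cong refl lin_smult[OF l]) auto
      also have "\<dots> = (\<Sum>k<n. smult (u k) (E (fold \<rho> w (unitv k))))"
      proof (intro sum.cong refl)
        fix k assume "k \<in> {..<n}"
        then have "unitv k \<in> (vsupp n :: 'a vec set)" by simp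
        from foldE[OF w this] show "smult (u k) (fold \<epsilon> w (unitv k)) = smult (u k) (E (fold \<rho> w (unitv k)))"
          by (simp add: E_unitv)
      qed
      finally have "\<Psi> w = (\<Sum>k<n. u k * \<xi> (E (fold \<rho> w (unitv k))))" by (simp add: \<Psi>_def \<xi>s \<xi>)
      also have "\<dots> = (\<Sum>k<n. u k * (\<Sum>i<n. emb (fold \<rho> w (unitv k) i) * \<xi> (unitv i)))"
      proof (intro sum.cong refl)
        fix k assume "k \<in> {..<n}"
        then have "E (fold \<rho> w (unitv k)) \<in> vsupp n" using L.fold_in[OF w, of "unitv k"] by (intro E_vsupp) auto
        from vsupp_expand[OF this] have "\<xi> (E (fold \<rho> w (unitv k))) = \<xi> (\<Sum>i<n. smult (emb (fold \<rho> w (unitv k) i)) (unitv i))"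
          by (simp add: E_apply)
        then show "u k * \<xi> (E (fold \<rho> w (unitv k))) = u k * (\<Sum>i<n. emb (fold \<rho> w (unitv k) i) * \<xi> (unitv i))"
          by (simp add: \<xi>s \<xi>)
      qed
      finally show ?thesis by (simp add: sum_distrib_left mult_ac)
    qed
    moreover have "coef (\<lambda>w. \<Sum>k<n. \<Sum>i<n. (u k * \<xi> (unitv i)) * emb (fold \<rho> w (unitv k) i))"
      by (intro coef_sum coefI[OF LMW _ cK]) auto
    ultimately show ?thesis by (rule coef_cong)
  qed
  ultimately show ?thesis by blast
qed

end

section \<open>Characters attained by coefficients\<close>

context main
begin

text \<open>Values at the empty word multiply under shuffling, so the condition there survives
  products; in \<open>dual_word_eval\<close> this value is the factor that must not vanish.\<close>

definition attained :: "('a vec \<Rightarrow> 'k) \<Rightarrow> bool" where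
  "attained \<chi> \<longleftrightarrow> (\<exists>\<Psi>. coef \<Psi> \<and> eig \<Psi> \<chi> \<and> \<Psi> [] \<noteq> 0)"

lemma attained_add: "attained \<chi> \<Longrightarrow> attained \<psi> \<Longrightarrow> attained (\<lambda>x. \<chi> x + \<psi> x)"
proof -
  assume "attained \<chi>" "attained \<psi>"
  then obtain \<Phi> \<Psi> where "coef \<Phi>" "eig \<Phi> \<chi>" "\<Phi> [] \<noteq> 0" "coef \<Psi>" "eig \<Psi> \<psi>" "\<Psi> [] \<noteq> 0"
    unfolding attained_def by (elim exE conjE) (rule that)
  then show ?thesis unfolding attained_def by (intro exI[of _ "shuf \<Phi> \<Psi>"] conjI coef_shuf eig_shuf) auto
qed

lemma attained_zero: "attained (\<lambda>_. 0)"
proof -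
  have "p > 0" using p by (simp add: prime_gt_0_nat)
  then have "eig (\<lambda>w. if w = [] then 1 else 0) (\<lambda>_. 0)" by (auto simp: eig_def)
  then show ?thesis unfolding attained_def
    by (intro exI[of _ "\<lambda>w. if w = [] then 1 else 0"] conjI coef_empty_word) simp_all
qed

lemma attained_Fp_span:
  assumes A: "\<And>\<chi>. \<chi> \<in> A \<Longrightarrow> attained \<chi>" and \<chi>: "\<chi> \<in> Fp_span A" shows "attained \<chi>"
proof -
  obtain B k where B: "finite B" "B \<subseteq> A" "\<chi> = (\<lambda>x. \<Sum>\<psi>\<in>B. of_nat (k \<psi>) * \<psi> x)"
    using \<chi> by (auto simp: Fp_span_def)
  have m: "attained (\<lambda>x. of_nat m * \<psi> x)" if "attained \<psi>" for m \<psi>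
  proof (induction m)
    case (Suc m)
    then show ?case using attained_add[OF that Suc] by (simp add: algebra_simps)
  qed (simp add: attained_zero)
  have "attained (\<lambda>x. \<Sum>\<psi>\<in>B. of_nat (k \<psi>) * \<psi> x)"
    using B(1,2)
  proof (induction B rule: finite_induct)
    case (insert \<psi> B)
    then show ?case using attained_add[OF m[OF A, of \<psi> "k \<psi>"]] by simp
  qed (simp add: attained_zero)
  then show ?thesis using B(3) by simp
qed

end

section \<open>Irreducible factors with attained characters\<close>

lemma sum_list_group:
  fixes f :: "'t \<Rightarrow> 'm::comm_monoid_add"
  assumes "finite A" "k ` set ts \<subseteq> A"
  shows "(\<Sum>t\<leftarrow>ts. f t) = (\<Sum>a\<in>A. \<Sum>t\<leftarrow>filter (\<lambda>t. k t = a) ts. f t)"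
  using assms(2)
proof (induction ts)
  case (Cons t ts)
  have "(\<Sum>a\<in>A. \<Sum>t\<leftarrow>filter (\<lambda>t. k t = a) (t # ts). f t)
      = (\<Sum>a\<in>A. (if k t = a then f t else 0) + (\<Sum>t\<leftarrow>filter (\<lambda>t. k t = a) ts. f t))"
    by (intro sum.cong refl) simp
  also have "\<dots> = (\<Sum>a\<in>A. if k t = a then f t else 0) + (\<Sum>a\<in>A. \<Sum>t\<leftarrow>filter (\<lambda>t. k t = a) ts. f t)"
    by (rule sum.distrib)
  also have "(\<Sum>a\<in>A. if k t = a then f t else 0) = f t"
    using Cons.prems assms(1) by simp
  finally show ?case using Cons by simp
qed simp

context pbw
begin

text \<open>The scalar by which a central generator acts on a factor with character
  \<open>\<chi>\<close>; the exponent \<open>p\<close> reflects that \<open>zeta\<close> has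
  eigenvalue \<open>\<chi>^p\<close>.\<close>

definition cval :: "('a vec \<Rightarrow> 'k) \<Rightarrow> nat + 'a vec \<Rightarrow> 'k" where
  "cval \<chi> g = (case g of Inl i \<Rightarrow> \<chi> (e i) ^ p | Inr z \<Rightarrow> \<chi> z)"

definition monomial_coeff :: "('a vec \<Rightarrow> 'k) \<Rightarrow> ('a \<times> (nat + 'a vec) list \<times> nat list) list \<Rightarrow> nat list \<Rightarrow> 'k" where
  "monomial_coeff \<chi> ts a = (\<Sum>(c, G, a')\<leftarrow>filter (\<lambda>t. snd (snd t) = a) ts. emb c * prod_list (map (cval \<chi>) G))"

text \<open>Central generators act on \<open>m\<close> before the monomial does. Peeling them off
  from the right turns the last one into a prefix of the word, where \<open>eig\<close> evaluates
  it.\<close>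

lemma coef_tev:
  assumes gm: "gmod X b U \<rho>" and m: "m \<in> U" and K: "cfun emb K" "\<And>w. w \<in> lists X \<Longrightarrow> \<Psi> w = K (fold \<rho> w m)"
    and eig: "eig \<Psi> \<chi>" and G: "G \<in> lists central" and a: "set a \<subseteq> {..<r}"
  shows "K (tev \<rho> (c, G, a) m) = emb c * prod_list (map (cval \<chi>) G) * \<Psi> (map e a)"
proof -
  interpret pbw_mod FF S X b emb p pm r e lam U \<rho> by (rule pbw_modI[OF gm])
  have Klin: "K (x + y) = K x + K y" "K (smult c x) = emb c * K x" for x y c
    using cfun_linear[OF K(1) emb_add emb_mult] by auto
  have Kdiff: "K (x - y) = K x - K y" for x y
    using Klin(1)[of "x - y" y] by simp
  have "K (fold \<rho> w (fold (cact \<rho>) G m)) = prod_list (map (cval \<chi>) G) * \<Psi> w" if "w \<in> lists X" for w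
    using G that
  proof (induction G arbitrary: w rule: rev_induct)
    case Nil
    then show ?case using K by simp
  next
    case (snoc g G)
    let ?y = "fold (cact \<rho>) G m"
    have G: "G \<in> lists central" and g: "g \<in> central" using snoc.prems by auto
    have y: "?y \<in> U" using cfold_in[OF G m] .
    note w = snoc.prems(2)
    note IH = snoc.IH[OF G]
    have "K (fold \<rho> w (cact \<rho> g ?y)) = prod_list (map (cval \<chi>) G) * (cval \<chi> g * \<Psi> w)"
    proof (cases g)
      case (Inl i)
      then have i: "i < r" using g by (auto simp: central_def)
      have rep: "fold \<rho> (replicate k (e i)) u = (\<rho> (e i) ^^ k) u" for k u
        by (induction k arbitrary: u) (simp_all add: funpow_Suc_right del: funpow.simps)
      have rl: "replicate k (e i) \<in> lists X" for k using i by (induction k) auto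
      have "fold \<rho> w (cact \<rho> g ?y) = fold \<rho> (replicate p (e i) @ w) ?y - fold \<rho> (pm (e i) # w) ?y"
        using lin_diff[OF M.fold_linear[OF w] M.rsub] i y
        by (simp add: Inl cact_def zeta_def rep)
      then have "K (fold \<rho> w (cact \<rho> g ?y)) = prod_list (map (cval \<chi>) G) * \<Psi> (replicate p (e i) @ w) - prod_list (map (cval \<chi>) G) * \<Psi> (pm (e i) # w)"
        using IH[of "replicate p (e i) @ w"] IH[of "pm (e i) # w"] w i rl[of p] by (simp add: Kdiff)
      also have "\<dots> = prod_list (map (cval \<chi>) G) * (\<Psi> (replicate p (e i) @ w) - \<Psi> (pm (e i) # w))"
        by (simp add: right_diff_distrib)
      also have "\<Psi> (replicate p (e i) @ w) - \<Psi> (pm (e i) # w) = cval \<chi> g * \<Psi> w"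
        using eig i w unfolding eig_def by (simp add: Inl cval_def)
      finally show ?thesis .
    next
      case (Inr z)
      then have z: "z \<in> centre X b" using g by (auto simp: central_def)
      have "K (fold \<rho> (z # w) ?y) = prod_list (map (cval \<chi>) G) * \<Psi> (z # w)"
        using IH[of "z # w"] w z centreX by simp
      moreover have "\<Psi> (z # w) = cval \<chi> g * \<Psi> w" using eig z w unfolding eig_def by (simp add: Inr cval_def)
      ultimately show ?thesis by (simp add: Inr cact_def)
    qed
    then show ?case by (simp add: mult_ac)
  qed
  then show ?thesis using a by (simp add: tev_def Klin wact_fold mult_ac)
qed

text \<open>The vanishing sum is evaluated against \<open>dual_word\<close> of \<open>a\<close>.
  Shorter monomials give zero by the order of vanishing, longer ones have zero coefficient by
  induction, and among those of equal length sortedness leaves only \<open>a\<close>, with a nonzero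
  factor.\<close>

lemma monomial_coeff_zero:
  assumes gm: "gmod X b U \<rho>" and m: "m \<in> U"
    and ts: "\<forall>(c, G, a)\<in>set ts. G \<in> lists central \<and> standard a \<and> length a \<le> d"
    and zero: "(\<Sum>t\<leftarrow>ts. tev \<rho> t m) = 0"
    and K: "\<And>a. standard a \<Longrightarrow> \<exists>K. cfun emb K \<and> (\<forall>w\<in>lists X. dual_word \<Psi> a w = K (fold \<rho> w m))"
    and eig: "eig \<Psi> \<chi>" and \<Psi>: "\<Psi> [] \<noteq> 0" and a: "standard a"
  shows "monomial_coeff \<chi> ts a = 0"
  using a
\<comment> \<open>The measure shrinks as monomials get longer; those occurring in \<open>ts\<close>
  have length at most \<open>d\<close>.\<close>
proof (induction "Suc d - length a" arbitrary: a rule: less_induct)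
  case less
  let ?o = "monomial_coeff \<chi> ts"
  let ?A = "(\<lambda>t. snd (snd t)) ` set ts"
  have std: "standard a'" "length a' \<le> d" if "a' \<in> ?A" for a' using that ts by auto
  show ?case
  proof (cases "a \<in> ?A")
    case False
    then have "filter (\<lambda>t. snd (snd t) = a) ts = []" by (auto simp: filter_empty_conv)
    then show ?thesis by (simp add: monomial_coeff_def)
  next
    case True
    have ar: "set a \<subseteq> {..<r}" using less.prems by (simp add: standard_def)
    obtain K where K: "cfun emb K" "\<And>w. w \<in> lists X \<Longrightarrow> dual_word \<Psi> a w = K (fold \<rho> w m)"
      using K[OF less.prems] by blast
    note eig' = dual_word_eig[OF ar eig]
    let ?f = "\<lambda>(c, G, a'). emb c * prod_list (map (cval \<chi>) G)"
    have Kadd: "K (x + y) = K x + K y" for x y using cfun_linear[OF K(1) emb_add emb_mult] by auto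
    have K0: "K 0 = 0" using Kadd[of 0 0] by (simp only: add_0_right add_cancel_right_right)
    have Ksum: "K (\<Sum>t\<leftarrow>us. g t) = (\<Sum>t\<leftarrow>us. K (g t))" for us and g :: "'a \<times> (nat + 'a vec) list \<times> nat list \<Rightarrow> 'a vec"
      by (induction us) (simp_all add: K0 Kadd)
    have "0 = (\<Sum>t\<leftarrow>ts. K (tev \<rho> t m))" using zero K0 Ksum[of "\<lambda>t. tev \<rho> t m" ts] by simp
    also have "\<dots> = (\<Sum>t\<leftarrow>ts. ?f t * dual_word \<Psi> a (map e (snd (snd t))))"
    proof (intro arg_cong[of _ _ sum_list] map_cong refl)
      fix t assume t: "t \<in> set ts"
      obtain c G a' where [simp]: "t = (c, G, a')" by (cases t)
      have "G \<in> lists central" "set a' \<subseteq> {..<r}" using t ts by (auto simp: standard_def)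
      then show "K (tev \<rho> t m) = ?f t * dual_word \<Psi> a (map e (snd (snd t)))"
        using coef_tev[OF gm m K eig'] by simp
    qed
    also have "\<dots> = (\<Sum>a'\<in>?A. \<Sum>t\<leftarrow>filter (\<lambda>t. snd (snd t) = a') ts. ?f t * dual_word \<Psi> a (map e (snd (snd t))))"
      by (rule sum_list_group) auto
    also have "\<dots> = (\<Sum>a'\<in>?A. ?o a' * dual_word \<Psi> a (map e a'))"
    proof (intro sum.cong refl)
      fix a'
      have "(\<Sum>t\<leftarrow>filter (\<lambda>t. snd (snd t) = a') ts. ?f t * dual_word \<Psi> a (map e (snd (snd t))))
          = (\<Sum>t\<leftarrow>filter (\<lambda>t. snd (snd t) = a') ts. ?f t * dual_word \<Psi> a (map e a'))"
        by (intro arg_cong[of _ _ sum_list] map_cong refl) auto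
      also have "\<dots> = ?o a' * dual_word \<Psi> a (map e a')"
        unfolding monomial_coeff_def by (rule sum_list_mult_const)
      finally show "(\<Sum>t\<leftarrow>filter (\<lambda>t. snd (snd t) = a') ts. ?f t * dual_word \<Psi> a (map e (snd (snd t)))) = ?o a' * dual_word \<Psi> a (map e a')" .
    qed
    also have "\<dots> = (\<Sum>a'\<in>?A. if a' = a then ?o a * (dual_const a * \<Psi> []) else 0)"
    proof (intro sum.cong refl)
      fix a' assume a': "a' \<in> ?A"
      have a'r: "set a' \<subseteq> {..<r}" using std[OF a'] by (simp add: standard_def)
      consider "length a' < length a" | "length a' > length a" | "length a' = length a" by linarith
      then show "?o a' * dual_word \<Psi> a (map e a') = (if a' = a then ?o a * (dual_const a * \<Psi> []) else 0)"
      proof cases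
        case 1
        then have "dual_word \<Psi> a (map e a') = 0" using a'r by (intro dual_word_order[OF ar]) auto
        then show ?thesis using 1 by auto
      next
        case 2
        then have "?o a' = 0" using std[OF a'] by (intro less.hyps) auto
        then show ?thesis using 2 by auto
      next
        case 3
        have "dual_word \<Psi> a (map e a') = (if mset a' = mset a then dual_const a * \<Psi> [] else 0)"
          by (rule dual_word_eval[OF ar a'r 3])
        moreover have "mset a' = mset a \<longleftrightarrow> a' = a"
          using std[OF a'] less.prems by (metis standard_def sorted_sort_id properties_for_sort)
        ultimately show ?thesis by simp
      qed
    qed
    also have "\<dots> = ?o a * (dual_const a * \<Psi> [])" using True by (simp add: sum.delta)
    finally have "?o a * (dual_const a * \<Psi> []) = 0" by simp
    moreover have "dual_const a \<noteq> 0" using less.prems by (intro dual_const_nonzero) (simp add: standard_def)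
    ultimately show ?thesis using \<Psi> by simp
  qed
qed

end

section \<open>Central coefficients as operators on a module\<close>

locale pbw_main_mod = pbw FF S X b emb p pm r e lam + main_mod FF S X b emb p pm n \<rho>
  for FF :: "('a::field) lie_class" and S X b and emb :: "'a \<Rightarrow> 'k::field" and p pm r e lam n \<rho>
begin

sublocale P: pbw_mod FF S X b emb p pm r e lam "vsupp n" \<rho>
  by (rule pbw_modI[OF W.gm])

definition kact :: "nat + 'a vec \<Rightarrow> 'k vec \<Rightarrow> 'k vec" where
  "kact g = (case g of Inl i \<Rightarrow> zeta p pm \<epsilon> (e i) | Inr z \<Rightarrow> \<epsilon> z)"

text \<open>The operator on the module of the central coefficient that \<open>ts\<close> attaches to
  the monomial \<open>a\<close>; \<open>monomial_coeff\<close> is the value of the same coefficient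
  at a character.\<close>

definition oact :: "('a \<times> (nat + 'a vec) list \<times> nat list) list \<Rightarrow> nat list \<Rightarrow> 'a vec \<Rightarrow> 'a vec" where
  "oact ts a v = (\<Sum>(c, G, a')\<leftarrow>filter (\<lambda>t. snd (snd t) = a) ts. smult c (fold (cact \<rho>) G v))"

definition okact :: "('a \<times> (nat + 'a vec) list \<times> nat list) list \<Rightarrow> nat list \<Rightarrow> 'k vec \<Rightarrow> 'k vec" where
  "okact ts a v = (\<Sum>(c, G, a')\<leftarrow>filter (\<lambda>t. snd (snd t) = a) ts. smult (emb c) (fold kact G v))"

lemma kact_E: "g \<in> central \<Longrightarrow> v \<in> vsupp n \<Longrightarrow> kact g (E v) = E (cact \<rho> g v)"
  by (auto simp: central_def kact_def cact_def zeta_E ext_E centreX)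

lemma fold_kact_E: "G \<in> lists central \<Longrightarrow> v \<in> vsupp n \<Longrightarrow> fold kact G (E v) = E (fold (cact \<rho>) G v)"
  by (induction G arbitrary: v) (simp_all add: kact_E)

lemma okact_E:
  assumes "\<forall>(c, G, a)\<in>set ts. G \<in> lists central" "v \<in> vsupp n" shows "okact ts a (E v) = E (oact ts a v)"
  using assms(1)
proof (induction ts)
  case (Cons t ts)
  obtain c G a' where [simp]: "t = (c, G, a')" by (cases t)
  show ?case using Cons fold_kact_E[of G v] assms(2) by (simp add: okact_def oact_def E_linear)
qed (simp add: okact_def oact_def E_linear)

lemma oact_in: 
  assumes "\<forall>(c, G, a)\<in>set ts. G \<in> lists central" "subsp N" "\<And>g v. g \<in> central \<Longrightarrow> v \<in> N \<Longrightarrow> cact \<rho> g v \<in> N" "v \<in> N"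
  shows "oact ts a v \<in> N"
  using assms(1)
proof (induction ts)
  case (Cons t ts)
  obtain c G a' where [simp]: "t = (c, G, a')" by (cases t)
  have "fold (cact \<rho>) G u \<in> N" if "G \<in> lists central" "u \<in> N" for G u
    using that assms(3) by (induction G arbitrary: u) auto
  then have "smult c (fold (cact \<rho>) G v) \<in> N" using Cons.prems assms by (auto intro: subsp_smult)
  then show ?case using Cons assms(2) by (simp add: oact_def subsp_add)
qed (simp add: oact_def assms)

lemma oact_linear:
  assumes "\<forall>(c, G, a)\<in>set ts. G \<in> lists central" shows "linear_on (vsupp n) (oact ts a)"
  using assms
proof (induction ts)
  case (Cons t ts)
  obtain c G a' where t [simp]: "t = (c, G, a')" by (cases t)
  have l: "linear_on (vsupp n) (fold (cact \<rho>) G)" using Cons.prems P.cfold_linear by simp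
  have 1: "linear_on (vsupp n) (\<lambda>v. smult c (fold (cact \<rho>) G v) + oact ts a v)"
    using Cons l by (intro linear_onI) (simp_all add: lin_add lin_smult smult_distrib algebra_simps)
  have "oact (t # ts) a = (if a' = a then (\<lambda>v. smult c (fold (cact \<rho>) G v) + oact ts a v) else oact ts a)"
    by (auto simp: oact_def fun_eq_iff)
  then show ?case using 1 Cons by auto
qed (auto simp: oact_def linear_on_def)

lemma oact_commute:
  assumes "\<forall>(c, G, a)\<in>set ts. G \<in> lists central" "x \<in> X" "v \<in> vsupp n"
  shows "oact ts a (\<rho> x v) = \<rho> x (oact ts a v)"
  using assms(1)
proof (induction ts)
  case (Cons t ts)
  obtain c G a' where t [simp]: "t = (c, G, a')" by (cases t)
  have G: "G \<in> lists central" "\<forall>(c, G, a)\<in>set ts. G \<in> lists central" using Cons.prems by auto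
  have o: "oact ts a v \<in> vsupp n" by (rule oact_in[OF G(2)]) (use assms P.cact_in in auto)
  have f: "fold (cact \<rho>) G v \<in> vsupp n" using P.cfold_in[OF G(1) assms(3)] .
  have "oact (t # ts) a u = (if a' = a then smult c (fold (cact \<rho>) G u) + oact ts a u else oact ts a u)" for u
    by (simp add: oact_def)
  then show ?case using Cons.IH[OF G(2)] P.cfold_commute[OF G(1) assms(2,3)] assms(2) o f
    by (simp add: W.act_add W.act_smult subsp_smult)
qed (simp add: oact_def assms)

text \<open>After extension of scalars the operator acts on each composition factor by the value of
  the coefficient at the character, which is zero; so it lowers the series by one term at each
  application. The conclusion descends because \<open>E\<close> is injective.\<close>

lemma oact_nilpotent:
  assumes Ns: "comp_series X \<epsilon> (vsupp n) Ns"
    and ch: "\<And>i. Suc i < length Ns \<Longrightarrow> has_character p X pm \<epsilon> (Ns ! i) (Ns ! Suc i) (\<chi> i)"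
    and ts: "\<forall>(c, G, a)\<in>set ts. G \<in> lists central"
    and zero: "\<And>i. Suc i < length Ns \<Longrightarrow> monomial_coeff (\<chi> i) ts a = 0"
    and v: "v \<in> vsupp n"
  shows "(oact ts a ^^ (length Ns - 1)) v = 0"
proof -
  have cs: "Ns \<noteq> []" "hd Ns = {0}" "last Ns = vsupp n" using Ns by (auto simp: comp_series_def)
  have N: "subsp (Ns ! j)" "Ns ! j \<subseteq> vsupp n" "\<And>x v. x \<in> X \<Longrightarrow> v \<in> Ns ! j \<Longrightarrow> \<epsilon> x v \<in> Ns ! j" if "j < length Ns" for j
    using comp_series_submod[OF Ns that] by (auto simp: submod_def)
  have k_in: "kact g u \<in> Ns ! j" if "j < length Ns" "g \<in> central" "u \<in> Ns ! j" for j g u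
  proof -
    have "(\<epsilon> x ^^ k) u \<in> Ns ! j" if "x \<in> X" for x k using that N(3)[OF \<open>j < length Ns\<close>] \<open>u \<in> Ns ! j\<close> by (induction k) auto
    then show ?thesis using that N[OF that(1)] centreX
      by (auto simp: central_def kact_def zeta_def intro!: subsp_diff[OF N(1)[OF that(1)]])
  qed
  have step: "okact ts a u \<in> Ns ! i" if i: "Suc i < length Ns" and u: "u \<in> Ns ! Suc i" for i u
  proof -
    have i': "i < length Ns" using i by simp
    note Ni = N[OF i'] and Nj = N[OF i]
    have one: "kact g w - smult (cval (\<chi> i) g) w \<in> Ns ! i" if "g \<in> central" "w \<in> Ns ! Suc i" for g w
      using that ch[OF i] character_central[OF Ns i ch[OF i]]
      by (auto simp: central_def kact_def cval_def has_character_def zeta_def)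
    have fk: "fold kact G w - smult (prod_list (map (cval (\<chi> i)) G)) w \<in> Ns ! i" if "G \<in> lists central" "w \<in> Ns ! Suc i" for G w
      using that
    proof (induction G arbitrary: w)
      case Nil
      then show ?case using Ni by simp
    next
      case (Cons g G)
      have g: "g \<in> central" "G \<in> lists central" using Cons by auto
      let ?y = "kact g w"
      have "fold kact G ?y - smult (prod_list (map (cval (\<chi> i)) G)) ?y \<in> Ns ! i"
        by (rule Cons.IH) (use g Cons.prems k_in[OF i] in auto)
      moreover have "smult (prod_list (map (cval (\<chi> i)) G)) (?y - smult (cval (\<chi> i) g) w) \<in> Ns ! i"
        by (rule subsp_smult[OF Ni(1) one]) (use g Cons.prems in auto)
      ultimately have "(fold kact G ?y - smult (prod_list (map (cval (\<chi> i)) G)) ?y)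
          + smult (prod_list (map (cval (\<chi> i)) G)) (?y - smult (cval (\<chi> i) g) w) \<in> Ns ! i"
        by (rule subsp_add[OF Ni(1)])
      then show ?case by (simp add: smult_distrib mult.commute)
    qed
    have "okact us a u - smult (monomial_coeff (\<chi> i) us a) u \<in> Ns ! i" if "\<forall>(c, G, a)\<in>set us. G \<in> lists central" for us
      using that
    proof (induction us)
      case Nil
      then show ?case using Ni by (simp add: okact_def monomial_coeff_def)
    next
      case (Cons t us)
      obtain c G a' where t [simp]: "t = (c, G, a')" by (cases t)
      have IH: "okact us a u - smult (monomial_coeff (\<chi> i) us a) u \<in> Ns ! i" using Cons by simp
      let ?m = "prod_list (map (cval (\<chi> i)) G)"
      have "smult (emb c) (fold kact G u - smult ?m u) \<in> Ns ! i"
        by (rule subsp_smult[OF Ni(1) fk[OF _ u]]) (use Cons.prems in auto)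
      then have "smult (emb c) (fold kact G u - smult ?m u) + (okact us a u - smult (monomial_coeff (\<chi> i) us a) u) \<in> Ns ! i"
        using IH by (rule subsp_add[OF Ni(1)])
      moreover have eq: "smult (emb c) (fold kact G u - smult ?m u) + (okact us a u - smult (monomial_coeff (\<chi> i) us a) u)
          = (smult (emb c) (fold kact G u) + okact us a u) - smult (emb c * ?m + monomial_coeff (\<chi> i) us a) u"
        by (simp add: smult_distrib)
      ultimately have 1: "(smult (emb c) (fold kact G u) + okact us a u)
          - smult (emb c * ?m + monomial_coeff (\<chi> i) us a) u \<in> Ns ! i" by (simp only:)
      have "okact (t # us) a u = (if a' = a then smult (emb c) (fold kact G u) + okact us a u else okact us a u)"
        "monomial_coeff (\<chi> i) (t # us) a = (if a' = a then emb c * ?m + monomial_coeff (\<chi> i) us a else monomial_coeff (\<chi> i) us a)"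
        by (simp_all add: okact_def monomial_coeff_def)
      then show ?case using 1 IH by (cases "a' = a") simp_all
    qed
    from this[OF ts] show ?thesis using zero[OF i] by simp
  qed
  have pow: "(okact ts a ^^ j) u \<in> Ns ! (length Ns - 1 - j)" if "u \<in> vsupp n" "j < length Ns" for u j
    using that(2)
  proof (induction j)
    case 0
    then show ?case using cs that(1) by (simp add: last_conv_nth)
  next
    case (Suc j)
    have "(okact ts a ^^ j) u \<in> Ns ! Suc (length Ns - 1 - Suc j)" using Suc by (simp add: Suc_diff_Suc)
    then show ?case using step[of "length Ns - 1 - Suc j"] Suc.prems by simp
  qed
  have "(okact ts a ^^ (length Ns - 1)) (E v) \<in> Ns ! 0"
    using pow[OF E_vsupp[OF v], of "length Ns - 1"] cs by simp
  moreover have "Ns ! 0 = {0}" using cs by (simp add: hd_conv_nth)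
  ultimately have "(okact ts a ^^ (length Ns - 1)) (E v) = 0" by simp
  moreover have "(okact ts a ^^ k) (E v) = E ((oact ts a ^^ k) v) \<and> (oact ts a ^^ k) v \<in> vsupp n" for k
  proof (induction k)
    case (Suc k)
    have "oact ts a ((oact ts a ^^ k) v) \<in> vsupp n"
      by (rule oact_in[OF ts]) (use Suc P.cact_in in auto)
    then show ?case using Suc okact_E[OF ts] by simp
  qed (use v in simp)
  ultimately show ?thesis using E_eq_0 by metis
qed

lemma tev_group:
  assumes ts: "\<forall>(c, G, a)\<in>set ts. G \<in> lists central \<and> standard a \<and> length a \<le> d" and w: "w \<in> vsupp n"
  shows "(\<Sum>t\<leftarrow>ts. tev \<rho> t w) = (\<Sum>a\<in>(\<lambda>t. snd (snd t)) ` set ts. wact a \<rho> (oact ts a w))"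
proof -
  let ?A = "(\<lambda>t. snd (snd t)) ` set ts"
  have "(\<Sum>t\<leftarrow>ts. tev \<rho> t w) = (\<Sum>a\<in>?A. \<Sum>t\<leftarrow>filter (\<lambda>t. snd (snd t) = a) ts. tev \<rho> t w)"
    by (rule sum_list_group) auto
  also have "\<dots> = (\<Sum>a\<in>?A. wact a \<rho> (oact ts a w))"
  proof (intro sum.cong refl)
    fix a assume "a \<in> ?A"
    then have a: "set a \<subseteq> {..<r}" using ts by (fastforce simp: standard_def)
    have "(\<Sum>t\<leftarrow>us. tev \<rho> t w) = wact a \<rho> (\<Sum>(c, G, a')\<leftarrow>us. smult c (fold (cact \<rho>) G w))"
      if "\<forall>(c, G, a')\<in>set us. G \<in> lists central \<and> a' = a" for us
      using that
    proof (induction us)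
      case Nil
      then show ?case using lin_0[OF P.wact_linear[OF a]] by simp
    next
      case (Cons t us)
      obtain c G a' where t [simp]: "t = (c, G, a')" by (cases t)
      have G: "G \<in> lists central" "a' = a" using Cons.prems by auto
      have s: "(\<Sum>(c, G, a')\<leftarrow>vs. smult c (fold (cact \<rho>) G w)) \<in> vsupp n" if "\<forall>(c, G, a')\<in>set vs. G \<in> lists central \<and> a' = a" for vs
        using that w by (induction vs) (auto intro!: subsp_add[OF subsp_vsupp] subsp_smult[OF subsp_vsupp] P.cfold_in)
      have "tev \<rho> t w = wact a \<rho> (smult c (fold (cact \<rho>) G w))"
        using G lin_smult[OF P.wact_linear[OF a] P.cfold_in[OF G(1) w]] by (simp add: tev_def)
      then show ?case
        using Cons lin_add[OF P.wact_linear[OF a] _ s[of us]] P.cfold_in[OF G(1) w]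
        by (simp add: subsp_smult)
    qed
    then show "(\<Sum>t\<leftarrow>filter (\<lambda>t. snd (snd t) = a) ts. tev \<rho> t w) = wact a \<rho> (oact ts a w)"
      unfolding oact_def using ts by (auto simp: case_prod_unfold)
  qed
  finally show ?thesis .
qed

text \<open>The generic operators \<open>\<theta>\<close> give a cyclic submodule of \<open>U \<oplus> N'\<close>; its projection to \<open>U\<close>
  is in the class, and its projection to \<open>N'/N\<close> factors through the one to \<open>U\<close>.\<close>

lemma HH_factor:
  assumes U: "LM U \<sigma>" "m \<in> U"
    and N: "submod X \<rho> (vsupp n) N" "HH N \<rho>" and N': "submod X \<rho> (vsupp n) N'" and lt: "N \<subset> N'"
    and irr: "\<And>T. submod X \<rho> (vsupp n) T \<Longrightarrow> N \<subset> T \<Longrightarrow> \<not> T \<subset> N'"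
    and w: "w \<in> N'" "w \<notin> N"
    and key: "\<And>d \<theta>. NF d \<theta> \<Longrightarrow> \<theta> \<sigma> m = 0 \<Longrightarrow> \<theta> \<rho> w \<in> N"
  shows "HH N' \<rho>"
proof -
  have n: "subsp N" "N \<subseteq> vsupp n" "\<And>x v. x \<in> X \<Longrightarrow> v \<in> N \<Longrightarrow> \<rho> x v \<in> N"
    and n': "subsp N'" "N' \<subseteq> vsupp n" "\<And>x v. x \<in> X \<Longrightarrow> v \<in> N' \<Longrightarrow> \<rho> x v \<in> N'"
    using N N' by (auto simp: submod_def)
  have gU: "gmod X b U \<sigma>" using U by (simp add: LM_def)
  have gN': "gmod X b N' \<rho>" by (rule W.submod_gmod[OF N'])
  let ?\<tau> = "\<lambda>x f. pr (\<sigma> x (p1 f)) (\<rho> x (p2 f))"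
  interpret UN: lmod X b "PR U N'" ?\<tau> by unfold_locales (rule gmod_sum[OF gU gN'])
  interpret U: lmod X b U \<sigma> by unfold_locales (rule gU)
  interpret N': lmod X b N' \<rho> by unfold_locales (rule gN')
  interpret PU: pbw_mod FF S X b emb p pm r e lam U \<sigma> by (rule pbw_modI[OF gU])
  interpret PN: pbw_mod FF S X b emb p pm r e lam N' \<rho> by (rule pbw_modI[OF gN'])
  have NF_in: "\<theta> \<kappa> v \<in> V" if \<theta>: "NF d \<theta>" and V: "gmod X b V \<kappa>" "v \<in> V" for d \<theta> \<kappa> v V
  proof -
    interpret V: pbw_mod FF S X b emb p pm r e lam V \<kappa> by (rule pbw_modI[OF V(1)])
    obtain ts where ts: "\<forall>(c, G, a)\<in>set ts. G \<in> lists central \<and> standard a \<and> length a \<le> d"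
      "\<And>U \<rho> v. gmod X b U \<rho> \<Longrightarrow> v \<in> U \<Longrightarrow> \<theta> \<rho> v = (\<Sum>t\<leftarrow>ts. tev \<rho> t v)"
      by (rule NFE[OF \<theta>]) (rule that)
    have t: "tev \<kappa> t v \<in> V" if "case t of (c, G, a) \<Rightarrow> G \<in> lists central \<and> standard a \<and> length a \<le> d" for t
    proof -
      obtain c G a where "t = (c, G, a)" by (cases t)
      then show ?thesis using that \<open>v \<in> V\<close>
        by (simp add: tev_def standard_def) (intro subsp_smult V.wact_in V.cfold_in V.M.rsub; simp)
    qed
    have "(\<Sum>t\<leftarrow>us. tev \<kappa> t v) \<in> V" if "\<forall>(c, G, a)\<in>set us. G \<in> lists central \<and> standard a \<and> length a \<le> d" for us
      using that by (induction us) (auto simp: subsp_add t)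
    then show ?thesis using ts V by simp
  qed
  \<comment> \<open>The cyclic submodule of the direct sum generated by the pair of \<open>m\<close>
    and \<open>w\<close>, written as all normal forms applied to that pair.\<close>
  define D where "D = {pr (\<theta> \<sigma> m) (\<theta> \<rho> w) | \<theta>. \<exists>d. NF d \<theta>}"
  have DI: "pr (\<theta> \<sigma> m) (\<theta> \<rho> w) \<in> D" if "NF d \<theta>" for d \<theta> using that by (auto simp: D_def)
  have DE: "\<exists>d \<theta>. NF d \<theta> \<and> x = pr (\<theta> \<sigma> m) (\<theta> \<rho> w)" if "x \<in> D" for x using that by (auto simp: D_def)
  have Dsub: "subsp D"
  proof (rule subspI)
    have "pr 0 0 = (0 :: 'a vec)" by (simp add: pr_eq_iff[of "pr _ _"])
    then show "0 \<in> D" using DI[OF NF_zero] by simp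
  next
    fix x y assume "x \<in> D" "y \<in> D"
    then obtain d \<theta> d' \<eta> where x: "NF d \<theta>" "x = pr (\<theta> \<sigma> m) (\<theta> \<rho> w)" and y: "NF d' \<eta>" "y = pr (\<eta> \<sigma> m) (\<eta> \<rho> w)"
      using DE by meson
    have "NF (max d d') \<theta>" "NF (max d d') \<eta>" using NF_mono[OF x(1)] NF_mono[OF y(1)] by auto
    from DI[OF NF_add[OF this]] show "x + y \<in> D" by (simp add: x y) (metis p1_pr p2_pr p_linear(1,2) pr_p)
  next
    fix k x assume "x \<in> D"
    then obtain d \<theta> where x: "NF d \<theta>" "x = pr (\<theta> \<sigma> m) (\<theta> \<rho> w)" using DE by meson
    from DI[OF NF_smult[OF x(1)], of k] show "smult k x \<in> D" by (simp add: x) (metis p1_pr p2_pr p_linear(7,8) pr_p)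
  qed
  have DU: "D \<subseteq> PR U N'" using NF_in[OF _ gU U(2)] NF_in[OF _ gN' w(1)] by (auto simp: D_def)
  have Dact: "?\<tau> x f \<in> D" if x: "x \<in> X" and f: "f \<in> D" for x f
  proof -
    obtain d \<theta> where "NF d \<theta>" "f = pr (\<theta> \<sigma> m) (\<theta> \<rho> w)" using DE[OF f] by blast
    then show ?thesis using DI[OF NF_act[OF _ x, of d \<theta>]] by simp
  qed
  have one: "pr m w \<in> D"
  proof -
    have "NF 0 (wact [])" by (rule NF_wact) auto
    from DI[OF this] show ?thesis by (simp add: wact_def)
  qed
  have gD: "gmod X b D ?\<tau>" by (rule UN.submodule[OF Dsub DU Dact])
  interpret D: lmod X b D ?\<tau> by unfold_locales (rule gD)
  let ?D1 = "p1 ` D"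
  have D1: "subsp ?D1" "?D1 \<subseteq> U" "\<And>x v. x \<in> X \<Longrightarrow> v \<in> ?D1 \<Longrightarrow> \<sigma> x v \<in> ?D1"
  proof -
    show "subsp ?D1" using subsp_image[OF Dsub, of p1] by (simp add: linear_on_def)
    show "?D1 \<subseteq> U" using DU by auto
    show "\<sigma> x v \<in> ?D1" if "x \<in> X" "v \<in> ?D1" for x v
    proof -
      obtain f where "f \<in> D" "v = p1 f" using \<open>v \<in> ?D1\<close> by blast
      then show ?thesis using Dact[OF that(1), of f] by (intro image_eqI[of _ _ "?\<tau> x f"]) auto
    qed
  qed
  have HD1: "HH ?D1 \<sigma>"
    by (rule HH_submodule[OF LM_S[OF U(1)] _ D1(1,2)]) (use U SX(1) D1(3) in \<open>auto simp: LM_def\<close>)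
  have gSD: "gmod S b D ?\<tau>" and gSN': "gmod S b N' \<rho>" using D.restrict N'.restrict SX(2) by auto
  interpret SD: lmod S b D ?\<tau> by unfold_locales (rule gSD)
  interpret SN': lmod S b N' \<rho> by unfold_locales (rule gSN')
  have f: "surj_hom (PR S D) (SB b ?\<tau>) (PR S ?D1) (SB b \<sigma>) (\<lambda>k. pr (p1 k) (p1 (p2 k)))"
    by (rule surj_hom_semidirect[OF surj_hom_id]) (auto simp: linear_on_def Dsub)
  have B: "ideal_of (PR {0} N) (PR S N') (SB b \<rho>)"
    unfolding ideal_of_def
  proof (intro conjI ballI)
    show "subsp (PR {0} N)" using n by (auto intro!: subspI simp: subsp_add subsp_smult)
    show "PR {0} N \<subseteq> PR S N'" using lt by auto
    fix x y assume "x \<in> PR S N'" "y \<in> PR {0} N"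
    then show "SB b \<rho> x y \<in> PR {0} N" using n SX(1) lt by auto
  qed
  obtain Y c q where Y: "lie_alg Y c" "surj_hom (PR S N') (SB b \<rho>) Y c q" "kern (PR S N') q = PR {0} N"
    by (rule quotient_exists[OF SN'.lie_semidirect B]) (rule that)
  note qD = surj_homD[OF Y(2)]
  have q0: "q k = 0 \<longleftrightarrow> p1 k = 0 \<and> p2 k \<in> N" if "k \<in> PR S N'" for k
  proof -
    have "q k = 0 \<longleftrightarrow> k \<in> kern (PR S N') q" using that by (simp add: kern_def)
    then show ?thesis by (simp add: Y(3))
  qed
  let ?T = "{x + y | x y. x \<in> p2 ` D \<and> y \<in> N}"
  have D2: "subsp (p2 ` D)" "p2 ` D \<subseteq> N'"
    using subsp_image[OF Dsub, of p2] DU by (auto simp: linear_on_def)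
  \<comment> \<open>The second projection of \<open>D\<close> contains \<open>w\<close>, so together
    with \<open>N\<close> it is a submodule strictly above \<open>N\<close>; irreducibility makes it
    all of \<open>N'\<close>.\<close>
  have TN': "?T = N'"
  proof -
    have sm: "submod X \<rho> (vsupp n) ?T"
      unfolding submod_def
    proof (intro conjI ballI)
      show "subsp ?T" by (rule subsp_sums[OF D2(1) n(1)])
      show "?T \<subseteq> vsupp n" using D2 n n' by (auto intro!: subsp_add[OF subsp_vsupp])
      fix x v assume x: "x \<in> X" and "v \<in> ?T"
      then obtain f y where v: "v = p2 f + y" "f \<in> D" "y \<in> N" by blast
      have "p2 f \<in> vsupp n" "y \<in> vsupp n" using v D2 n' n by auto
      then have "\<rho> x v = p2 (?\<tau> x f) + \<rho> x y" using x by (simp add: v W.act_add)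
      moreover have "p2 (?\<tau> x f) \<in> p2 ` D" using Dact[OF x v(2)] by blast
      moreover have "\<rho> x y \<in> N" using n x v by blast
      ultimately show "\<rho> x v \<in> ?T" by blast
    qed
    have NT: "N \<subseteq> ?T" by (rule sums_right[OF D2(1)])
    have "w \<in> ?T"
    proof -
      have "w = p2 (pr m w) + 0" by simp
      then show ?thesis using one n subsp_0 by blast
    qed
    then have NT': "N \<noteq> ?T" using w(2) by metis
    have TN: "?T \<subseteq> N'"
    proof
      fix v assume "v \<in> ?T"
      then obtain f y where "v = p2 f + y" "f \<in> D" "y \<in> N" by blast
      moreover from this have "p2 f \<in> N'" "y \<in> N'" using D2 lt by blast+
      ultimately show "v \<in> N'" using n' by (simp add: subsp_add)
    qed
    show ?thesis
    proof (rule ccontr)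
      assume "?T \<noteq> N'"
      then have "?T \<subset> N'" by (rule psubsetI[OF TN])
      then show False by (rule notE[OF irr[OF sm psubsetI[OF NT NT']]])
    qed
  qed
  let ?g = "\<lambda>k. q (pr (p1 k) (p2 (p2 k)))"
  have pp: "pr (p1 k) (p2 (p2 k)) \<in> PR S N'" if "k \<in> PR S D" for k using that D2 by auto
  have g: "surj_hom (PR S D) (SB b ?\<tau>) Y c ?g"
  proof (rule surj_homI)
    have "linear_on (PR S D) (\<lambda>k. pr (p1 k) (p2 (p2 k)))" by (auto simp: linear_on_def pr_eq_iff[of "pr _ _"])
    then show "linear_on (PR S D) ?g" by (rule linear_on_comp[OF _ qD(1)]) (use pp in auto)
    show "?g ` PR S D = Y"
    proof
      show "?g ` PR S D \<subseteq> Y" using pp qD(4) by blast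
      show "Y \<subseteq> ?g ` PR S D"
      proof
        fix y assume "y \<in> Y"
        then obtain k where k: "k \<in> PR S N'" "y = q k" using qD(2) by blast
        then have "p2 k \<in> ?T" unfolding TN' by simp
        then obtain f v where fv: "p2 k = p2 f + v" "f \<in> D" "v \<in> N" by blast
        have vN: "v \<in> N'" using fv lt by blast
        have mem: "pr (p1 k) f \<in> PR S D" "pr 0 v \<in> PR S N'" using k fv vN by auto
        have "k = pr (p1 k) (p2 f) + pr 0 v" using fv by (simp add: pr_eq_iff[of k])
        then have "q k = q (pr (p1 k) (p2 f)) + q (pr 0 v)"
          using lin_add[OF qD(1) pp[OF mem(1)] mem(2)] by simp
        also have "q (pr 0 v) = 0" using q0[OF mem(2)] fv by simp
        finally have "y = ?g (pr (p1 k) f)" using k by simp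
        then show "y \<in> ?g ` PR S D" using mem by blast
      qed
    qed
    fix k l assume kl: "k \<in> PR S D" "l \<in> PR S D"
    have "pr (p1 (SB b ?\<tau> k l)) (p2 (p2 (SB b ?\<tau> k l))) = SB b \<rho> (pr (p1 k) (p2 (p2 k))) (pr (p1 l) (p2 (p2 l)))"
      by (simp add: pr_eq_iff[of "pr _ _"])
    then show "?g (SB b ?\<tau> k l) = c (?g k) (?g l)" using qD(3)[OF pp[OF kl(1)] pp[OF kl(2)]] by simp
  qed
  interpret SDlie: lie "PR S D" "SB b ?\<tau>" by unfold_locales (rule SD.lie_semidirect)
  \<comment> \<open>An element of \<open>D\<close> with zero first component is a normal form
    killing \<open>m\<close>, and \<open>key\<close> then puts its second component into
    \<open>N\<close>. Hence the map to the factor depends on the first component only.\<close>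
  obtain h where h: "surj_hom (PR S ?D1) (SB b \<sigma>) Y c h"
  proof (rule factor_hom[OF SDlie.sub f g])
    fix k assume k: "k \<in> PR S D" "pr (p1 k) (p1 (p2 k)) = 0"
    have "p1 k = 0" "p1 (p2 k) = 0" using arg_cong[OF k(2), of p1] arg_cong[OF k(2), of p2] by simp_all
    obtain d \<theta> where "NF d \<theta>" "p2 k = pr (\<theta> \<sigma> m) (\<theta> \<rho> w)" using DE[of "p2 k"] k by auto
    then have "p2 (p2 k) \<in> N" using key[of d \<theta>] \<open>p1 (p2 k) = 0\<close> by simp
    then show "?g k = 0" using q0[OF pp[OF k(1)]] \<open>p1 k = 0\<close> by simp
  qed (use SDlie.cl that in auto)
  have YF: "(Y, c) \<in> FF" using F_image[OF HD1[unfolded HH_def] h Y(1)] .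
  show ?thesis
  proof (rule HH_climb[OF gSN' n(1) _ _ N(2) YF Y(2)])
    show "N \<subseteq> N'" using lt by blast
    show "\<rho> x v \<in> N" if "x \<in> S" "v \<in> N" for x v using n SX(1) that by blast
    show "q (pr 0 v) = 0 \<longleftrightarrow> v \<in> N" if "v \<in> N'" for v using q0[of "pr 0 v"] that by simp
  qed
qed

end

context main_mod
begin

text \<open>One auxiliary pair of \<open>U\<close> and \<open>m\<close> has to serve all composition
  factors, so it is built from the eigenfunctions of all characters at once; the composition series
  over the ground field is then climbed with \<open>HH_factor\<close>.\<close>

lemma HH_of_cluster:
  assumes cl: "\<And>\<chi>. \<chi> \<in> char_cluster p emb X pm n \<rho> \<Longrightarrow> attained \<chi>"
  shows "HH (vsupp n) \<rho>"
proof -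
  obtain r e lam where pb: "pbw FF S X b emb p pm r e lam" by (rule pbw_exists)
  interpret pbw FF S X b emb p pm r e lam by (rule pb)
  interpret pbw_main_mod FF S X b emb p pm r e lam n \<rho> by unfold_locales
  \<comment> \<open>Two series are in play: \<open>Ks\<close> over the closure supplies the
    characters, \<open>Ns\<close> over the ground field is the one that is climbed.\<close>
  obtain Ks where Ks: "comp_series X \<epsilon> (vsupp n) Ks" by (rule ext_series_exists)
  have "\<exists>\<chi> \<Psi>. has_character p X pm \<epsilon> (Ks ! i) (Ks ! Suc i) \<chi> \<and> coef \<Psi> \<and> eig \<Psi> \<chi> \<and> \<Psi> [] \<noteq> 0"
    if i: "Suc i < length Ks" for i
  proof -
    obtain \<chi> where \<chi>: "\<And>x. x \<notin> X \<Longrightarrow> \<chi> x = 0" "has_character p X pm \<epsilon> (Ks ! i) (Ks ! Suc i) \<chi>"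
      using character_exists[OF Ks i] by metis
    have "\<chi> \<in> char_cluster p emb X pm n \<rho>" unfolding char_cluster_def using \<chi> Ks i by blast
    then show ?thesis using cl \<chi>(2) unfolding attained_def by blast
  qed
  then obtain \<chi> \<Psi> where \<chi>: "\<And>i. Suc i < length Ks \<Longrightarrow> has_character p X pm \<epsilon> (Ks ! i) (Ks ! Suc i) (\<chi> i)"
    and \<Psi>: "\<And>i. Suc i < length Ks \<Longrightarrow> coef (\<Psi> i)" "\<And>i. Suc i < length Ks \<Longrightarrow> eig (\<Psi> i) (\<chi> i)"
      "\<And>i. Suc i < length Ks \<Longrightarrow> \<Psi> i [] \<noteq> 0"
    by metis
  \<comment> \<open>Exponents below \<open>p\<close> leave finitely many standard words, so
    \<open>coef_common\<close> can collect all dual words in one module.\<close>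
  have fin: "finite {a. standard a}"
  proof (rule finite_subset)
    show "{a. standard a} \<subseteq> {a. set a \<subseteq> {..<r} \<and> length a \<le> r * p}"
    proof safe
      fix a assume a: "standard a"
      have "length a = (\<Sum>i\<in>set a. count_list a i)" by (simp add: sum_count_set)
      also have "\<dots> \<le> (\<Sum>i\<in>set a. p)" using a by (intro sum_mono) (simp add: standard_def less_imp_le)
      also have "\<dots> = card (set a) * p" by simp
      also have "\<dots> \<le> r * p"
        using a card_mono[of "{..<r}" "set a"] by (intro mult_right_mono) (auto simp: standard_def)
      finally show "length a \<le> r * p" .
    qed (auto simp: standard_def)
    show "finite {a. set a \<subseteq> {..<r} \<and> length a \<le> r * p}" by (rule finite_lists_length_le) simp
  qed
  let ?F = "(\<lambda>(i, a). dual_word (\<Psi> i) a) ` ({i. Suc i < length Ks} \<times> {a. standard a})"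
  have "finite {i. Suc i < length Ks}" by (rule finite_subset[of _ "{..<length Ks}"]) auto
  then have "finite ?F" using fin by simp
  moreover have "coef \<Phi>" if "\<Phi> \<in> ?F" for \<Phi>
    using that \<Psi>(1) by (auto simp: standard_def intro!: dual_word_coef)
  ultimately obtain U \<sigma> m where U: "LM U \<sigma>" "m \<in> U"
    and K: "\<forall>\<Phi>\<in>?F. \<exists>K. cfun emb K \<and> (\<forall>w\<in>lists X. \<Phi> w = K (fold \<sigma> w m))"
    using coef_common[of ?F] by blast
  have gU: "gmod X b U \<sigma>" using U by (simp add: LM_def)
  obtain Ns where Ns: "comp_series X \<rho> (vsupp n) Ns"
    using comp_series_exists[OF subset_refl W.submod_whole W.submod_zero] by blast
  have cs: "Ns \<noteq> []" "hd Ns = {0}" "last Ns = vsupp n" using Ns by (auto simp: comp_series_def)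
  have gS: "gmod S b (vsupp n) \<rho>" using W.restrict SX(2) by blast
  have "j < length Ns \<Longrightarrow> HH (Ns ! j) \<rho>" for j
  proof (induction j)
    case 0
    then show ?case using cs HH_zero[OF gS] by (simp add: hd_conv_nth)
  next
    case (Suc j)
    let ?N = "Ns ! j" and ?N' = "Ns ! Suc j"
    have sub: "submod X \<rho> (vsupp n) ?N" "submod X \<rho> (vsupp n) ?N'" using comp_series_submod[OF Ns] Suc.prems by auto
    then have N: "subsp ?N" "?N \<subseteq> vsupp n" "\<And>x v. x \<in> X \<Longrightarrow> v \<in> ?N \<Longrightarrow> \<rho> x v \<in> ?N"
      and N': "subsp ?N'" "?N' \<subseteq> vsupp n" "\<And>x v. x \<in> X \<Longrightarrow> v \<in> ?N' \<Longrightarrow> \<rho> x v \<in> ?N'"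
      by (auto simp: submod_def)
    have lt: "?N \<subset> ?N'" and irr: "\<And>T. submod X \<rho> (vsupp n) T \<Longrightarrow> ?N \<subset> T \<Longrightarrow> \<not> T \<subset> ?N'"
      using Ns Suc.prems by (auto simp: comp_series_def)
    obtain w where w: "w \<in> ?N'" "w \<notin> ?N" using lt by blast
    have wn: "w \<in> vsupp n" using w N' by blast
    have HN: "HH ?N \<rho>" using Suc by simp
    show ?case
    proof (rule HH_factor[OF U sub(1) HN sub(2) lt irr w])
      fix d \<theta> assume \<theta>: "NF d \<theta>" and z: "\<theta> \<sigma> m = 0"
      obtain ts where ts: "\<forall>(c, G, a)\<in>set ts. G \<in> lists central \<and> standard a \<and> length a \<le> d"
        "\<And>U \<rho> v. gmod X b U \<rho> \<Longrightarrow> v \<in> U \<Longrightarrow> \<theta> \<rho> v = (\<Sum>t\<leftarrow>ts. tev \<rho> t v)"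
        by (rule NFE[OF \<theta>]) (rule that)
      have tsc: "\<forall>(c, G, a)\<in>set ts. G \<in> lists central" using ts(1) by auto
      have z': "(\<Sum>t\<leftarrow>ts. tev \<sigma> t m) = 0" using z ts(2)[OF gU U(2)] by simp
      have mc: "monomial_coeff (\<chi> i) ts a = 0" if i: "Suc i < length Ks" and a: "standard a" for i a
      proof (rule monomial_coeff_zero[OF gU U(2) ts(1) z' _ \<Psi>(2,3)[OF i] a])
        fix a' assume "standard a'"
        then have "dual_word (\<Psi> i) a' \<in> ?F" using i by auto
        then show "\<exists>K. cfun emb K \<and> (\<forall>w\<in>lists X. dual_word (\<Psi> i) a' w = K (fold \<sigma> w m))" using K by blast
      qed
      have cN: "cact \<rho> g v \<in> M" if "g \<in> central" "v \<in> M" "subsp M" "\<And>x v. x \<in> X \<Longrightarrow> v \<in> M \<Longrightarrow> \<rho> x v \<in> M" for g v M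
      proof -
        have "(\<rho> x ^^ k) v \<in> M" if "x \<in> X" for x k using that \<open>v \<in> M\<close> \<open>\<And>x v. x \<in> X \<Longrightarrow> v \<in> M \<Longrightarrow> \<rho> x v \<in> M\<close> by (induction k) auto
        then show ?thesis using that centreX
          by (auto simp: central_def cact_def zeta_def intro!: subsp_diff[OF that(3)])
      qed
      \<comment> \<open>The operator commutes with the action, so the vectors of \<open>?N'\<close>
        that it sends into \<open>?N\<close> form a submodule. If \<open>w\<close> were not among
        them, that submodule would be \<open>?N\<close>, and all iterates of \<open>w\<close> would
        stay outside \<open>?N\<close>, against nilpotency.\<close>
      have oN: "oact ts a w \<in> ?N" if a: "standard a" for a
      proof (rule ccontr)
        assume no: "oact ts a w \<notin> ?N"
        let ?T = "{v \<in> ?N'. oact ts a v \<in> ?N}"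
        have ol: "linear_on ?N' (oact ts a)" using linear_on_subset[OF oact_linear[OF tsc] N'(2)] .
        have oin: "oact ts a v \<in> ?N'" if "v \<in> ?N'" for v
          by (rule oact_in[OF tsc N'(1) cN that]) (use N' in auto)
        have oin': "oact ts a v \<in> ?N" if "v \<in> ?N" for v
          by (rule oact_in[OF tsc N(1) cN that]) (use N in auto)
        have "submod X \<rho> (vsupp n) ?T" unfolding submod_def
        proof (intro conjI ballI)
          show "subsp ?T" by (rule subsp_vimage[OF N'(1) ol N(1)])
          fix x v assume x: "x \<in> X" and v: "v \<in> ?T"
          then have "oact ts a (\<rho> x v) = \<rho> x (oact ts a v)" using oact_commute[OF tsc x, of v a] N' by blast
          then show "\<rho> x v \<in> ?T" using x v N N' by auto
        qed (use N' in auto)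
        moreover have "?N \<subseteq> ?T" using lt oin' by blast
        moreover have "?T \<subset> ?N'" using w no by blast
        ultimately have T: "?T = ?N" using irr[of ?T] by blast
        have "(oact ts a ^^ k) w \<in> ?N' \<and> (oact ts a ^^ k) w \<notin> ?N" for k
        proof (induction k)
          case (Suc k)
          then show ?case using oin T by auto
        qed (use w in simp)
        moreover have "(oact ts a ^^ (length Ks - 1)) w = 0"
          by (rule oact_nilpotent[OF Ks \<chi> tsc mc[OF _ a] wn])
        ultimately show False using N(1) subsp_0 by metis
      qed
      have "\<theta> \<rho> w = (\<Sum>a\<in>(\<lambda>t. snd (snd t)) ` set ts. wact a \<rho> (oact ts a w))"
        using ts(2)[OF W.gm wn] tev_group[OF ts(1) wn] by simp
      also have "\<dots> \<in> ?N"
      proof (rule subsp_sum[OF N(1)])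
        fix a assume "a \<in> (\<lambda>t. snd (snd t)) ` set ts"
        then have a: "standard a" using ts(1) by auto
        have "fold \<rho> u v \<in> ?N" if "u \<in> lists X" "v \<in> ?N" for u v
          using that N by (induction u arbitrary: v) auto
        then show "wact a \<rho> (oact ts a w) \<in> ?N" using oN[OF a] a by (simp add: wact_fold standard_def)
      qed
      finally show "\<theta> \<rho> w \<in> ?N" .
    qed
  qed
  from this[of "length Ns - 1"] show ?thesis using cs by (simp add: last_conv_nth)
qed

end

theorem theorem1:
  fixes p :: nat
    and FF :: "('a::field) lie_class"
    and X :: "'a vec set" and b :: "'a br" and pm :: "'a vec \<Rightarrow> 'a vec"
    and S :: "'a vec set"
    and emb :: "'a \<Rightarrow> 'k::field"
    and nV nW :: nat and \<rho>V \<rho>W :: "'a vec \<Rightarrow> 'a vec \<Rightarrow> 'a vec"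
  assumes "prime p" and "CHAR('a) = p"
    and "formation FF" and "saturated FF"
    and "lie_alg X b" and "restricted p X b pm"
    and "\<forall>z\<in>centre X b. pm z = 0"
    and "subnormal S X b" and "S \<noteq> {0}" and "(S, b) \<in> FF"
    and "is_alg_closure emb"
    and "lie_mod X b nV \<rho>V" and "lie_mod X b nW \<rho>W"
    and "char_cluster p emb X pm nW \<rho>W \<subseteq> Fp_span (char_cluster p emb X pm nV \<rho>V)"
    and "fhypercentral FF S b nV \<rho>V"
  shows "fhypercentral FF S b nW \<rho>W"
proof -
  interpret main FF S X b emb p pm
    by unfold_locales (use assms in auto)
  interpret V: main_mod FF S X b emb p pm nV \<rho>V
    by unfold_locales (use assms(12) in \<open>simp add: lie_mod_gmod\<close>)
  interpret W: main_mod FF S X b emb p pm nW \<rho>W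
    by unfold_locales (use assms(13) in \<open>simp add: lie_mod_gmod\<close>)
  have "HH (vsupp nV) \<rho>V"
    by (rule fhypercentral_imp_HH[OF V.W.restrict[OF SX(2)] assms(15)])
  then have "attained \<chi>" if "\<chi> \<in> char_cluster p emb X pm nV \<rho>V" for \<chi>
    using V.coef_character that unfolding attained_def by blast
  then have "attained \<chi>" if "\<chi> \<in> char_cluster p emb X pm nW \<rho>W" for \<chi>
    using attained_Fp_span that assms(14) by blast
  then have "HH (vsupp nW) \<rho>W" by (rule W.HH_of_cluster)
  then show ?thesis by (rule HH_imp_fhypercentral[OF W.W.restrict[OF SX(2)]])
qed

end
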